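(* Let $f\in C^2(\mathbb{R}^n,\mathbb{R})$ and $F_1,F_2\in C^2(\mathbb{R}^n,\mathbb{R}^\kappa)$ be the defining functions of MPCC, and let $\mathcal{S}_t$, with feasible set $M^{\mathcal{S}}_t$, be its Scholtes regularization with parameter $t>0$. Let $\bar x\in M$ be a nondegenerate C-stationary point of MPCC with C-index $c$ which additionally fulfills NDC4. Then, for every sufficiently small neighborhood $U$ of $\bar x$ there is $t_0>0$ such that for all $t\in(0,t_0)$: there exists a nondegenerate Karush-Kuhn-Tucker point $x^t\in M^{\mathcal{S}}_t$ of $\mathcal{S}_t$ within $U$ which has the same quadratic index $c$; moreover, $x^t$ is the unique Karush-Kuhn-Tucker point of $\mathcal{S}_t$ in $U$.
   Context: **MPCC.** $\min_x f(x)$ s.t. $x\in M$, where $M=\{x\in\mathbb{R}^n\mid F_{1,j}(x)F_{2,j}(x)=0,\ F_{1,j}(x)\ge 0,\ F_{2,j}(x)\ge 0,\ j=1,\dots,\kappa\}$. $D$ and $D^2$ denote differential and Hessian. For $\bar x\in M$ put $a_{01}(\bar x)=\{j\mid F_{1,j}(\bar x)=0,F_{2,j}(\bar x)>0\}$, $a_{10}(\bar x)=\{j\mid F_{1,j}(\bar x)>0,F_{2,j}(\bar x)=0\}$, $a_{00}(\bar x)=\{j\mid F_{1,j}(\bar x)=0,F_{2,j}(\bar x)=0\}$. **C-stationarity.** $\bar x\in M$ is C-stationary with multipliers $(\bar\sigma,\bar\varrho)$, consisting of $\bar\sigma_{1,j}$ ($j\in a_{01}(\bar x)$), $\bar\sigma_{2,j}$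 ($j\in a_{10}(\bar x)$), $\bar\varrho_{1,j},\bar\varrho_{2,j}$ ($j\in a_{00}(\bar x)$), if $$Df(\bar x)=\sum_{j\in a_{01}(\bar x)}\bar\sigma_{1,j}DF_{1,j}(\bar x)+\sum_{j\in a_{10}(\bar x)}\bar\sigma_{2,j}DF_{2,j}(\bar x)+\sum_{j\in a_{00}(\bar x)}\big(\bar\varrho_{1,j}DF_{1,j}(\bar x)+\bar\varrho_{2,j}DF_{2,j}(\bar x)\big)$$ and $\bar\varrho_{1,j}\bar\varrho_{2,j}\ge 0$ for all $j\in a_{00}(\bar x)$. The Lagrange function is $$L(x)=f(x)-\sum_{j\in a_{01}(\bar x)}\bar\sigma_{1,j}F_{1,j}(x)-\sum_{j\in a_{10}(\bar x)}\bar\sigma_{2,j}F_{2,j}(x)-\sum_{j\in a_{00}(\bar x)}\big(\bar\varrho_{1,j}F_{1,j}(x)+\bar\varrho_{2,j}F_{2,j}(x)\big),$$ and the tangent space is $\mathcal{T}_{\bar x}=\{\xi\in\mathbb{R}^n\mid DF_{1,j}(\bar x)\xi=0,\ j\in a_{01}(\bar x)\cup a_{00}(\bar x);\ DF_{2,j}(\bar x)\xi=0,\ j\in a_{10}(\bar x)\cup a_{00}(\bar x)\}$. A C-stationary point $\bar x$ with multipliers $(\bar\sigma,\bar\varrho)$ is **nondegenerate** if - NDC1: MPCC-LICQ holds, i.e. the vectors $DF_{1,j}(\bar x)$, $j\in a_{01}(\bar x)\cup a_{00}(\bar x)$, $DF_{2,j}(\bar x)$, $j\in a_{10}(\bar x)\cup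 a_{00}(\bar x)$, are linearly independent (so the multipliers are unique); - NDC2: $\bar\varrho_{1,j}\bar\varrho_{2,j}>0$ for all $j\in a_{00}(\bar x)$; - NDC3: the restricted Hessian $D^2L(\bar x)\restriction_{\mathcal{T}_{\bar x}}$ is nonsingular. Additional condition NDC4: $\bar\sigma_{1,j}\ne0$ for all $j\in a_{01}(\bar x)$ and $\bar\sigma_{2,j}\neq 0$ for all $j\in a_{10}(\bar x)$. **C-index** of a nondegenerate C-stationary point: $CI=QI+BI$, where $QI$ is the number of negative eigenvalues of $D^2L(\bar x)\restriction_{\mathcal{T}_{\bar x}}$ and $BI$ is the number of $j\in a_{00}(\bar x)$ with $\bar\varrho_{1,j},\bar\varrho_{2,j}<0$. **Scholtes regularization** $\mathcal{S}_t$, $t>0$: $\min_x f(x)$ s.t. $x\in M^{\mathcal{S}}_t=\{x\in\mathbb{R}^n\mid F_{1,j}(x)F_{2,j}(x)\le t,\ F_{1,j}(x)\ge0,\ F_{2,j}(x)\ge0,\ j=1,\dots,\kappa\}$. Active index sets: $\mathcal{H}(x)=\{j\mid F_{1,j}(x)F_{2,j}(x)=t\}$, $\mathcal{N}_1(x)=\{j\mid F_{1,j}(x)=0\}$, $\mathcal{N}_2(x)=\{j\mid F_{2,j}(x)=0\}$. A point $x\in M^{\mathcal{S}}_t$ is a **Karush-Kuhn-Tucker point** with multipliers $(\eta,\nu)$ if $$Df(x)=-\sum_{j=1}^\kappa\eta_j\big(F_{2,j}(x)DF_{1,j}(x)+F_{1,j}(x)DF_{2,j}(x)\big)+\sum_{j=1}^\kappa\nu_{1,j}DF_{1,j}(x)+\sum_{j=1}^\kappa\nu_{2,j}DF_{2,j}(x),$$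 with $\eta_j,\nu_{1,j},\nu_{2,j}\ge0$, $\eta_j(t-F_{1,j}(x)F_{2,j}(x))=0$, $\nu_{1,j}F_{1,j}(x)=0$, $\nu_{2,j}F_{2,j}(x)=0$ for all $j$. Its Lagrange function is $L^{\mathcal{S}}(x)=f(x)-\sum_j\eta_j(t-F_{1,j}(x)F_{2,j}(x))-\sum_j\nu_{1,j}F_{1,j}(x)-\sum_j\nu_{2,j}F_{2,j}(x)$ (multipliers fixed), and $\mathcal{T}^{\mathcal{S}}_x=\{\xi\mid (F_{2,j}(x)DF_{1,j}(x)+F_{1,j}(x)DF_{2,j}(x))\xi=0,\ j\in\mathcal{H}(x);\ DF_{1,j}(x)\xi=0,\ j\in\mathcal{N}_1(x);\ DF_{2,j}(x)\xi=0,\ j\in\mathcal{N}_2(x)\}$. It is **nondegenerate** if - ND1 (LICQ): the vectors $F_{2,j}(x)DF_{1,j}(x)+F_{1,j}(x)DF_{2,j}(x)$, $j\in\mathcal{H}(x)$, $DF_{1,j}(x)$, $j\in\mathcal{N}_1(x)$, $DF_{2,j}(x)$, $j\in\mathcal{N}_2(x)$, are linearly independent; - ND2: $\eta_j>0$ for $j\in\mathcal{H}(x)$, $\nu_{1,j}>0$ for $j\in\mathcal{N}_1(x)$, $\nu_{2,j}>0$ for $j\in\mathcal{N}_2(x)$; - ND3: $D^2L^{\mathcal{S}}(x)\restriction_{\mathcal{T}^{\mathcal{S}}_x}$ is nonsingular. Its **quadratic index** is the number of negative eigenvalues of $D^2L^{\mathcal{S}}(x)\restriction_{\mathcal{T}^{\mathcal{S}}_x}$.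 *)

theory Defs
  imports "HOL-Analysis.Analysis"
begin

section \<open>Derivatives\<close>

definition grad :: "(real^'n \<Rightarrow> real) \<Rightarrow> real^'n \<Rightarrow> real^'n" where
  "grad g x = (\<chi> i. frechet_derivative g (at x) (axis i 1))"

definition hess :: "(real^'n \<Rightarrow> real) \<Rightarrow> real^'n \<Rightarrow> real^'n^'n" where
  "hess g x = jacobian (grad g) (at x)"

definition C2 :: "(real^'n \<Rightarrow> real) \<Rightarrow> bool" where
  "C2 g \<longleftrightarrow> (\<forall>x. g differentiable (at x)) \<and> (\<forall>x. grad g differentiable (at x))
     \<and> continuous_on UNIV (hess g)"

section \<open>Linear algebra\<close>

text \<open>Linear independence of a family indexed by a set: repeated vectors make it dependent,
  hence the injectivity requirement.\<close>

definition lin_indep_family :: "('i \<Rightarrow> 'v::real_vector) \<Rightarrow> 'i set \<Rightarrow> bool" where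
  "lin_indep_family v I \<longleftrightarrow> inj_on v I \<and> independent (v ` I)"

text \<open>The restriction of a symmetric matrix \<open>A\<close> to a subspace \<open>T\<close>, as an operator from \<open>T\<close> to \<open>T\<close>:
  apply \<open>A\<close>, then project orthogonally onto \<open>T\<close>. With respect to an orthonormal basis of \<open>T\<close>,
  written as the columns of \<open>V\<close>, its matrix is \<open>transpose V ** A ** V\<close>.\<close>

definition restrict_op :: "real^'n^'n \<Rightarrow> (real^'n) set \<Rightarrow> real^'n \<Rightarrow> real^'n" where
  "restrict_op A T \<xi> = closest_point T (A *v \<xi>)"

definition restrict_nonsingular :: "real^'n^'n \<Rightarrow> (real^'n) set \<Rightarrow> bool" where
  "restrict_nonsingular A T \<longleftrightarrow> bij_betw (restrict_op A T) T T"

definition restrict_eigenspace :: "real^'n^'n \<Rightarrow> (real^'n) set \<Rightarrow> real \<Rightarrow> (real^'n) set" where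
  "restrict_eigenspace A T \<mu> = {\<xi>\<in>T. restrict_op A T \<xi> = \<mu> *\<^sub>R \<xi>}"

definition restrict_eigenvalues :: "real^'n^'n \<Rightarrow> (real^'n) set \<Rightarrow> real set" where
  "restrict_eigenvalues A T = {\<mu>. \<exists>\<xi>\<in>restrict_eigenspace A T \<mu>. \<xi> \<noteq> 0}"

text \<open>Eigenvalues are counted with multiplicity; for symmetric \<open>A\<close> the geometric and the
  algebraic multiplicities agree. The sum is over a finite set when \<open>T\<close> is a subspace.\<close>

definition num_neg_eigenvalues :: "real^'n^'n \<Rightarrow> (real^'n) set \<Rightarrow> nat" where
  "num_neg_eigenvalues A T =
     (\<Sum>\<mu> \<in> {\<mu> \<in> restrict_eigenvalues A T. \<mu> < 0}. dim (restrict_eigenspace A T \<mu>))"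

section \<open>Mathematical programs with complementarity constraints\<close>

definition mpcc_feasible ::
  "(real^'n \<Rightarrow> real^'k) \<Rightarrow> (real^'n \<Rightarrow> real^'k) \<Rightarrow> (real^'n) set" where
  "mpcc_feasible F1 F2 = {x. \<forall>j. F1 x $ j * F2 x $ j = 0 \<and> F1 x $ j \<ge> 0 \<and> F2 x $ j \<ge> 0}"

definition a01 :: "(real^'n \<Rightarrow> real^'k) \<Rightarrow> (real^'n \<Rightarrow> real^'k) \<Rightarrow> real^'n \<Rightarrow> 'k set" where
  "a01 F1 F2 x = {j. F1 x $ j = 0 \<and> F2 x $ j > 0}"

definition a10 :: "(real^'n \<Rightarrow> real^'k) \<Rightarrow> (real^'n \<Rightarrow> real^'k) \<Rightarrow> real^'n \<Rightarrow> 'k set" where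
  "a10 F1 F2 x = {j. F1 x $ j > 0 \<and> F2 x $ j = 0}"

definition a00 :: "(real^'n \<Rightarrow> real^'k) \<Rightarrow> (real^'n \<Rightarrow> real^'k) \<Rightarrow> real^'n \<Rightarrow> 'k set" where
  "a00 F1 F2 x = {j. F1 x $ j = 0 \<and> F2 x $ j = 0}"

text \<open>The multipliers \<open>\<sigma>1\<close>, \<open>\<sigma>2\<close>, \<open>\<rho>1\<close>, \<open>\<rho>2\<close> are total functions, but are only ever evaluated on
  the index sets \<open>a01\<close>, \<open>a10\<close>, \<open>a00\<close>, \<open>a00\<close> of the point considered, respectively.\<close>

definition C_stationary ::
  "(real^'n \<Rightarrow> real) \<Rightarrow> (real^'n \<Rightarrow> real^'k) \<Rightarrow> (real^'n \<Rightarrow> real^'k) \<Rightarrow> real^'n \<Rightarrow>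
   ('k \<Rightarrow> real) \<Rightarrow> ('k \<Rightarrow> real) \<Rightarrow> ('k \<Rightarrow> real) \<Rightarrow> ('k \<Rightarrow> real) \<Rightarrow> bool" where
  "C_stationary f F1 F2 xb \<sigma>1 \<sigma>2 \<rho>1 \<rho>2 \<longleftrightarrow>
     xb \<in> mpcc_feasible F1 F2 \<and>
     grad f xb =
       (\<Sum>j\<in>a01 F1 F2 xb. \<sigma>1 j *\<^sub>R grad (\<lambda>x. F1 x $ j) xb)
       + (\<Sum>j\<in>a10 F1 F2 xb. \<sigma>2 j *\<^sub>R grad (\<lambda>x. F2 x $ j) xb)
       + (\<Sum>j\<in>a00 F1 F2 xb. \<rho>1 j *\<^sub>R grad (\<lambda>x. F1 x $ j) xb + \<rho>2 j *\<^sub>R grad (\<lambda>x. F2 x $ j) xb) \<and>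
     (\<forall>j\<in>a00 F1 F2 xb. \<rho>1 j * \<rho>2 j \<ge> 0)"

text \<open>The index sets are those of the reference point \<open>xb\<close>; the Lagrange function is a function
  of \<open>x\<close>.\<close>

definition mpcc_lagrange ::
  "(real^'n \<Rightarrow> real) \<Rightarrow> (real^'n \<Rightarrow> real^'k) \<Rightarrow> (real^'n \<Rightarrow> real^'k) \<Rightarrow> real^'n \<Rightarrow>
   ('k \<Rightarrow> real) \<Rightarrow> ('k \<Rightarrow> real) \<Rightarrow> ('k \<Rightarrow> real) \<Rightarrow> ('k \<Rightarrow> real) \<Rightarrow> real^'n \<Rightarrow> real" where
  "mpcc_lagrange f F1 F2 xb \<sigma>1 \<sigma>2 \<rho>1 \<rho>2 x =
     f x - (\<Sum>j\<in>a01 F1 F2 xb. \<sigma>1 j * F1 x $ j)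
         - (\<Sum>j\<in>a10 F1 F2 xb. \<sigma>2 j * F2 x $ j)
         - (\<Sum>j\<in>a00 F1 F2 xb. \<rho>1 j * F1 x $ j + \<rho>2 j * F2 x $ j)"

definition mpcc_tangent ::
  "(real^'n \<Rightarrow> real^'k) \<Rightarrow> (real^'n \<Rightarrow> real^'k) \<Rightarrow> real^'n \<Rightarrow> (real^'n) set" where
  "mpcc_tangent F1 F2 xb =
     {\<xi>. (\<forall>j\<in>a01 F1 F2 xb \<union> a00 F1 F2 xb. grad (\<lambda>x. F1 x $ j) xb \<bullet> \<xi> = 0) \<and>
         (\<forall>j\<in>a10 F1 F2 xb \<union> a00 F1 F2 xb. grad (\<lambda>x. F2 x $ j) xb \<bullet> \<xi> = 0)}"

definition mpcc_licq ::
  "(real^'n \<Rightarrow> real^'k) \<Rightarrow> (real^'n \<Rightarrow> real^'k) \<Rightarrow> real^'n \<Rightarrow> bool" where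
  "mpcc_licq F1 F2 xb \<longleftrightarrow>
     lin_indep_family
       (case_sum (\<lambda>j. grad (\<lambda>x. F1 x $ j) xb) (\<lambda>j. grad (\<lambda>x. F2 x $ j) xb))
       ((a01 F1 F2 xb \<union> a00 F1 F2 xb) <+> (a10 F1 F2 xb \<union> a00 F1 F2 xb))"

definition nondegenerate_C_stationary ::
  "(real^'n \<Rightarrow> real) \<Rightarrow> (real^'n \<Rightarrow> real^'k) \<Rightarrow> (real^'n \<Rightarrow> real^'k) \<Rightarrow> real^'n \<Rightarrow>
   ('k \<Rightarrow> real) \<Rightarrow> ('k \<Rightarrow> real) \<Rightarrow> ('k \<Rightarrow> real) \<Rightarrow> ('k \<Rightarrow> real) \<Rightarrow> bool" where
  "nondegenerate_C_stationary f F1 F2 xb \<sigma>1 \<sigma>2 \<rho>1 \<rho>2 \<longleftrightarrow>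
     C_stationary f F1 F2 xb \<sigma>1 \<sigma>2 \<rho>1 \<rho>2 \<and>
     mpcc_licq F1 F2 xb \<and>
     (\<forall>j\<in>a00 F1 F2 xb. \<rho>1 j * \<rho>2 j > 0) \<and>
     restrict_nonsingular (hess (mpcc_lagrange f F1 F2 xb \<sigma>1 \<sigma>2 \<rho>1 \<rho>2) xb)
       (mpcc_tangent F1 F2 xb)"

definition NDC4 ::
  "(real^'n \<Rightarrow> real^'k) \<Rightarrow> (real^'n \<Rightarrow> real^'k) \<Rightarrow> real^'n \<Rightarrow>
   ('k \<Rightarrow> real) \<Rightarrow> ('k \<Rightarrow> real) \<Rightarrow> bool" where
  "NDC4 F1 F2 xb \<sigma>1 \<sigma>2 \<longleftrightarrow>
     (\<forall>j\<in>a01 F1 F2 xb. \<sigma>1 j \<noteq> 0) \<and> (\<forall>j\<in>a10 F1 F2 xb. \<sigma>2 j \<noteq> 0)"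

definition biactive_index ::
  "(real^'n \<Rightarrow> real^'k) \<Rightarrow> (real^'n \<Rightarrow> real^'k) \<Rightarrow> real^'n \<Rightarrow>
   ('k \<Rightarrow> real) \<Rightarrow> ('k \<Rightarrow> real) \<Rightarrow> nat" where
  "biactive_index F1 F2 xb \<rho>1 \<rho>2 = card {j \<in> a00 F1 F2 xb. \<rho>1 j < 0 \<and> \<rho>2 j < 0}"

definition C_index ::
  "(real^'n \<Rightarrow> real) \<Rightarrow> (real^'n \<Rightarrow> real^'k) \<Rightarrow> (real^'n \<Rightarrow> real^'k) \<Rightarrow> real^'n \<Rightarrow>
   ('k \<Rightarrow> real) \<Rightarrow> ('k \<Rightarrow> real) \<Rightarrow> ('k \<Rightarrow> real) \<Rightarrow> ('k \<Rightarrow> real) \<Rightarrow> nat" where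
  "C_index f F1 F2 xb \<sigma>1 \<sigma>2 \<rho>1 \<rho>2 =
     num_neg_eigenvalues (hess (mpcc_lagrange f F1 F2 xb \<sigma>1 \<sigma>2 \<rho>1 \<rho>2) xb)
       (mpcc_tangent F1 F2 xb)
     + biactive_index F1 F2 xb \<rho>1 \<rho>2"

section \<open>Scholtes regularization\<close>

definition scholtes_feasible ::
  "(real^'n \<Rightarrow> real^'k) \<Rightarrow> (real^'n \<Rightarrow> real^'k) \<Rightarrow> real \<Rightarrow> (real^'n) set" where
  "scholtes_feasible F1 F2 t =
     {x. \<forall>j. F1 x $ j * F2 x $ j \<le> t \<and> F1 x $ j \<ge> 0 \<and> F2 x $ j \<ge> 0}"

definition active_H ::
  "(real^'n \<Rightarrow> real^'k) \<Rightarrow> (real^'n \<Rightarrow> real^'k) \<Rightarrow> real \<Rightarrow> real^'n \<Rightarrow> 'k set" where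
  "active_H F1 F2 t x = {j. F1 x $ j * F2 x $ j = t}"

definition active_N :: "(real^'n \<Rightarrow> real^'k) \<Rightarrow> real^'n \<Rightarrow> 'k set" where
  "active_N F x = {j. F x $ j = 0}"

definition prod_grad ::
  "(real^'n \<Rightarrow> real^'k) \<Rightarrow> (real^'n \<Rightarrow> real^'k) \<Rightarrow> real^'n \<Rightarrow> 'k \<Rightarrow> real^'n" where
  "prod_grad F1 F2 x j =
     F2 x $ j *\<^sub>R grad (\<lambda>y. F1 y $ j) x + F1 x $ j *\<^sub>R grad (\<lambda>y. F2 y $ j) x"

definition scholtes_KKT ::
  "(real^'n \<Rightarrow> real) \<Rightarrow> (real^'n \<Rightarrow> real^'k) \<Rightarrow> (real^'n \<Rightarrow> real^'k) \<Rightarrow> real \<Rightarrow> real^'n \<Rightarrow>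
   ('k \<Rightarrow> real) \<Rightarrow> ('k \<Rightarrow> real) \<Rightarrow> ('k \<Rightarrow> real) \<Rightarrow> bool" where
  "scholtes_KKT f F1 F2 t x \<eta> \<nu>1 \<nu>2 \<longleftrightarrow>
     x \<in> scholtes_feasible F1 F2 t \<and>
     grad f x =
       - (\<Sum>j\<in>UNIV. \<eta> j *\<^sub>R prod_grad F1 F2 x j)
       + (\<Sum>j\<in>UNIV. \<nu>1 j *\<^sub>R grad (\<lambda>y. F1 y $ j) x)
       + (\<Sum>j\<in>UNIV. \<nu>2 j *\<^sub>R grad (\<lambda>y. F2 y $ j) x) \<and>
     (\<forall>j. \<eta> j \<ge> 0 \<and> \<nu>1 j \<ge> 0 \<and> \<nu>2 j \<ge> 0 \<and>
          \<eta> j * (t - F1 x $ j * F2 x $ j) = 0 \<and>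
          \<nu>1 j * F1 x $ j = 0 \<and> \<nu>2 j * F2 x $ j = 0)"

definition scholtes_lagrange ::
  "(real^'n \<Rightarrow> real) \<Rightarrow> (real^'n \<Rightarrow> real^'k) \<Rightarrow> (real^'n \<Rightarrow> real^'k) \<Rightarrow> real \<Rightarrow>
   ('k \<Rightarrow> real) \<Rightarrow> ('k \<Rightarrow> real) \<Rightarrow> ('k \<Rightarrow> real) \<Rightarrow> real^'n \<Rightarrow> real" where
  "scholtes_lagrange f F1 F2 t \<eta> \<nu>1 \<nu>2 x =
     f x - (\<Sum>j\<in>UNIV. \<eta> j * (t - F1 x $ j * F2 x $ j))
         - (\<Sum>j\<in>UNIV. \<nu>1 j * F1 x $ j) - (\<Sum>j\<in>UNIV. \<nu>2 j * F2 x $ j)"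

definition scholtes_tangent ::
  "(real^'n \<Rightarrow> real^'k) \<Rightarrow> (real^'n \<Rightarrow> real^'k) \<Rightarrow> real \<Rightarrow> real^'n \<Rightarrow> (real^'n) set" where
  "scholtes_tangent F1 F2 t x =
     {\<xi>. (\<forall>j\<in>active_H F1 F2 t x. prod_grad F1 F2 x j \<bullet> \<xi> = 0) \<and>
         (\<forall>j\<in>active_N F1 x. grad (\<lambda>y. F1 y $ j) x \<bullet> \<xi> = 0) \<and>
         (\<forall>j\<in>active_N F2 x. grad (\<lambda>y. F2 y $ j) x \<bullet> \<xi> = 0)}"

definition scholtes_licq ::
  "(real^'n \<Rightarrow> real^'k) \<Rightarrow> (real^'n \<Rightarrow> real^'k) \<Rightarrow> real \<Rightarrow> real^'n \<Rightarrow> bool" where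
  "scholtes_licq F1 F2 t x \<longleftrightarrow>
     lin_indep_family
       (case_sum (prod_grad F1 F2 x)
         (case_sum (\<lambda>j. grad (\<lambda>y. F1 y $ j) x) (\<lambda>j. grad (\<lambda>y. F2 y $ j) x)))
       (active_H F1 F2 t x <+> (active_N F1 x <+> active_N F2 x))"

definition nondegenerate_scholtes_KKT ::
  "(real^'n \<Rightarrow> real) \<Rightarrow> (real^'n \<Rightarrow> real^'k) \<Rightarrow> (real^'n \<Rightarrow> real^'k) \<Rightarrow> real \<Rightarrow> real^'n \<Rightarrow>
   ('k \<Rightarrow> real) \<Rightarrow> ('k \<Rightarrow> real) \<Rightarrow> ('k \<Rightarrow> real) \<Rightarrow> bool" where
  "nondegenerate_scholtes_KKT f F1 F2 t x \<eta> \<nu>1 \<nu>2 \<longleftrightarrow>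
     scholtes_KKT f F1 F2 t x \<eta> \<nu>1 \<nu>2 \<and>
     scholtes_licq F1 F2 t x \<and>
     (\<forall>j\<in>active_H F1 F2 t x. \<eta> j > 0) \<and>
     (\<forall>j\<in>active_N F1 x. \<nu>1 j > 0) \<and>
     (\<forall>j\<in>active_N F2 x. \<nu>2 j > 0) \<and>
     restrict_nonsingular (hess (scholtes_lagrange f F1 F2 t \<eta> \<nu>1 \<nu>2) x)
       (scholtes_tangent F1 F2 t x)"

definition quadratic_index ::
  "(real^'n \<Rightarrow> real) \<Rightarrow> (real^'n \<Rightarrow> real^'k) \<Rightarrow> (real^'n \<Rightarrow> real^'k) \<Rightarrow> real \<Rightarrow> real^'n \<Rightarrow>
   ('k \<Rightarrow> real) \<Rightarrow> ('k \<Rightarrow> real) \<Rightarrow> ('k \<Rightarrow> real) \<Rightarrow> nat" where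
  "quadratic_index f F1 F2 t x \<eta> \<nu>1 \<nu>2 =
     num_neg_eigenvalues (hess (scholtes_lagrange f F1 F2 t \<eta> \<nu>1 \<nu>2) x)
       (scholtes_tangent F1 F2 t x)"

end

theory Submission
  imports Defs
begin

text \<open>
  Write \<open>t = s\<^sup>2\<close>. In the gradient equation of a Karush-Kuhn-Tucker point \<open>x\<close> of the regularisation, the
  three multipliers of a pair \<open>j\<close> only occur in the combinations \<open>\<nu>1 j - \<eta> j * F2 x $ j\<close> and
  \<open>\<nu>2 j - \<eta> j * F1 x $ j\<close>. These normalised multipliers \<open>m\<close> stay bounded as \<open>t\<close> tends to 0 and tend to the
  C-stationary multipliers of \<open>xb\<close> (put to 0 where a function is positive at \<open>xb\<close>), although \<open>\<eta> j\<close> itself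
  grows like \<open>1 / s\<close> on biactive pairs with negative multipliers. All limit multipliers that matter are
  nonzero, by NDC2 and NDC4, so near the limit the signs of \<open>m\<close> tell which constraints of a pair are
  active, and the conditions of the pair turn into two equations. For example, on a biactive pair with
  negative multipliers \<open>p\<close>, \<open>q\<close> they read \<open>F1 = s * sqrt (q / p)\<close> and \<open>F2 = s * sqrt (p / q)\<close>.

  Together with the gradient equation this is a square system in \<open>(x, m)\<close> which is differentiable in
  \<open>(s, x, m)\<close> up to \<open>s = 0\<close>. Its linearisation at \<open>s = 0\<close> is the bordered matrix built from the Hessian of
  the Lagrange function and the active gradients, which is injective by LICQ and NDC3
  (\<open>system_kernel\<close>). The implicit function principle (\<open>implicit_solution\<close>) gives exactly one solution near
  \<open>(xb, mb)\<close> for each small \<open>s\<close>. By LICQ, the normalised multipliers of every Karush-Kuhn-Tucker point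
  near \<open>xb\<close> are close to \<open>mb\<close>, whatever \<open>t\<close> is (\<open>multipliers_near\<close>); hence uniqueness holds in \<open>x\<close> alone, on a
  neighbourhood that does not depend on \<open>t\<close>.

  For the index (\<open>scholtes_inertia\<close>), the tangent space of the regularisation is close to a space that
  exceeds the tangent space at \<open>xb\<close> by one dimension for every biactive pair with negative multipliers,
  because such a pair has one active constraint after the regularisation instead of two. On the old
  directions the Hessian is a small perturbation of the Hessian at \<open>xb\<close>. On the new ones the term
  \<open>\<eta> j * (2 * (DF1 \<xi>) * (DF2 \<xi>))\<close> dominates and is very negative, since the tangent condition forces the two
  factors to have opposite signs and \<open>\<eta> j\<close> is large. So the quadratic index grows by precisely the
  biactive index. Eigenvalues are counted through definite subspaces
  (\<open>inertia_from_definite_subspaces\<close>), which needs only lower bounds for dimensions.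
\<close>

section \<open>Subspaces cut out by linear equations\<close>

text \<open>Independence in terms of coefficients is the form that survives a perturbation of the vectors.\<close>
lemma lin_indep_family_iff:
  fixes v :: "'i \<Rightarrow> 'v::real_vector"
  assumes "finite I"
  shows "lin_indep_family v I \<longleftrightarrow>
    (\<forall>c. (\<Sum>i\<in>I. c i *\<^sub>R v i) = 0 \<longrightarrow> (\<forall>i\<in>I. c i = 0))"
proof
  assume L: "lin_indep_family v I"
  hence inj: "inj_on v I" and ind: "independent (v ` I)" by (auto simp: lin_indep_family_def)
  show "\<forall>c. (\<Sum>i\<in>I. c i *\<^sub>R v i) = 0 \<longrightarrow> (\<forall>i\<in>I. c i = 0)"
  proof (intro allI impI ballI)
    fix c i assume s: "(\<Sum>i\<in>I. c i *\<^sub>R v i) = 0" and i: "i \<in> I"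
    have "(\<Sum>w\<in>v ` I. c (the_inv_into I v w) *\<^sub>R w) = (\<Sum>i\<in>I. c i *\<^sub>R v i)"
      by (subst sum.reindex[OF inj]) (auto intro!: sum.cong simp: the_inv_into_f_f[OF inj])
    with s have "(\<Sum>w\<in>v ` I. c (the_inv_into I v w) *\<^sub>R w) = 0" by simp
    with ind have "c (the_inv_into I v (v i)) = 0"
      using independentD[OF ind _ order_refl, of "\<lambda>w. c (the_inv_into I v w)" "v i"] i assms by auto
    thus "c i = 0" using the_inv_into_f_f[OF inj i] by simp
  qed
next
  assume R: "\<forall>c. (\<Sum>i\<in>I. c i *\<^sub>R v i) = 0 \<longrightarrow> (\<forall>i\<in>I. c i = 0)"
  have inj: "inj_on v I"
  proof (rule inj_onI, rule ccontr)
    fix i j assume ij: "i \<in> I" "j \<in> I" "v i = v j" "i \<noteq> j"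
    let ?c = "\<lambda>k. if k = i then 1 else if k = j then -1 else (0::real)"
    have "(\<Sum>k\<in>I. ?c k *\<^sub>R v k) = (\<Sum>k\<in>{i,j}. ?c k *\<^sub>R v k)"
      using ij assms by (intro sum.mono_neutral_right) auto
    also have "\<dots> = 0" using ij by simp
    finally have "\<forall>k\<in>I. ?c k = 0" using R[THEN spec, of ?c] by (rule rev_mp)
    from bspec[OF this ij(1)] show False by simp
  qed
  have "independent (v ` I)"
  proof (rule independent_if_scalars_zero)
    fix c w assume s: "(\<Sum>w\<in>v ` I. c w *\<^sub>R w) = 0" and w: "w \<in> v ` I"
    have "(\<Sum>i\<in>I. c (v i) *\<^sub>R v i) = 0" using s by (simp add: sum.reindex[OF inj])
    with R w show "c w = 0" by auto
  qed (use assms in auto)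
  with inj show "lin_indep_family v I" by (simp add: lin_indep_family_def)
qed

lemma subspace_inner_constraints:
  fixes S :: "('a::real_inner) set"
  assumes "subspace S"
  shows "subspace {x\<in>S. \<forall>w\<in>W. w \<bullet> x = 0}"
  using assms by (auto simp: subspace_def inner_add_right)

text \<open>A vector of \<open>S\<close> outside the hyperplane, together with the section by the hyperplane, spans \<open>S\<close>.\<close>
lemma dim_inner_constraint:
  fixes S :: "('a::euclidean_space) set"
  assumes "subspace S"
  shows "dim S \<le> dim {x\<in>S. w \<bullet> x = 0} + 1"
proof (cases "S \<subseteq> {x. w \<bullet> x = 0}")
  case True
  hence "{x\<in>S. w \<bullet> x = 0} = S" by auto
  thus ?thesis by simp
next
  case False
  then obtain e where e: "e \<in> S" "w \<bullet> e \<noteq> 0" by auto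
  have "S \<subseteq> span (insert e {x\<in>S. w \<bullet> x = 0})"
  proof
    fix x assume x: "x \<in> S"
    let ?r = "(w \<bullet> x) / (w \<bullet> e)"
    have "x - ?r *\<^sub>R e \<in> {x\<in>S. w \<bullet> x = 0}"
      using e x assms by (auto simp: inner_diff_right intro: subspace_diff subspace_scale)
    thus "x \<in> span (insert e {x\<in>S. w \<bullet> x = 0})"
      by (auto simp: span_breakdown_eq intro: span_base)
  qed
  hence "dim S \<le> dim (insert e {x\<in>S. w \<bullet> x = 0})" by (metis dim_mono dim_span)
  thus ?thesis by (simp add: dim_insert split: if_splits)
qed

lemma dim_inner_constraints:
  fixes S :: "('a::euclidean_space) set"
  assumes "subspace S" "finite W"
  shows "dim S \<le> dim {x\<in>S. \<forall>w\<in>W. w \<bullet> x = 0} + card W"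
  using assms(2)
proof induction
  case empty
  thus ?case by simp
next
  case (insert a W)
  have "{x\<in>S. \<forall>w\<in>insert a W. w \<bullet> x = 0} = {x\<in>{x\<in>S. \<forall>w\<in>W. w \<bullet> x = 0}. a \<bullet> x = 0}" by auto
  with insert dim_inner_constraint[OF subspace_inner_constraints[OF assms(1), of W], of a]
  show ?case by simp
qed

lemma dim_inner_constraints_family:
  fixes S :: "('a::euclidean_space) set"
  assumes "subspace S" "finite I"
  shows "dim S \<le> dim {x\<in>S. \<forall>i\<in>I. v i \<bullet> x = 0} + card I"
  using dim_inner_constraints[OF assms(1), of "v ` I"] card_image_le[OF assms(2), of v] assms(2)
  by simp

text \<open>The definite subspaces of the index computation are given by equations of this kind; lower bounds
  for their dimensions replace any construction of bases.\<close>
lemma dim_orthogonal_to_subspace: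
  fixes S P :: "('a::euclidean_space) set"
  assumes "subspace S"
  shows "dim S \<le> dim {x\<in>S. \<forall>p\<in>P. p \<bullet> x = 0} + dim P"
proof -
  obtain B where B: "B \<subseteq> P" "independent B" "P \<subseteq> span B" "card B = dim P"
    using basis_exists[of P] by blast
  have "{x\<in>S. \<forall>p\<in>B. p \<bullet> x = 0} \<subseteq> {x\<in>S. \<forall>p\<in>P. p \<bullet> x = 0}"
  proof clarsimp
    fix x p assume "\<forall>p\<in>B. p \<bullet> x = 0" "p \<in> P"
    hence "orthogonal x p" using B(3) orthogonal_to_span[of p B x]
      by (auto simp: orthogonal_def inner_commute)
    thus "p \<bullet> x = 0" by (simp add: orthogonal_def inner_commute)
  qed
  hence "dim {x\<in>S. \<forall>p\<in>B. p \<bullet> x = 0} \<le> dim {x\<in>S. \<forall>p\<in>P. p \<bullet> x = 0}" by (rule dim_subset)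
  with dim_inner_constraints[OF assms, of B] B show ?thesis
    by (simp add: finiteI_independent)
qed

lemma dim_kernel_lin_indep_family:
  fixes v :: "'i \<Rightarrow> 'a::euclidean_space"
  assumes "lin_indep_family v I" "finite I"
  shows "dim {x. \<forall>i\<in>I. v i \<bullet> x = 0} + card I = DIM('a)"
proof -
  have eq: "{x. \<forall>i\<in>I. v i \<bullet> x = 0} = {y\<in>UNIV. \<forall>x\<in>span (v ` I). orthogonal x y}"
  proof (intro equalityI subsetI CollectI conjI ballI)
    fix y x assume "y \<in> {x. \<forall>i\<in>I. v i \<bullet> x = 0}" "x \<in> span (v ` I)"
    thus "orthogonal x y"
      using orthogonal_to_span[of x "v ` I" y] by (force simp: orthogonal_def inner_commute)
  qed (auto simp: orthogonal_def span_base)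
  have "dim (span (v ` I)) = card I"
    using assms unfolding lin_indep_family_def
    by (metis card_image dim_eq_card_independent dim_span)
  with dim_subspace_orthogonal_to_vectors[of "span (v ` I)" UNIV] eq show ?thesis by simp
qed

section \<open>Symmetric forms on a subspace and their inertia\<close>

definition sym_op :: "real^'n^'n \<Rightarrow> bool" where
  "sym_op A \<longleftrightarrow> (\<forall>x y. (A *v x) \<bullet> y = x \<bullet> (A *v y))"
text \<open>The closest point of a subspace is the orthogonal projection. This characterisation replaces the
  restricted operator by the bilinear form \<open>(A *v \<xi>) \<bullet> \<zeta>\<close> on \<open>T\<close>.\<close>
lemma restrict_op_eq_iff:
  assumes T: "subspace T"
  shows "restrict_op A T \<xi> = \<eta> \<longleftrightarrow> \<eta> \<in> T \<and> (\<forall>\<zeta>\<in>T. (A *v \<xi>) \<bullet> \<zeta> = \<eta> \<bullet> \<zeta>)"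
proof -
  define c where "c = closest_point T (A *v \<xi>)"
  have cl: "closed T" "convex T" "T \<noteq> {}"
    using T closed_subspace subspace_imp_convex subspace_0 by auto
  have cT: "c \<in> T" unfolding c_def using cl by (intro closest_point_in_set)
  have orth: "(A *v \<xi>) \<bullet> \<zeta> = c \<bullet> \<zeta>" if "\<zeta> \<in> T" for \<zeta>
  proof -
    have "(A *v \<xi> - c) \<bullet> ((c + \<zeta>) - c) \<le> 0" unfolding c_def
      using cl that cT T by (intro closest_point_dot) (auto simp: c_def intro: subspace_add)
    moreover have "(A *v \<xi> - c) \<bullet> ((c - \<zeta>) - c) \<le> 0" unfolding c_def
      using cl that cT T by (intro closest_point_dot) (auto simp: c_def intro: subspace_diff)
    ultimately show ?thesis by (simp add: inner_diff_left inner_diff_right)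
  qed
  have uniq: "\<eta> = c" if "\<eta> \<in> T" "\<forall>\<zeta>\<in>T. (A *v \<xi>) \<bullet> \<zeta> = \<eta> \<bullet> \<zeta>"
  proof -
    have "\<eta> - c \<in> T" using that cT T by (auto intro: subspace_diff)
    hence "(\<eta> - c) \<bullet> (\<eta> - c) = 0" using that orth by (simp add: inner_diff_left)
    thus ?thesis by simp
  qed
  show ?thesis unfolding restrict_op_def c_def[symmetric] using cT orth uniq by auto
qed

text \<open>The restricted operator is linear, so a trivial kernel makes it bijective by dimension.\<close>
lemma restrict_nonsingular_iff:
  assumes T: "subspace T"
  shows "restrict_nonsingular A T \<longleftrightarrow>
    (\<forall>\<xi>\<in>T. (\<forall>\<zeta>\<in>T. (A *v \<xi>) \<bullet> \<zeta> = 0) \<longrightarrow> \<xi> = 0)"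
proof
  assume ns: "restrict_nonsingular A T"
  show "\<forall>\<xi>\<in>T. (\<forall>\<zeta>\<in>T. (A *v \<xi>) \<bullet> \<zeta> = 0) \<longrightarrow> \<xi> = 0"
  proof (intro ballI impI)
    fix \<xi> assume x: "\<xi> \<in> T" "\<forall>\<zeta>\<in>T. (A *v \<xi>) \<bullet> \<zeta> = 0"
    have "restrict_op A T \<xi> = 0" "restrict_op A T 0 = 0"
      using x T by (auto simp: restrict_op_eq_iff subspace_0)
    with ns x(1) subspace_0[OF T] show "\<xi> = 0"
      unfolding restrict_nonsingular_def bij_betw_def by (metis inj_onD)
  qed
next
  assume inj: "\<forall>\<xi>\<in>T. (\<forall>\<zeta>\<in>T. (A *v \<xi>) \<bullet> \<zeta> = 0) \<longrightarrow> \<xi> = 0"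
  let ?R = "restrict_op A T"
  have R: "?R \<xi> \<in> T" "\<zeta> \<in> T \<Longrightarrow> (A *v \<xi>) \<bullet> \<zeta> = ?R \<xi> \<bullet> \<zeta>" for \<xi> \<zeta>
    using restrict_op_eq_iff[OF T, of A \<xi> "?R \<xi>"] by auto
  have lin: "linear ?R"
  proof (rule linearI)
    show "?R (x + y) = ?R x + ?R y" for x y
      using T R by (auto simp: restrict_op_eq_iff subspace_add matrix_vector_right_distrib inner_add_left)
    show "?R (r *\<^sub>R x) = r *\<^sub>R ?R x" for r x
      using T R by (auto simp: restrict_op_eq_iff subspace_scale matrix_vector_mult_scaleR)
  qed
  have injR: "inj_on ?R T"
  proof (rule inj_onI)
    fix x y assume xy: "x \<in> T" "y \<in> T" "?R x = ?R y"
    have "\<forall>\<zeta>\<in>T. (A *v (x - y)) \<bullet> \<zeta> = 0"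
      using R xy by (auto simp: matrix_vector_mult_diff_distrib inner_diff_left)
    with inj xy T show "x = y" by (metis subspace_diff eq_iff_diff_eq_0)
  qed
  have "dim (?R ` T) = dim T"
    using lin injR T by (intro dim_image_eq) (auto simp: span_eq_iff[THEN iffD2])
  hence "?R ` T = T"
    using lin T R(1) by (intro subspace_dim_equal) (auto intro: linear_subspace_image)
  with injR show "restrict_nonsingular A T"
    by (simp add: restrict_nonsingular_def bij_betw_def)
qed

text \<open>If \<open>l\<close> is the maximum of the quadratic form on the unit sphere of \<open>T\<close>, attained at \<open>e\<close>, then
  \<open>l * (x \<bullet> x) - (A *v x) \<bullet> x\<close> is positive semidefinite on \<open>T\<close> and vanishes at \<open>e\<close>; hence \<open>e\<close> lies in its kernel.\<close>
lemma sym_form_max_on_sphere: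
  fixes A :: "real^'n^'n"
  assumes A: "sym_op A" and T: "subspace T" and nz: "T \<noteq> {0}"
  obtains e l where "e \<in> T" "norm e = 1" "\<And>\<zeta>. \<zeta> \<in> T \<Longrightarrow> (A *v e) \<bullet> \<zeta> = l * (e \<bullet> \<zeta>)"
proof -
  let ?q = "\<lambda>x. (A *v x) \<bullet> x"
  let ?S = "T \<inter> sphere 0 1"
  have "compact ?S" using T by (simp add: closed_subspace closed_Int_compact)
  moreover obtain y where y: "y \<in> T" "y \<noteq> 0" using nz subspace_0[OF T] by blast
  have "(1 / norm y) *\<^sub>R y \<in> ?S" using y T by (auto intro: subspace_scale)
  hence "?S \<noteq> {}" by blast
  moreover have "continuous_on ?S ?q"
    by (intro continuous_intros linear_continuous_on) (simp add: matrix_vector_mul_bounded_linear)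
  ultimately obtain e where e: "e \<in> ?S" "\<forall>y\<in>?S. ?q y \<le> ?q e"
    using continuous_attains_sup by blast
  define l where "l = ?q e"
  have ee: "e \<bullet> e = 1" using e by (simp add: dot_square_norm)
  have psd: "?q x \<le> l * (x \<bullet> x)" if "x \<in> T" for x
  proof (cases "x = 0")
    case False
    have "(1 / norm x) *\<^sub>R x \<in> ?S" using False that T by (auto intro: subspace_scale)
    hence "?q ((1 / norm x) *\<^sub>R x) \<le> l" unfolding l_def using e(2) by blast
    hence "?q x / (norm x)^2 \<le> l" by (simp add: matrix_vector_mult_scaleR power2_eq_square field_simps)
    thus ?thesis using False by (simp add: field_simps dot_square_norm)
  qed simp
  have "(A *v e) \<bullet> z = l * (e \<bullet> z)" if z: "z \<in> T" for z
  proof -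
    define b where "b = l * (e \<bullet> z) - (A *v e) \<bullet> z"
    define d where "d = l * (z \<bullet> z) - ?q z"
    have *: "0 \<le> 2 * r * b + r^2 * d" for r
    proof -
      have "?q (e + r *\<^sub>R z) \<le> l * ((e + r *\<^sub>R z) \<bullet> (e + r *\<^sub>R z))"
        using z e T by (intro psd) (auto intro: subspace_add subspace_scale)
      moreover have "(A *v z) \<bullet> e = (A *v e) \<bullet> z" using A by (simp add: sym_op_def inner_commute)
      ultimately show ?thesis
        by (simp add: b_def d_def matrix_vector_right_distrib matrix_vector_mult_scaleR inner_add_left
            inner_add_right ee l_def[symmetric] algebra_simps power2_eq_square inner_commute[of z e])
    qed
    have "b = 0"
    proof (rule ccontr)
      assume b: "b \<noteq> 0"
      have dp: "d \<ge> 0" using psd[OF z] by (simp add: d_def)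
      \<comment> \<open>The minimiser \<open>r = - b / d\<close> of the parabola, with \<open>d + 1\<close> in place of \<open>d\<close>, which may be 0.\<close>
      define u where "u = 1 / (d + 1)"
      have u: "u > 0" "u * d < 1" using dp by (auto simp: u_def)
      have "0 \<le> 2 * (- b * u) * b + (- b * u)^2 * d" by (rule *)
      also have "\<dots> = b^2 * u * (u * d - 2)" by (simp add: algebra_simps power2_eq_square)
      also have "\<dots> < 0" using u b by (intro mult_pos_neg) auto
      finally show False by simp
    qed
    thus ?thesis by (simp add: b_def)
  qed
  with e show ?thesis using that by auto
qed

text \<open>Spectral theorem: split off a maximiser and continue in its orthogonal complement within \<open>T\<close>.\<close>
lemma sym_form_eigenbasis:
  fixes A :: "real^'n^'n"
  assumes A: "sym_op A" and T: "subspace T"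
  obtains B l where "finite B" "pairwise orthogonal B" "\<And>b. b \<in> B \<Longrightarrow> norm b = 1" "span B = T"
    "\<And>b \<zeta>. b \<in> B \<Longrightarrow> \<zeta> \<in> T \<Longrightarrow> (A *v b) \<bullet> \<zeta> = l b * (b \<bullet> \<zeta>)"
proof -
  have "\<exists>B l. finite B \<and> pairwise orthogonal B \<and> (\<forall>b\<in>B. norm b = 1) \<and> span B = T \<and>
      (\<forall>b\<in>B. \<forall>\<zeta>\<in>T. (A *v b) \<bullet> \<zeta> = l b * (b \<bullet> \<zeta>))"
    using T
  proof (induction "dim T" arbitrary: T rule: less_induct)
    case less
    show ?case
    proof (cases "T = {0}")
      case True
      thus ?thesis by (intro exI[of _ "{}"]) auto
    next
      case False
      then obtain e l0 where e: "e \<in> T" "norm e = 1"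
        and eig: "\<And>\<zeta>. \<zeta> \<in> T \<Longrightarrow> (A *v e) \<bullet> \<zeta> = l0 * (e \<bullet> \<zeta>)"
        using sym_form_max_on_sphere[OF A less.prems] by metis
      define T' where "T' = {x\<in>T. \<forall>w\<in>{e}. w \<bullet> x = 0}"
      have T': "subspace T'" unfolding T'_def by (rule subspace_inner_constraints[OF less.prems])
      have ee: "e \<bullet> e = 1" using e by (simp add: dot_square_norm)
      have "e \<notin> T'" using ee by (simp add: T'_def)
      hence "T' \<subset> T" using e(1) unfolding T'_def by blast
      hence "dim T' < dim T"
        using T' less.prems by (metis dim_psubset span_eq_iff)
      with less.hyps T' obtain B l where B: "finite B" "pairwise orthogonal B"
        "\<forall>b\<in>B. norm b = 1" "span B = T'"
        and l: "\<forall>b\<in>B. \<forall>\<zeta>\<in>T'. (A *v b) \<bullet> \<zeta> = l b * (b \<bullet> \<zeta>)" by blast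
      have BT': "b \<in> T'" if "b \<in> B" for b using B that span_base by blast
      have be: "b \<bullet> e = 0" "e \<bullet> b = 0" if "b \<in> B" for b
        using BT'[OF that] by (auto simp: T'_def inner_commute)
      have dec: "x - (e \<bullet> x) *\<^sub>R e \<in> T'" if "x \<in> T" for x
        using that e less.prems ee
        by (auto simp: T'_def inner_diff_right intro: subspace_diff subspace_scale)
      have "e \<notin> B" using be ee by fastforce
      let ?l = "l(e := l0)"
      have "(A *v b) \<bullet> x = l b * (b \<bullet> x)" if b: "b \<in> B" and x: "x \<in> T" for b x
      proof -
        have "(A *v b) \<bullet> e = (A *v e) \<bullet> b" using A by (simp add: sym_op_def inner_commute)
        also have "\<dots> = 0" using eig BT'[OF b] be[OF b] by (simp add: T'_def)
        finally have 0: "(A *v b) \<bullet> e = 0" .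
        have "(A *v b) \<bullet> (x - (e \<bullet> x) *\<^sub>R e) = l b * (b \<bullet> (x - (e \<bullet> x) *\<^sub>R e))"
          using l b dec[OF x] by blast
        thus ?thesis by (simp add: inner_diff_right 0 be[OF b])
      qed
      moreover have "span (insert e B) = T"
      proof
        show "span (insert e B) \<subseteq> T"
          using BT' e less.prems by (intro span_minimal) (auto simp: T'_def)
        show "T \<subseteq> span (insert e B)"
          using dec B(4) by (auto simp: span_breakdown_eq intro!: exI[of _ "e \<bullet> _"])
      qed
      moreover have "pairwise orthogonal (insert e B)"
        using B(2) be by (auto simp: pairwise_insert orthogonal_def)
      ultimately show ?thesis using B(1,3) e(2) eig \<open>e \<notin> B\<close>
        by (intro exI[of _ "insert e B"] exI[of _ ?l]) auto
    qed
  qed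
  thus ?thesis using that by metis
qed

text \<open>Coordinates in which the restricted form is diagonal, so that eigenspaces, nonsingularity and the
  number of negative eigenvalues can be read off from the values \<open>l b\<close>.\<close>
locale sym_eigenbasis =
  fixes A :: "real^'n^'n" and T B :: "(real^'n) set" and l :: "real^'n \<Rightarrow> real"
  assumes sym: "sym_op A" and T: "subspace T"
    and fin: "finite B" and orth: "pairwise orthogonal B" and unit: "\<And>b. b \<in> B \<Longrightarrow> norm b = 1"
    and span: "span B = T"
    and eig: "\<And>b \<zeta>. b \<in> B \<Longrightarrow> \<zeta> \<in> T \<Longrightarrow> (A *v b) \<bullet> \<zeta> = l b * (b \<bullet> \<zeta>)"
begin

lemma base_in: "b \<in> B \<Longrightarrow> b \<in> T"
  using span span_base by blast

lemma expand: "\<xi> \<in> T \<Longrightarrow> (\<Sum>b\<in>B. (\<xi> \<bullet> b) *\<^sub>R b) = \<xi>"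
  using orthonormal_basis_expand[OF orth unit _ fin] span by blast

lemma eig': "b \<in> B \<Longrightarrow> \<zeta> \<in> T \<Longrightarrow> (A *v \<zeta>) \<bullet> b = l b * (\<zeta> \<bullet> b)"
  using eig[of b \<zeta>] sym by (simp add: sym_op_def inner_commute)

lemma form_eq:
  assumes "\<xi> \<in> T"
  shows "(A *v \<xi>) \<bullet> \<xi> = (\<Sum>b\<in>B. l b * (\<xi> \<bullet> b)^2)"
proof -
  have "(A *v \<xi>) \<bullet> \<xi> = (A *v \<xi>) \<bullet> (\<Sum>b\<in>B. (\<xi> \<bullet> b) *\<^sub>R b)" using expand[OF assms] by simp
  also have "\<dots> = (\<Sum>b\<in>B. (\<xi> \<bullet> b) * (l b * (\<xi> \<bullet> b)))"
    by (simp add: inner_sum_right eig'[OF _ assms])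
  finally show ?thesis by (simp add: power2_eq_square algebra_simps)
qed

lemma zero_if_orthogonal: "\<xi> \<in> T \<Longrightarrow> (\<And>b. b \<in> B \<Longrightarrow> \<xi> \<bullet> b = 0) \<Longrightarrow> \<xi> = 0"
  using expand[of \<xi>] by simp

lemma independent_subset: "C \<subseteq> B \<Longrightarrow> independent C"
  using pairwise_orthogonal_independent[OF orth] unit independent_mono
  by (metis norm_zero zero_neq_one)

lemma eigenspace_eq: "restrict_eigenspace A T \<mu> = span {b\<in>B. l b = \<mu>}"
proof
  show "restrict_eigenspace A T \<mu> \<subseteq> span {b\<in>B. l b = \<mu>}"
  proof
    fix \<xi> assume "\<xi> \<in> restrict_eigenspace A T \<mu>"
    hence x: "\<xi> \<in> T" and e: "\<And>\<zeta>. \<zeta> \<in> T \<Longrightarrow> (A *v \<xi>) \<bullet> \<zeta> = \<mu> * (\<xi> \<bullet> \<zeta>)"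
      by (auto simp: restrict_eigenspace_def restrict_op_eq_iff[OF T])
    have "\<xi> \<bullet> b = 0" if "b \<in> B" "l b \<noteq> \<mu>" for b
      using e[OF base_in] eig'[OF _ x] that by auto
    hence "(\<Sum>b\<in>{b\<in>B. l b = \<mu>}. (\<xi> \<bullet> b) *\<^sub>R b) = (\<Sum>b\<in>B. (\<xi> \<bullet> b) *\<^sub>R b)"
      using fin by (intro sum.mono_neutral_left) auto
    also have "\<dots> = \<xi>" by (rule expand[OF x])
    finally have "\<xi> = (\<Sum>b\<in>{b\<in>B. l b = \<mu>}. (\<xi> \<bullet> b) *\<^sub>R b)" ..
    also have "\<dots> \<in> span {b\<in>B. l b = \<mu>}"
      by (intro span_sum span_scale span_base)
    finally show "\<xi> \<in> span {b\<in>B. l b = \<mu>}" .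
  qed
  have sub: "subspace (restrict_eigenspace A T \<mu>)"
    using T by (auto simp: restrict_eigenspace_def restrict_op_eq_iff[OF T] subspace_def
        matrix_vector_right_distrib matrix_vector_mult_scaleR inner_add_left algebra_simps)
  show "span {b\<in>B. l b = \<mu>} \<subseteq> restrict_eigenspace A T \<mu>"
    using base_in eig T
    by (intro span_minimal sub) (auto simp: restrict_eigenspace_def restrict_op_eq_iff[OF T] subspace_scale)
qed

lemma num_neg_eq: "num_neg_eigenvalues A T = card {b\<in>B. l b < 0}"
proof -
  have "{\<mu> \<in> restrict_eigenvalues A T. \<mu> < 0} = l ` {b\<in>B. l b < 0}"
  proof (intro equalityI subsetI)
    fix \<mu> assume m: "\<mu> \<in> {\<mu> \<in> restrict_eigenvalues A T. \<mu> < 0}"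
    then obtain \<xi> where "\<xi> \<in> span {b\<in>B. l b = \<mu>}" "\<xi> \<noteq> 0"
      by (auto simp: restrict_eigenvalues_def eigenspace_eq)
    hence "{b\<in>B. l b = \<mu>} \<noteq> {}" by (metis span_empty singletonD)
    thus "\<mu> \<in> l ` {b\<in>B. l b < 0}" using m by auto
  next
    fix \<mu> assume "\<mu> \<in> l ` {b\<in>B. l b < 0}"
    then obtain b where b: "b \<in> B" "l b < 0" "\<mu> = l b" by auto
    hence "b \<in> restrict_eigenspace A T \<mu>" "b \<noteq> 0"
      using unit[OF b(1)] by (auto simp: eigenspace_eq span_base)
    thus "\<mu> \<in> {\<mu> \<in> restrict_eigenvalues A T. \<mu> < 0}" using b by (auto simp: restrict_eigenvalues_def)
  qed
  hence "num_neg_eigenvalues A T = (\<Sum>\<mu>\<in>l ` {b\<in>B. l b < 0}. card {b\<in>B. l b = \<mu>})"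
    by (simp add: num_neg_eigenvalues_def eigenspace_eq dim_eq_card_independent independent_subset)
  also have "\<dots> = (\<Sum>\<mu>\<in>l ` {b\<in>B. l b < 0}. \<Sum>b\<in>{b\<in>{b\<in>B. l b < 0}. l b = \<mu>}. 1)"
    by (intro sum.cong) (auto intro!: arg_cong[of _ _ card])
  also have "\<dots> = (\<Sum>b\<in>{b\<in>B. l b < 0}. 1)"
    using fin by (intro sum.image_gen[symmetric]) auto
  finally show ?thesis by simp
qed

lemma nonsingular_iff: "restrict_nonsingular A T \<longleftrightarrow> (\<forall>b\<in>B. l b \<noteq> 0)"
proof
  assume ns: "restrict_nonsingular A T"
  show "\<forall>b\<in>B. l b \<noteq> 0"
  proof
    fix b assume b: "b \<in> B"
    show "l b \<noteq> 0"
    proof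
      assume "l b = 0"
      hence "b = 0" using ns eig[OF b] base_in[OF b] by (auto simp: restrict_nonsingular_iff[OF T])
      thus False using unit[OF b] by simp
    qed
  qed
next
  assume nz: "\<forall>b\<in>B. l b \<noteq> 0"
  show "restrict_nonsingular A T"
    unfolding restrict_nonsingular_iff[OF T]
  proof (intro ballI impI)
    fix \<xi> assume x: "\<xi> \<in> T" "\<forall>\<zeta>\<in>T. (A *v \<xi>) \<bullet> \<zeta> = 0"
    show "\<xi> = 0"
      by (rule zero_if_orthogonal) (use x nz eig'[OF _ x(1)] base_in in fastforce)+
  qed
qed

lemma dim_eq: "dim T = card B"
  using independent_subset[OF order_refl] span dim_eq_card_independent dim_span by metis

end

lemma sym_eigenbasis_exists:
  assumes "sym_op A" "subspace T"
  obtains B l where "sym_eigenbasis A T B l"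
  using sym_form_eigenbasis[OF assms] assms by (metis sym_eigenbasis.intro)

text \<open>\<open>N\<close> and \<open>P\<close> are the eigenvectors of a basis with negative and with positive eigenvalue. As no eigenvalue
  is 0, a vector orthogonal to one of the two sets is a combination of the other. Definiteness is stated
  on such orthogonal vectors because orthogonality to a fixed set still makes sense when \<open>T\<close> is perturbed.\<close>
lemma inertia_splitting:
  fixes A :: "real^'n^'n"
  assumes A: "sym_op A" and T: "subspace T" and ns: "restrict_nonsingular A T"
  obtains N P where "N \<subseteq> T" "P \<subseteq> T" "dim N = num_neg_eigenvalues A T" "dim N + dim P = dim T"
    "\<And>\<xi>. \<xi> \<in> T \<Longrightarrow> \<xi> \<noteq> 0 \<Longrightarrow> (\<forall>w\<in>N. w \<bullet> \<xi> = 0) \<Longrightarrow> (A *v \<xi>) \<bullet> \<xi> > 0"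
    "\<And>\<xi>. \<xi> \<in> T \<Longrightarrow> \<xi> \<noteq> 0 \<Longrightarrow> (\<forall>w\<in>P. w \<bullet> \<xi> = 0) \<Longrightarrow> (A *v \<xi>) \<bullet> \<xi> < 0"
proof -
  obtain B l where "sym_eigenbasis A T B l" using sym_eigenbasis_exists[OF A T] .
  then interpret sym_eigenbasis A T B l .
  have nz: "l b \<noteq> 0" if "b \<in> B" for b using ns nonsingular_iff that by blast
  define N where "N = {b\<in>B. l b < 0}"
  define P where "P = {b\<in>B. l b > 0}"
  have BNP: "B = N \<union> P" "N \<inter> P = {}" using nz by (force simp: N_def P_def)+
  have "finite N" "finite P" using fin by (auto simp: N_def P_def)
  hence c: "card B = card N + card P" using BNP card_Un_disjoint by metis
  have d: "dim N = card N" "dim P = card P"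
    using independent_subset[of N] independent_subset[of P] by (auto simp: N_def P_def dim_eq_card_independent)
  have nz2: "\<exists>b\<in>B. \<xi> \<bullet> b \<noteq> 0" if "\<xi> \<in> T" "\<xi> \<noteq> 0" for \<xi>
    using zero_if_orthogonal that by blast
  have pos: "(A *v \<xi>) \<bullet> \<xi> > 0" if "\<xi> \<in> T" "\<xi> \<noteq> 0" "\<forall>w\<in>N. w \<bullet> \<xi> = 0" for \<xi>
  proof -
    obtain b where b: "b \<in> B" "\<xi> \<bullet> b \<noteq> 0" using nz2 \<open>\<xi> \<in> T\<close> \<open>\<xi> \<noteq> 0\<close> by blast
    have "0 \<le> l b * (\<xi> \<bullet> b)^2" if "b \<in> B" for b
      using \<open>\<forall>w\<in>N. w \<bullet> \<xi> = 0\<close> that by (cases "l b < 0") (auto simp: N_def inner_commute)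
    moreover have "0 < l b * (\<xi> \<bullet> b)^2"
      using b nz[OF b(1)] \<open>\<forall>w\<in>N. w \<bullet> \<xi> = 0\<close>
      by (cases "l b < 0") (auto simp: N_def inner_commute)
    ultimately show ?thesis unfolding form_eq[OF \<open>\<xi> \<in> T\<close>]
      using fin b(1) by (intro sum_pos2) auto
  qed
  have neg: "(A *v \<xi>) \<bullet> \<xi> < 0" if "\<xi> \<in> T" "\<xi> \<noteq> 0" "\<forall>w\<in>P. w \<bullet> \<xi> = 0" for \<xi>
  proof -
    obtain b where b: "b \<in> B" "\<xi> \<bullet> b \<noteq> 0" using nz2 \<open>\<xi> \<in> T\<close> \<open>\<xi> \<noteq> 0\<close> by blast
    have "0 \<le> - (l b * (\<xi> \<bullet> b)^2)" if "b \<in> B" for b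
      using \<open>\<forall>w\<in>P. w \<bullet> \<xi> = 0\<close> that
      by (cases "l b > 0") (auto simp: P_def inner_commute mult_nonpos_nonneg)
    moreover have "0 < - (l b * (\<xi> \<bullet> b)^2)"
      using b nz[OF b(1)] \<open>\<forall>w\<in>P. w \<bullet> \<xi> = 0\<close>
      by (cases "l b > 0") (auto simp: P_def inner_commute mult_neg_pos)
    ultimately have "0 < (\<Sum>b\<in>B. - (l b * (\<xi> \<bullet> b)^2))"
      using fin b(1) by (intro sum_pos2) auto
    thus ?thesis unfolding form_eq[OF \<open>\<xi> \<in> T\<close>] by (simp add: sum_negf)
  qed
  show ?thesis
    by (rule that[of N P]) (use base_in pos neg d c dim_eq num_neg_eq in \<open>auto simp: N_def P_def\<close>)
qed

text \<open>The law of inertia: a negative definite subspace contains no nonzero vector orthogonal to the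
  eigenvectors with negative eigenvalue, so its dimension is at most their number; likewise for the
  positive ones. When the two dimensions exhaust \<open>dim T\<close>, there is no room for the eigenvalue 0 and both
  counts are exact.\<close>
lemma inertia_from_definite_subspaces:
  fixes A :: "real^'n^'n"
  assumes A: "sym_op A" and T: "subspace T" and N: "subspace N" "N \<subseteq> T" and P: "subspace P" "P \<subseteq> T"
    and neg: "\<And>\<xi>. \<xi> \<in> N \<Longrightarrow> \<xi> \<noteq> 0 \<Longrightarrow> (A *v \<xi>) \<bullet> \<xi> < 0"
    and pos: "\<And>\<xi>. \<xi> \<in> P \<Longrightarrow> \<xi> \<noteq> 0 \<Longrightarrow> (A *v \<xi>) \<bullet> \<xi> > 0"
    and dims: "n \<le> dim N" "p \<le> dim P" "dim T = n + p"
  shows "restrict_nonsingular A T" "num_neg_eigenvalues A T = n"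
proof -
  obtain B l where "sym_eigenbasis A T B l" using sym_eigenbasis_exists[OF A T] .
  then interpret sym_eigenbasis A T B l .
  define Bn where "Bn = {b\<in>B. l b < 0}"
  define Bp where "Bp = {b\<in>B. l b > 0}"
  define Bz where "Bz = {b\<in>B. l b = 0}"
  have f: "finite Bn" "finite Bp" "finite Bz" using fin by (auto simp: Bn_def Bp_def Bz_def)
  have "{x\<in>N. \<forall>w\<in>Bn. w \<bullet> x = 0} \<subseteq> {0}"
  proof clarsimp
    fix x assume x: "x \<in> N" "\<forall>w\<in>Bn. w \<bullet> x = 0"
    have "x \<in> T" using x N by auto
    have "0 \<le> (A *v x) \<bullet> x" unfolding form_eq[OF \<open>x \<in> T\<close>]
    proof (rule sum_nonneg)
      fix b assume "b \<in> B"
      thus "0 \<le> l b * (x \<bullet> b)^2" using x(2) by (cases "l b < 0") (auto simp: Bn_def inner_commute)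
    qed
    thus "x = 0" using neg[OF x(1)] by force
  qed
  hence "dim {x\<in>N. \<forall>w\<in>Bn. w \<bullet> x = 0} = 0" by simp
  with dim_inner_constraints[OF N(1) f(1)] have n: "dim N \<le> card Bn" by simp
  have "{x\<in>P. \<forall>w\<in>Bp. w \<bullet> x = 0} \<subseteq> {0}"
  proof clarsimp
    fix x assume x: "x \<in> P" "\<forall>w\<in>Bp. w \<bullet> x = 0"
    have "x \<in> T" using x P by auto
    have "(A *v x) \<bullet> x \<le> 0" unfolding form_eq[OF \<open>x \<in> T\<close>]
    proof (rule sum_nonpos)
      fix b assume "b \<in> B"
      thus "l b * (x \<bullet> b)^2 \<le> 0" using x(2)
        by (cases "l b > 0") (auto simp: Bp_def inner_commute mult_nonpos_nonneg)
    qed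
    thus "x = 0" using pos[OF x(1)] by force
  qed
  hence "dim {x\<in>P. \<forall>w\<in>Bp. w \<bullet> x = 0} = 0" by simp
  with dim_inner_constraints[OF P(1) f(2)] have p: "dim P \<le> card Bp" by simp
  have "B = (Bn \<union> Bp) \<union> Bz" "(Bn \<union> Bp) \<inter> Bz = {}" "Bn \<inter> Bp = {}"
    by (auto simp: Bn_def Bp_def Bz_def)
  hence "card B = card Bn + card Bp + card Bz" using f by (metis card_Un_disjoint finite_Un)
  with n p dims dim_eq have "card Bz = 0" "card Bn = n" by auto
  thus "restrict_nonsingular A T" "num_neg_eigenvalues A T = n"
    using f(3) by (auto simp: nonsingular_iff num_neg_eq Bz_def Bn_def)
qed

text \<open>By compactness of the unit sphere, a form that is positive definite on the common kernel of the
  functionals in \<open>W\<close> remains uniformly positive on all vectors that the functionals almost annihilate.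
  This absorbs the change of the tangent space from \<open>xb\<close> to a nearby point.\<close>
lemma definite_form_stable:
  fixes A :: "real^'n^'n"
  assumes pos: "\<And>\<xi>. \<xi> \<noteq> 0 \<Longrightarrow> (\<forall>w\<in>W. w \<bullet> \<xi> = 0) \<Longrightarrow> (A *v \<xi>) \<bullet> \<xi> > 0"
  obtains \<delta> where "\<delta> > 0"
    "\<And>\<xi>. (\<forall>w\<in>W. \<bar>w \<bullet> \<xi>\<bar> \<le> \<delta> * norm \<xi>) \<Longrightarrow> (A *v \<xi>) \<bullet> \<xi> \<ge> \<delta> * (norm \<xi>)^2"
proof -
  have "\<exists>\<delta>>0. \<forall>\<xi>. (\<forall>w\<in>W. \<bar>w \<bullet> \<xi>\<bar> \<le> \<delta> * norm \<xi>) \<longrightarrow> (A *v \<xi>) \<bullet> \<xi> \<ge> \<delta> * (norm \<xi>)^2"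
  proof (rule ccontr)
    assume "\<not> ?thesis"
    hence neg: "\<And>\<delta>. \<delta> > 0 \<Longrightarrow> \<exists>\<xi>. (\<forall>w\<in>W. \<bar>w \<bullet> \<xi>\<bar> \<le> \<delta> * norm \<xi>) \<and> (A *v \<xi>) \<bullet> \<xi> < \<delta> * (norm \<xi>)^2"
      by force
    have "\<exists>u. norm u = 1 \<and> (\<forall>w\<in>W. \<bar>w \<bullet> u\<bar> \<le> inverse (real (Suc k))) \<and> (A *v u) \<bullet> u \<le> inverse (real (Suc k))" for k
    proof -
      obtain \<xi> where x: "\<forall>w\<in>W. \<bar>w \<bullet> \<xi>\<bar> \<le> inverse (real (Suc k)) * norm \<xi>"
        "(A *v \<xi>) \<bullet> \<xi> < inverse (real (Suc k)) * (norm \<xi>)^2"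
        using neg[of "inverse (real (Suc k))"] by auto
      have nz: "norm \<xi> > 0" using x(2) by force
      have "\<bar>w \<bullet> ((1 / norm \<xi>) *\<^sub>R \<xi>)\<bar> \<le> inverse (real (Suc k))" if "w \<in> W" for w
        using x(1) that nz by (auto simp: pos_divide_le_eq abs_mult)
      moreover have "(A *v ((1 / norm \<xi>) *\<^sub>R \<xi>)) \<bullet> ((1 / norm \<xi>) *\<^sub>R \<xi>) = (A *v \<xi>) \<bullet> \<xi> / (norm \<xi>)^2"
        by (simp add: matrix_vector_mult_scaleR power2_eq_square)
      hence "(A *v ((1 / norm \<xi>) *\<^sub>R \<xi>)) \<bullet> ((1 / norm \<xi>) *\<^sub>R \<xi>) \<le> inverse (real (Suc k))"
        using x(2) nz by (simp add: pos_divide_le_eq)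
      ultimately show ?thesis using nz by (intro exI[of _ "(1 / norm \<xi>) *\<^sub>R \<xi>"]) auto
    qed
    then obtain u where u: "\<And>k. norm (u k) = 1" "\<And>k w. w \<in> W \<Longrightarrow> \<bar>w \<bullet> u k\<bar> \<le> inverse (real (Suc k))"
      "\<And>k. (A *v u k) \<bullet> u k \<le> inverse (real (Suc k))" by metis
    have "\<forall>k. u k \<in> sphere 0 1" using u(1) by simp
    moreover have "compact (sphere (0::real^'n) 1)" by simp
    ultimately obtain v r where v: "v \<in> sphere 0 1" and r: "strict_mono (r::nat\<Rightarrow>nat)"
      and lim: "(u \<circ> r) \<longlonglongrightarrow> v"
      unfolding compact_def by meson
    have null: "(\<lambda>k. inverse (real (Suc (r k)))) \<longlonglongrightarrow> 0"
      using LIMSEQ_subseq_LIMSEQ[OF LIMSEQ_inverse_real_of_nat r] by (simp add: o_def)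
    have "w \<bullet> v = 0" if w: "w \<in> W" for w
    proof -
      have "(\<lambda>k. w \<bullet> (u \<circ> r) k) \<longlonglongrightarrow> w \<bullet> v" by (intro tendsto_intros lim)
      moreover have "(\<lambda>k. w \<bullet> (u \<circ> r) k) \<longlonglongrightarrow> 0"
        by (rule Lim_null_comparison[OF _ null]) (use u(2)[OF w] in auto)
      ultimately show ?thesis by (rule LIMSEQ_unique)
    qed
    with pos[of v] v have "(A *v v) \<bullet> v > 0" by fastforce
    moreover have "(\<lambda>k. (A *v (u \<circ> r) k) \<bullet> (u \<circ> r) k) \<longlonglongrightarrow> (A *v v) \<bullet> v"
      by (intro tendsto_intros lim
          linear_continuous_at[THEN isCont_tendsto_compose, OF matrix_vector_mul_bounded_linear])
    hence "(A *v v) \<bullet> v \<le> 0"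
      using null by (rule LIMSEQ_le) (use u(3) in auto)
    ultimately show False by simp
  qed
  thus ?thesis using that by blast
qed

section \<open>Strict differentiability and the implicit function principle\<close>

text \<open>Differentiability at \<open>p\<close> with both endpoints of the increment moving. It holds for functions that are
  continuously differentiable near \<open>p\<close>, is inherited by sums, products and compositions, and is exactly
  the estimate that makes the frozen Newton map a contraction.\<close>
definition has_strict_derivative ::
  "('a::real_normed_vector \<Rightarrow> 'b::real_normed_vector) \<Rightarrow> ('a \<Rightarrow> 'b) \<Rightarrow> 'a \<Rightarrow> bool" where
  "has_strict_derivative f f' p \<longleftrightarrow> bounded_linear f' \<and>
     (\<forall>\<epsilon>>0. \<forall>\<^sub>F w in nhds p \<times>\<^sub>F nhds p.
        norm (f (fst w) - f (snd w) - f' (fst w - snd w)) \<le> \<epsilon> * norm (fst w - snd w))"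

lemma has_strict_derivativeD:
  assumes "has_strict_derivative f f' p" "\<epsilon> > 0"
  shows "\<forall>\<^sub>F w in nhds p \<times>\<^sub>F nhds p.
    norm (f (fst w) - f (snd w) - f' (fst w - snd w)) \<le> \<epsilon> * norm (fst w - snd w)"
  using assms by (auto simp: has_strict_derivative_def)

lemma has_strict_derivative_bounded_linear:
  "has_strict_derivative f f' p \<Longrightarrow> bounded_linear f'"
  by (simp add: has_strict_derivative_def)

lemma has_strict_derivative_ball:
  assumes "has_strict_derivative f f' p" "\<epsilon> > 0"
  obtains \<delta> where "\<delta> > 0"
    "\<And>u v. u \<in> ball p \<delta> \<Longrightarrow> v \<in> ball p \<delta> \<Longrightarrow> norm (f u - f v - f' (u - v)) \<le> \<epsilon> * norm (u - v)"
  using has_strict_derivativeD[OF assms]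
  unfolding eventually_prod_same eventually_nhds_metric
  by (metis dist_commute fst_conv mem_ball snd_conv)

lemma eventually_nhds_diag:
  "eventually P (nhds p \<times>\<^sub>F nhds p) \<Longrightarrow> eventually (\<lambda>u. P (u, p)) (nhds p)"
  unfolding eventually_prod_same by (metis (mono_tags, lifting) eventually_mono eventually_nhds_x_imp_x)

lemma has_strict_derivative_imp_has_derivative:
  assumes "has_strict_derivative f f' p"
  shows "(f has_derivative f') (at p)"
  unfolding has_derivative_at_alt
proof (intro conjI allI impI)
  show "bounded_linear f'" using assms by (rule has_strict_derivative_bounded_linear)
  fix e :: real assume "e > 0"
  from eventually_nhds_diag[OF has_strict_derivativeD[OF assms this]]
  show "\<exists>d>0. \<forall>y. norm (y - p) < d \<longrightarrow> norm (f y - f p - f' (y - p)) \<le> e * norm (y - p)"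
    by (simp add: eventually_nhds_metric dist_norm)
qed

lemma has_strict_derivative_tendsto:
  assumes "has_strict_derivative f f' p"
  shows "(f \<longlongrightarrow> f p) (nhds p)"
  using has_derivative_continuous[OF has_strict_derivative_imp_has_derivative[OF assms]]
  by (simp add: continuous_at tendsto_at_iff_tendsto_nhds)

lemma has_strict_derivative_lipschitz:
  assumes "has_strict_derivative f f' p"
  obtains L where "L > 0"
    "\<forall>\<^sub>F w in nhds p \<times>\<^sub>F nhds p. norm (f (fst w) - f (snd w)) \<le> L * norm (fst w - snd w)"
proof -
  obtain K where K: "K > 0" "\<And>x. norm (f' x) \<le> norm x * K"
    using bounded_linear.pos_bounded[OF has_strict_derivative_bounded_linear[OF assms]] by blast
  have "\<forall>\<^sub>F w in nhds p \<times>\<^sub>F nhds p. norm (f (fst w) - f (snd w)) \<le> (1 + K) * norm (fst w - snd w)"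
    using has_strict_derivativeD[OF assms zero_less_one]
  proof eventually_elim
    case (elim w)
    have "norm (f (fst w) - f (snd w)) \<le>
      norm (f (fst w) - f (snd w) - f' (fst w - snd w)) + norm (f' (fst w - snd w))"
      by (metis add.commute norm_triangle_sub)
    also have "\<dots> \<le> 1 * norm (fst w - snd w) + norm (fst w - snd w) * K"
      by (intro add_mono elim K)
    finally show ?case by (simp add: algebra_simps)
  qed
  with K(1) show ?thesis by (intro that[of "1 + K"]) auto
qed

lemma has_strict_derivative_linear:
  assumes "bounded_linear f"
  shows "has_strict_derivative f f p"
  using assms by (simp add: has_strict_derivative_def linear_diff bounded_linear.linear)

lemma has_strict_derivative_const: "has_strict_derivative (\<lambda>_. c) (\<lambda>_. 0) p"
  by (simp add: has_strict_derivative_def)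

lemma has_strict_derivative_add:
  assumes "has_strict_derivative f f' p" "has_strict_derivative g g' p"
  shows "has_strict_derivative (\<lambda>x. f x + g x) (\<lambda>h. f' h + g' h) p"
  unfolding has_strict_derivative_def
proof (intro conjI allI impI)
  show "bounded_linear (\<lambda>h. f' h + g' h)"
    using assms by (intro bounded_linear_add has_strict_derivative_bounded_linear)
  fix \<epsilon> :: real assume "\<epsilon> > 0"
  hence "\<epsilon> / 2 > 0" by simp
  from has_strict_derivativeD[OF assms(1) this] has_strict_derivativeD[OF assms(2) this]
  show "\<forall>\<^sub>F w in nhds p \<times>\<^sub>F nhds p. norm (f (fst w) + g (fst w) - (f (snd w) + g (snd w)) -
      (f' (fst w - snd w) + g' (fst w - snd w))) \<le> \<epsilon> * norm (fst w - snd w)"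
  proof eventually_elim
    case (elim w)
    have "f (fst w) + g (fst w) - (f (snd w) + g (snd w)) - (f' (fst w - snd w) + g' (fst w - snd w))
      = (f (fst w) - f (snd w) - f' (fst w - snd w)) + (g (fst w) - g (snd w) - g' (fst w - snd w))"
      by simp
    also have "norm \<dots> \<le> \<epsilon> / 2 * norm (fst w - snd w) + \<epsilon> / 2 * norm (fst w - snd w)"
      by (rule norm_triangle_le) (use elim in linarith)
    finally show ?case by simp
  qed
qed

lemma has_strict_derivative_compose:
  assumes f: "has_strict_derivative f f' p" and g: "has_strict_derivative g g' (f p)"
  shows "has_strict_derivative (\<lambda>x. g (f x)) (\<lambda>h. g' (f' h)) p"
  unfolding has_strict_derivative_def
proof (intro conjI allI impI)
  show "bounded_linear (\<lambda>h. g' (f' h))"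
    using assms by (intro bounded_linear_compose[of g' f'] has_strict_derivative_bounded_linear)
  fix \<epsilon> :: real assume e: "\<epsilon> > 0"
  obtain L where L: "L > 0"
    "\<forall>\<^sub>F w in nhds p \<times>\<^sub>F nhds p. norm (f (fst w) - f (snd w)) \<le> L * norm (fst w - snd w)"
    using has_strict_derivative_lipschitz[OF f] .
  obtain K where K: "K > 0" "\<And>x. norm (g' x) \<le> norm x * K"
    using bounded_linear.pos_bounded[OF has_strict_derivative_bounded_linear[OF g]] by blast
  have lin: "linear g'" using has_strict_derivative_bounded_linear[OF g] bounded_linear.linear by blast
  define a where "a = \<epsilon> / (2 * L)"
  define b where "b = \<epsilon> / (2 * K)"
  have ab: "a > 0" "b > 0" "a * L = \<epsilon> / 2" "b * K = \<epsilon> / 2"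
    using e K L by (auto simp: a_def b_def)
  have "filterlim (\<lambda>w. (f (fst w), f (snd w))) (nhds (f p) \<times>\<^sub>F nhds (f p)) (nhds p \<times>\<^sub>F nhds p)"
    using has_strict_derivative_tendsto[OF f]
    by (intro filterlim_Pair filterlim_compose[OF _ filterlim_fst] filterlim_compose[OF _ filterlim_snd])
  from filterlim_iff[THEN iffD1, OF this, rule_format, OF has_strict_derivativeD[OF g ab(1)]]
  have "\<forall>\<^sub>F w in nhds p \<times>\<^sub>F nhds p. norm (g (f (fst w)) - g (f (snd w)) - g' (f (fst w) - f (snd w)))
      \<le> a * norm (f (fst w) - f (snd w))" by simp
  with L(2) has_strict_derivativeD[OF f ab(2)]
  show "\<forall>\<^sub>F w in nhds p \<times>\<^sub>F nhds p.
      norm (g (f (fst w)) - g (f (snd w)) - g' (f' (fst w - snd w))) \<le> \<epsilon> * norm (fst w - snd w)"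
  proof eventually_elim
    case (elim w)
    let ?h = "norm (fst w - snd w)"
    have dec: "g (f (fst w)) - g (f (snd w)) - g' (f' (fst w - snd w)) =
      (g (f (fst w)) - g (f (snd w)) - g' (f (fst w) - f (snd w))) +
      g' (f (fst w) - f (snd w) - f' (fst w - snd w))" by (simp add: linear_diff[OF lin])
    have "norm (g (f (fst w)) - g (f (snd w)) - g' (f (fst w) - f (snd w))) \<le> a * (L * ?h)"
      using elim(3) mult_left_mono[OF elim(1), of a] ab by linarith
    moreover have "norm (g' (f (fst w) - f (snd w) - f' (fst w - snd w))) \<le> b * ?h * K"
      using K(2)[of "f (fst w) - f (snd w) - f' (fst w - snd w)"] mult_right_mono[OF elim(2), of K] K(1)
      by linarith
    moreover have "a * (L * ?h) = (a * L) * ?h" "b * ?h * K = (b * K) * ?h" by simp_all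
    hence "a * (L * ?h) = \<epsilon> / 2 * ?h" "b * ?h * K = \<epsilon> / 2 * ?h" unfolding ab .
    ultimately show ?case unfolding dec
      using norm_triangle_ineq[of "g (f (fst w)) - g (f (snd w)) - g' (f (fst w) - f (snd w))"
        "g' (f (fst w) - f (snd w) - f' (fst w - snd w))"] by linarith
  qed
qed

lemma has_strict_derivative_scaleR:
  fixes f :: "'a::real_normed_vector \<Rightarrow> real"
  assumes f: "has_strict_derivative f f' p" and g: "has_strict_derivative g g' p"
  shows "has_strict_derivative (\<lambda>x. f x *\<^sub>R g x) (\<lambda>h. f' h *\<^sub>R g p + f p *\<^sub>R g' h) p"
  unfolding has_strict_derivative_def
proof (intro conjI allI impI)
  have bl: "bounded_linear f'" "bounded_linear g'"
    using assms by (auto intro: has_strict_derivative_bounded_linear)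
  show "bounded_linear (\<lambda>h. f' h *\<^sub>R g p + f p *\<^sub>R g' h)"
    using bl by (intro bounded_linear_add bounded_linear_scaleR_const bounded_linear_const_scaleR)
  fix \<epsilon> :: real assume e: "\<epsilon> > 0"
  obtain L where L: "L > 0"
    "\<forall>\<^sub>F w in nhds p \<times>\<^sub>F nhds p. norm (f (fst w) - f (snd w)) \<le> L * norm (fst w - snd w)"
    using has_strict_derivative_lipschitz[OF f] .
  obtain K where K: "K > 0" "\<And>x. norm (g' x) \<le> norm x * K"
    using bounded_linear.pos_bounded[OF bl(2)] by blast
  define a where "a = \<epsilon> / (4 * (norm (g p) + 1))"
  define b where "b = \<epsilon> / (4 * (\<bar>f p\<bar> + 1))"
  define c where "c = \<epsilon> / (4 * K)"
  define d where "d = \<epsilon> / (4 * L)"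
  have pos: "a > 0" "b > 0" "c > 0" "d > 0"
    using e K L by (auto simp: a_def b_def c_def d_def intro!: divide_pos_pos add_nonneg_pos)
  have scale: "\<epsilon> / (4 * x) * x = \<epsilon> / 4" if "x > 0" for x using that by simp
  have eqs: "a * (norm (g p) + 1) = \<epsilon> / 4" "b * (\<bar>f p\<bar> + 1) = \<epsilon> / 4" "c * K = \<epsilon> / 4" "d * L = \<epsilon> / 4"
    unfolding a_def b_def c_def d_def by (rule scale, use K L in \<open>simp add: add_nonneg_pos\<close>)+
  have "((\<lambda>w. f (snd w)) \<longlongrightarrow> f p) (nhds p \<times>\<^sub>F nhds p)"
    by (rule filterlim_compose[OF has_strict_derivative_tendsto[OF f] filterlim_snd])
  hence e1: "\<forall>\<^sub>F w in nhds p \<times>\<^sub>F nhds p. \<bar>f (snd w) - f p\<bar> < min 1 c"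
    using pos by (auto simp: tendsto_iff dist_real_def simp del: min_less_iff_conj)
  have "((\<lambda>w. g (fst w)) \<longlongrightarrow> g p) (nhds p \<times>\<^sub>F nhds p)"
    by (rule filterlim_compose[OF has_strict_derivative_tendsto[OF g] filterlim_fst])
  hence e2: "\<forall>\<^sub>F w in nhds p \<times>\<^sub>F nhds p. norm (g (fst w) - g p) < d"
    using pos by (auto simp: tendsto_iff dist_norm)
  have e3: "\<forall>\<^sub>F w in nhds p \<times>\<^sub>F nhds p. norm (g (fst w) - g p) < 1"
    using \<open>((\<lambda>w. g (fst w)) \<longlongrightarrow> g p) _\<close> by (auto simp: tendsto_iff dist_norm)
  show "\<forall>\<^sub>F w in nhds p \<times>\<^sub>F nhds p. norm (f (fst w) *\<^sub>R g (fst w) - f (snd w) *\<^sub>R g (snd w) -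
      (f' (fst w - snd w) *\<^sub>R g p + f p *\<^sub>R g' (fst w - snd w))) \<le> \<epsilon> * norm (fst w - snd w)"
    using e1 e2 e3 L(2) has_strict_derivativeD[OF f pos(1)] has_strict_derivativeD[OF g pos(2)]
  proof eventually_elim
    case (elim w)
    obtain u v where w: "w = (u, v)" by (cases w)
    note E = elim[unfolded w fst_conv snd_conv]
    let ?h = "norm (u - v)"
    let ?t1 = "(f u - f v - f' (u - v)) *\<^sub>R g p"
    let ?t2 = "(f u - f v) *\<^sub>R (g u - g p)"
    let ?t3 = "f v *\<^sub>R (g u - g v - g' (u - v))"
    let ?t4 = "(f v - f p) *\<^sub>R g' (u - v)"
    \<comment> \<open>The linearisation errors of \<open>f\<close> and \<open>g\<close>, and two products in which one factor tends to 0.\<close>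
    have dec: "f u *\<^sub>R g u - f v *\<^sub>R g v - (f' (u - v) *\<^sub>R g p + f p *\<^sub>R g' (u - v)) = (?t1 + ?t2) + (?t3 + ?t4)"
      by (simp add: algebra_simps)
    have "norm ?t1 \<le> (a * ?h) * (norm (g p) + 1)"
      using E(5) by (auto intro!: mult_mono)
    moreover have "norm ?t2 \<le> (L * ?h) * d"
      using E(4) E(2) L by (auto intro!: mult_mono)
    moreover have "norm ?t3 \<le> (\<bar>f p\<bar> + 1) * (b * ?h)"
      using E(6) E(1) by (auto intro!: mult_mono)
    moreover have "norm ?t4 \<le> c * (?h * K)"
      using E(1) K(2)[of "u - v"] pos by (auto intro!: mult_mono)
    moreover have "(a * ?h) * (norm (g p) + 1) = (a * (norm (g p) + 1)) * ?h" "(L * ?h) * d = (d * L) * ?h"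
      "(\<bar>f p\<bar> + 1) * (b * ?h) = (b * (\<bar>f p\<bar> + 1)) * ?h" "c * (?h * K) = (c * K) * ?h"
      by (simp_all only: ac_simps)
    hence "(a * ?h) * (norm (g p) + 1) = \<epsilon> / 4 * ?h" "(L * ?h) * d = \<epsilon> / 4 * ?h"
      "(\<bar>f p\<bar> + 1) * (b * ?h) = \<epsilon> / 4 * ?h" "c * (?h * K) = \<epsilon> / 4 * ?h"
      unfolding eqs .
    moreover have "norm ((?t1 + ?t2) + (?t3 + ?t4)) \<le> (norm ?t1 + norm ?t2) + (norm ?t3 + norm ?t4)"
      by (intro order.trans[OF norm_triangle_ineq] add_mono norm_triangle_ineq)
    ultimately show ?case unfolding w fst_conv snd_conv dec by linarith
  qed
qed

lemma has_strict_derivative_cmul: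
  assumes "has_strict_derivative f f' p"
  shows "has_strict_derivative (\<lambda>x. c *\<^sub>R f x) (\<lambda>h. c *\<^sub>R f' h) p"
  using has_strict_derivative_scaleR[OF has_strict_derivative_const assms] by simp

lemma has_strict_derivative_diff:
  assumes "has_strict_derivative f f' p" "has_strict_derivative g g' p"
  shows "has_strict_derivative (\<lambda>x. f x - g x) (\<lambda>h. f' h - g' h) p"
  using has_strict_derivative_add[OF assms(1) has_strict_derivative_cmul[OF assms(2), of "-1"]] by simp

lemma has_strict_derivative_mult:
  fixes f g :: "'a::real_normed_vector \<Rightarrow> real"
  assumes "has_strict_derivative f f' p" "has_strict_derivative g g' p"
  shows "has_strict_derivative (\<lambda>x. f x * g x) (\<lambda>h. f' h * g p + f p * g' h) p"
  using has_strict_derivative_scaleR[OF assms] by simp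

lemma has_strict_derivative_sum:
  assumes "\<And>i. i \<in> I \<Longrightarrow> has_strict_derivative (f i) (f' i) p"
  shows "has_strict_derivative (\<lambda>x. \<Sum>i\<in>I. f i x) (\<lambda>h. \<Sum>i\<in>I. f' i h) p"
  using assms
  by (induction I rule: infinite_finite_induct)
    (auto intro: has_strict_derivative_const has_strict_derivative_add)

lemma has_strict_derivative_Pair:
  assumes "has_strict_derivative f f' p" "has_strict_derivative g g' p"
  shows "has_strict_derivative (\<lambda>x. (f x, g x)) (\<lambda>h. (f' h, g' h)) p"
proof -
  have "bounded_linear (\<lambda>y. (y, 0))" "bounded_linear (\<lambda>y. (0, y))"
    by (auto intro: bounded_linear_Pair bounded_linear_ident bounded_linear_zero)
  from has_strict_derivative_add[OF
      has_strict_derivative_compose[OF assms(1) has_strict_derivative_linear[OF this(1)]]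
      has_strict_derivative_compose[OF assms(2) has_strict_derivative_linear[OF this(2)]]]
  show ?thesis by simp
qed

lemma has_strict_derivative_vec:
  fixes f :: "'i::finite \<Rightarrow> 'a::real_normed_vector \<Rightarrow> real"
  assumes "\<And>i. has_strict_derivative (f i) (f' i) p"
  shows "has_strict_derivative (\<lambda>x. \<chi> i. f i x) (\<lambda>h. \<chi> i. f' i h) p"
proof -
  have eq: "(\<chi> i. c i) = (\<Sum>i\<in>UNIV. c i *\<^sub>R axis i 1)" for c :: "'i \<Rightarrow> real"
    by (simp add: vec_eq_iff axis_def if_distrib cong: if_cong)
  have "has_strict_derivative (\<lambda>x. \<Sum>i\<in>UNIV. f i x *\<^sub>R (axis i 1 :: real^'i))
      (\<lambda>h. \<Sum>i\<in>UNIV. f' i h *\<^sub>R axis i 1) p"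
    using has_strict_derivative_scaleR[OF assms has_strict_derivative_const]
    by (intro has_strict_derivative_sum) simp
  thus ?thesis by (simp only: eq)
qed

text \<open>The mean value inequality for \<open>f - f' p\<close> on a small ball.\<close>
lemma has_strict_derivative_C1:
  fixes f :: "'a::real_normed_vector \<Rightarrow> 'b::real_normed_vector"
  assumes der: "\<forall>\<^sub>F x in nhds p. (f has_derivative f' x) (at x)"
    and cont: "\<And>\<epsilon>. \<epsilon> > 0 \<Longrightarrow> \<forall>\<^sub>F x in nhds p. \<forall>h. norm (f' x h - f' p h) \<le> \<epsilon> * norm h"
  shows "has_strict_derivative f (f' p) p"
  unfolding has_strict_derivative_def
proof (intro conjI allI impI)
  show "bounded_linear (f' p)"
    using eventually_nhds_x_imp_x[OF der] by (rule has_derivative_bounded_linear)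
  fix \<epsilon> :: real assume e: "\<epsilon> > 0"
  from eventually_conj[OF der cont[OF this]] obtain d where d: "d > 0"
    "\<And>x. dist x p < d \<Longrightarrow> (f has_derivative f' x) (at x) \<and> (\<forall>h. norm (f' x h - f' p h) \<le> \<epsilon> * norm h)"
    unfolding eventually_nhds_metric by blast
  have "norm (f u - f v - f' p (u - v)) \<le> \<epsilon> * norm (u - v)" if uv: "u \<in> ball p d" "v \<in> ball p d" for u v
  proof -
    have "norm (f u - f v - f' p (u - v)) \<le> norm (u - v) * \<epsilon>"
    proof (rule differentiable_bound_linearization[where S = "ball p d"])
      show "v + t *\<^sub>R (u - v) \<in> ball p d" if "t \<in> {0..1}" for t
        using convexD_alt[OF convex_ball uv(2) uv(1), of t] that by (simp add: algebra_simps)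
      show "(f has_derivative f' x) (at x within ball p d)" if "x \<in> ball p d" for x
        using d(2)[of x] that by (auto simp: dist_commute intro: has_derivative_at_withinI)
      show "onorm (f' x - f' p) \<le> \<epsilon>" if "x \<in> ball p d" for x
        using d(2)[of x] that e by (intro onorm_bound) (auto simp: dist_commute)
      show "p \<in> ball p d" using d by simp
    qed
    thus ?thesis by (simp add: mult.commute)
  qed
  thus "\<forall>\<^sub>F w in nhds p \<times>\<^sub>F nhds p. norm (f (fst w) - f (snd w) - f' p (fst w - snd w)) \<le> \<epsilon> * norm (fst w - snd w)"
    unfolding eventually_prod_same
    using d(1) by (intro exI[of _ "\<lambda>x. x \<in> ball p d"]) (auto simp: eventually_nhds_metric dist_commute)
qed

lemma has_strict_derivative_real:
  fixes f :: "real \<Rightarrow> real"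
  assumes "\<forall>\<^sub>F x in nhds p. (f has_real_derivative f' x) (at x)" "isCont f' p"
  shows "has_strict_derivative f (\<lambda>h. f' p * h) p"
proof (rule has_strict_derivative_C1[where f' = "\<lambda>x h. f' x * h"])
  show "\<forall>\<^sub>F x in nhds p. (f has_derivative (*) (f' x)) (at x)"
    using assms(1) by (simp add: has_field_derivative_def)
  fix \<epsilon> :: real assume "\<epsilon> > 0"
  hence "\<forall>\<^sub>F x in nhds p. dist (f' x) (f' p) < \<epsilon>"
    using assms(2) unfolding isCont_def tendsto_at_iff_tendsto_nhds by (auto simp: tendsto_iff)
  thus "\<forall>\<^sub>F x in nhds p. \<forall>h. norm (f' x * h - f' p * h) \<le> \<epsilon> * norm h"
    by eventually_elim
      (auto simp: dist_real_def left_diff_distrib[symmetric] abs_mult intro!: mult_right_mono)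
qed

text \<open>Near \<open>z0\<close> the Newton map \<open>z - M' (\<Phi> (s, z))\<close> with the inverse \<open>M'\<close> of the derivative at \<open>(0, z0)\<close> contracts
  by the factor 1/2, uniformly in small \<open>s\<close>; its fixed points are the zeros of \<open>\<Phi> (s, _)\<close>. The radius in the
  first part does not depend on \<open>s\<close>, and the zero of the second part can be found as close to \<open>z0\<close> as desired.\<close>
lemma implicit_solution:
  fixes \<Phi> :: "real \<times> 'a::euclidean_space \<Rightarrow> 'a"
  assumes strict: "has_strict_derivative \<Phi> L (0, z0)" and zero: "\<Phi> (0, z0) = 0"
    and inj: "\<And>z. L (0, z) = 0 \<Longrightarrow> z = 0"
  shows "\<exists>\<delta>>0. \<forall>s z z'. \<bar>s\<bar> < \<delta> \<longrightarrow> z \<in> ball z0 \<delta> \<longrightarrow> z' \<in> ball z0 \<delta> \<longrightarrow>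
      \<Phi> (s, z) = 0 \<longrightarrow> \<Phi> (s, z') = 0 \<longrightarrow> z = z'" (is ?unique)
    and "\<And>r. r > 0 \<Longrightarrow> \<exists>\<delta>>0. \<forall>s. \<bar>s\<bar> < \<delta> \<longrightarrow> (\<exists>z\<in>ball z0 r. \<Phi> (s, z) = 0)"
proof -
  have blL: "bounded_linear L" using strict by (rule has_strict_derivative_bounded_linear)
  define M where "M z = L (0, z)" for z
  have blM: "bounded_linear M" unfolding M_def
    by (intro bounded_linear_compose[OF blL] bounded_linear_Pair bounded_linear_zero bounded_linear_ident)
  hence linM: "linear M" by (rule bounded_linear.linear)
  hence "inj M" using inj by (simp add: linear_injective_0 M_def)
  then obtain M' where M': "linear M'" "\<And>x. M' (M x) = x" "\<And>x. M (M' x) = x"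
    using linM linear_injective_isomorphism by blast
  then obtain K where K: "K > 0" "\<And>x. norm (M' x) \<le> norm x * K"
    using bounded_linear.pos_bounded[OF linear_conv_bounded_linear[THEN iffD1]] by blast
  define G where "G s z = z - M' (\<Phi> (s, z))" for s z
  have "1 / (2 * K) > 0" using K by simp
  then obtain d where d: "d > 0"
    and D: "\<And>u v. u \<in> ball (0, z0) d \<Longrightarrow> v \<in> ball (0, z0) d \<Longrightarrow>
      norm (\<Phi> u - \<Phi> v - L (u - v)) \<le> 1 / (2 * K) * norm (u - v)"
    using has_strict_derivative_ball[OF strict] by blast
  have inball: "(s, z) \<in> ball (0, z0) d" if "\<bar>s\<bar> < d / 2" "dist z0 z < d / 2" for s z
  proof -
    have "norm (- s, z0 - z) \<le> norm (- s) + norm (z0 - z)" by (rule norm_Pair_le)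
    also have "\<dots> < d" using that by (simp add: dist_norm)
    finally show ?thesis by (simp add: dist_norm)
  qed
  have contr: "norm (G s z - G s z') \<le> norm (z - z') / 2"
    if s: "\<bar>s\<bar> < d / 2" and z: "dist z0 z < d / 2" "dist z0 z' < d / 2" for s z z'
  proof -
    have "G s z - G s z' = - M' (\<Phi> (s, z) - \<Phi> (s, z') - M (z - z'))"
      by (simp add: G_def linear_diff[OF M'(1)] linear_diff[OF linM] M'(2))
    hence "norm (G s z - G s z') \<le> norm (\<Phi> (s, z) - \<Phi> (s, z') - L ((s, z) - (s, z'))) * K"
      using K(2) by (simp add: M_def)
    also have "\<dots> \<le> (1 / (2 * K) * norm ((s, z) - (s, z'))) * K"
      using K(1) by (intro mult_right_mono D inball s z) auto
    finally show ?thesis using K(1) by simp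
  qed
  show ?unique
  proof (intro exI[of _ "d / 2"] conjI allI impI)
    fix s z z' assume *: "\<bar>s\<bar> < d / 2" "z \<in> ball z0 (d / 2)" "z' \<in> ball z0 (d / 2)"
      and "\<Phi> (s, z) = 0" "\<Phi> (s, z') = 0"
    hence "G s z = z" "G s z' = z'" by (auto simp: G_def linear_0[OF M'(1)])
    with contr[of s z z'] * show "z = z'" by simp
  qed (use d in simp)
  fix r :: real assume r: "r > 0"
  define q where "q = min (d / 4) (r / 2)"
  have q: "q > 0" "q < d / 2" "q < r" using d r by (auto simp: q_def)
  have "((\<lambda>s. \<Phi> (s, z0)) \<longlongrightarrow> \<Phi> (0, z0)) (nhds 0)"
    by (rule filterlim_compose[OF has_strict_derivative_tendsto[OF strict]])
      (intro tendsto_Pair tendsto_const filterlim_ident)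
  hence "\<forall>\<^sub>F s in nhds 0. norm (\<Phi> (s, z0)) < q / (2 * K)"
    using q K by (auto simp: tendsto_iff zero)
  then obtain e where e: "e > 0" "\<And>s. \<bar>s\<bar> < e \<Longrightarrow> norm (\<Phi> (s, z0)) < q / (2 * K)"
    by (auto simp: eventually_nhds_metric dist_real_def)
  show "\<exists>\<delta>>0. \<forall>s. \<bar>s\<bar> < \<delta> \<longrightarrow> (\<exists>z\<in>ball z0 r. \<Phi> (s, z) = 0)"
  proof (intro exI[of _ "min e (d / 2)"] conjI allI impI)
    fix s assume "\<bar>s\<bar> < min e (d / 2)"
    hence s: "\<bar>s\<bar> < e" "\<bar>s\<bar> < d / 2" by auto
    have "norm (G s z0 - z0) \<le> norm (\<Phi> (s, z0)) * K" using K(2) by (simp add: G_def)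
    also have "\<dots> \<le> (q / (2 * K)) * K" using e(2)[OF s(1)] K(1) by (intro mult_right_mono) auto
    also have "\<dots> = q / 2" using K(1) by simp
    finally have G0: "norm (G s z0 - z0) \<le> q / 2" .
    have "\<exists>!z\<in>cball z0 q. G s z = z"
    proof (rule Banach_fix[where c = "1/2"])
      show "complete (cball z0 q)" by (simp add: complete_eq_closed)
      show "cball z0 q \<noteq> {}" using q by auto
      show "G s ` cball z0 q \<subseteq> cball z0 q"
      proof clarsimp
        fix z assume z: "dist z0 z \<le> q"
        have "norm (G s z - G s z0) \<le> norm (z - z0) / 2"
          using z q s d by (intro contr) auto
        hence "norm (G s z - G s z0) \<le> q / 2" using z by (simp add: dist_norm norm_minus_commute)
        with G0 have "norm ((G s z - G s z0) + (G s z0 - z0)) \<le> q"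
          by (intro norm_triangle_le) simp
        thus "dist z0 (G s z) \<le> q" by (simp add: dist_norm norm_minus_commute)
      qed
      show "dist (G s x) (G s y) \<le> 1/2 * dist x y" if "x \<in> cball z0 q" "y \<in> cball z0 q" for x y
        using contr[of s x y] that q s by (simp add: dist_norm)
    qed auto
    then obtain z where z: "dist z0 z \<le> q" "G s z = z" by auto
    hence "M (M' (\<Phi> (s, z))) = 0" by (simp add: G_def linear_0[OF linM])
    hence "\<Phi> (s, z) = 0" by (simp add: M'(3))
    thus "\<exists>z\<in>ball z0 r. \<Phi> (s, z) = 0" using z q by (intro bexI[of _ z]) auto
  qed (use e d in simp)
qed

section \<open>Gradients and Hessians of twice continuously differentiable functions\<close>

lemma C2_has_derivative:
  assumes "C2 g"
  shows "(g has_derivative (\<lambda>h. grad g x \<bullet> h)) (at x)"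
proof -
  have d: "(g has_derivative frechet_derivative g (at x)) (at x)"
    using assms by (simp add: C2_def frechet_derivative_works)
  hence lin: "linear (frechet_derivative g (at x))" by (rule has_derivative_linear)
  have "frechet_derivative g (at x) h = grad g x \<bullet> h" for h
  proof -
    have "frechet_derivative g (at x) h = frechet_derivative g (at x) (\<Sum>i\<in>UNIV. h $ i *\<^sub>R axis i 1)"
      by (rule arg_cong[where f = "frechet_derivative g (at x)"])
        (simp add: vec_eq_iff axis_def if_distrib cong: if_cong)
    also have "\<dots> = grad g x \<bullet> h"
      by (simp add: linear_sum[OF lin] linear_cmul[OF lin] grad_def inner_vec_def mult.commute)
    finally show ?thesis .
  qed
  hence "frechet_derivative g (at x) = (\<lambda>h. grad g x \<bullet> h)" by (rule ext)
  with d show ?thesis by simp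
qed

lemma C2_grad_has_derivative:
  assumes "C2 g"
  shows "(grad g has_derivative (\<lambda>h. hess g x *v h)) (at x)"
  using assms by (simp add: C2_def hess_def jacobian_works)

lemma grad_eqI:
  assumes "(g has_derivative (\<lambda>h. v \<bullet> h)) (at x)"
  shows "grad g x = v"
  using frechet_derivative_at[OF assms, symmetric]
  by (simp add: grad_def vec_eq_iff inner_axis)

lemma hess_eqI:
  assumes "(grad g has_derivative D) (at x)"
  shows "hess g x *v h = D h"
proof -
  have "grad g differentiable (at x)" using assms by (rule differentiableI)
  hence "(grad g has_derivative (\<lambda>h. hess g x *v h)) (at x)" by (simp add: hess_def jacobian_works)
  from has_derivative_unique[OF assms this] show ?thesis by metis
qed

lemma norm_matrix_vector_mult_le:
  fixes A :: "real^'n^'m"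
  shows "norm (A *v h) \<le> (real CARD('m) * real CARD('n) * norm A) * norm h"
proof -
  have "\<bar>A $ i $ j\<bar> \<le> norm A" for i j
    using component_le_norm_cart[of "A $ i" j] Finite_Cartesian_Product.norm_nth_le[of A i] by linarith
  hence "onorm ((*v) A) \<le> real CARD('m) * real CARD('n) * norm A" by (rule onorm_le_matrix_component)
  moreover have "norm (A *v h) \<le> onorm ((*v) A) * norm h"
    by (rule onorm) (rule matrix_vector_mul_bounded_linear)
  ultimately show ?thesis by (meson mult_right_mono norm_ge_zero order_trans)
qed

lemma C2_has_strict_derivative_grad:
  fixes g :: "real^'n \<Rightarrow> real"
  assumes g: "C2 g"
  shows "has_strict_derivative (grad g) (\<lambda>h. hess g x *v h) x"
proof (rule has_strict_derivative_C1[where f' = "\<lambda>y h. hess g y *v h"])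
  show "\<forall>\<^sub>F x in nhds x. (grad g has_derivative (*v) (hess g x)) (at x)"
    using C2_grad_has_derivative[OF g] by simp
  fix \<epsilon> :: real assume "\<epsilon> > 0"
  define c where "c = real CARD('n) * real CARD('n)"
  have c: "c > 0" by (simp add: c_def)
  have "continuous (at x) (hess g)" using g by (simp add: C2_def continuous_on_eq_continuous_at)
  hence "\<forall>\<^sub>F y in nhds x. dist (hess g y) (hess g x) < \<epsilon> / c"
    using c \<open>\<epsilon> > 0\<close> unfolding continuous_at tendsto_at_iff_tendsto_nhds by (auto simp: tendsto_iff)
  thus "\<forall>\<^sub>F y in nhds x. \<forall>h. norm (hess g y *v h - hess g x *v h) \<le> \<epsilon> * norm h"
  proof eventually_elim
    case (elim y)
    hence "c * norm (hess g y - hess g x) \<le> \<epsilon>" using c by (simp add: dist_norm field_simps)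
    hence "norm ((hess g y - hess g x) *v h) \<le> \<epsilon> * norm h" for h
      using norm_matrix_vector_mult_le[of "hess g y - hess g x" h] mult_right_mono[OF _ norm_ge_zero[of h]]
      unfolding c_def[symmetric] by (meson order_trans)
    thus ?case by (simp add: matrix_vector_mult_diff_rdistrib)
  qed
qed

lemma C2_has_strict_derivative:
  fixes g :: "real^'n \<Rightarrow> real"
  assumes g: "C2 g"
  shows "has_strict_derivative g (\<lambda>h. grad g x \<bullet> h) x"
proof (rule has_strict_derivative_C1[where f' = "\<lambda>y h. grad g y \<bullet> h"])
  show "\<forall>\<^sub>F x in nhds x. (g has_derivative (\<bullet>) (grad g x)) (at x)"
    using C2_has_derivative[OF g] by simp
  fix \<epsilon> :: real assume "\<epsilon> > 0"
  hence "\<forall>\<^sub>F y in nhds x. dist (grad g y) (grad g x) < \<epsilon>"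
    using has_strict_derivative_tendsto[OF C2_has_strict_derivative_grad[OF g]] by (auto simp: tendsto_iff)
  thus "\<forall>\<^sub>F y in nhds x. \<forall>h. norm (grad g y \<bullet> h - grad g x \<bullet> h) \<le> \<epsilon> * norm h"
  proof eventually_elim
    case (elim y)
    have "\<bar>(grad g y - grad g x) \<bullet> h\<bar> \<le> \<epsilon> * norm h" for h
      using Cauchy_Schwarz_ineq2[of "grad g y - grad g x" h] elim
        mult_right_mono[of "norm (grad g y - grad g x)" \<epsilon> "norm h"] by (auto simp: dist_norm)
    thus ?case by (simp add: inner_diff_left)
  qed
qed

text \<open>The second difference \<open>S\<close> of \<open>g\<close> in the directions \<open>u\<close> and \<open>v\<close> is symmetric in \<open>u\<close> and \<open>v\<close>. By the mean value
  theorem in one direction and strict differentiability of the gradient it equals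
  \<open>t\<^sup>2 * ((hess g x *v v) \<bullet> u)\<close> up to an arbitrarily small multiple of \<open>t\<^sup>2\<close>.\<close>
lemma C2_hess_symmetric:
  fixes g :: "real^'n \<Rightarrow> real"
  assumes g: "C2 g"
  shows "sym_op (hess g x)"
proof -
  have key: "\<bar>(hess g x *v v) \<bullet> u - (hess g x *v u) \<bullet> v\<bar> \<le> \<epsilon>" if e: "\<epsilon> > 0" for u v \<epsilon>
  proof -
    \<comment> \<open>The summand 1 covers the case that \<open>u\<close> or \<open>v\<close> is 0.\<close>
    define c where "c = \<epsilon> / (2 * (norm u * norm v + 1))"
    have c: "c > 0" "2 * c * (norm u * norm v) \<le> \<epsilon>"
    proof -
      have p: "norm u * norm v + 1 > 0" by (simp add: add_nonneg_pos)
      thus "c > 0" using e by (simp add: c_def)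
      hence "2 * c * (norm u * norm v) \<le> 2 * c * (norm u * norm v + 1)" by simp
      also have "\<dots> = \<epsilon>" using p unfolding c_def by (simp del: times_divide_eq_left distrib_left add: field_simps)
      finally show "2 * c * (norm u * norm v) \<le> \<epsilon>" .
    qed
    obtain d where d: "d > 0" and D: "\<And>a b. a \<in> ball x d \<Longrightarrow> b \<in> ball x d \<Longrightarrow>
      norm (grad g a - grad g b - hess g x *v (a - b)) \<le> c * norm (a - b)"
      using has_strict_derivative_ball[OF C2_has_strict_derivative_grad[OF g] c(1)] by blast
    have shift: "x + y \<in> ball x d" if "norm y < d" for y
      using that by (simp add: dist_norm)
    define t where "t = d / (2 * (norm u + norm v + 1))"
    have p: "norm u + norm v + 1 > 0" by (simp add: add_nonneg_pos)
    have t: "t > 0" using d p by (simp add: t_def)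
    have tb: "t * (norm u + norm v) < d"
    proof -
      have "t * (norm u + norm v) \<le> t * (norm u + norm v + 1)" using t by simp
      also have "\<dots> = d / 2" using p unfolding t_def by (simp del: distrib_left add: field_simps)
      finally show ?thesis using d by simp
    qed
    define S where "S = g (x + t *\<^sub>R u + t *\<^sub>R v) - g (x + t *\<^sub>R u) - g (x + t *\<^sub>R v) + g x"
    have one: "\<bar>S - t^2 * ((hess g x *v b) \<bullet> a)\<bar> \<le> c * t^2 * (norm u * norm v)"
      if ab: "(a = u \<and> b = v) \<or> (a = v \<and> b = u)" for a b
    proof -
      define \<psi> where "\<psi> r = g (x + t *\<^sub>R b + r *\<^sub>R a) - g (x + r *\<^sub>R a)" for r
      have der: "(\<psi> has_real_derivative ((grad g (x + t *\<^sub>R b + r *\<^sub>R a) - grad g (x + r *\<^sub>R a)) \<bullet> a)) (at r)" for r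
      proof -
        have "(\<psi> has_derivative (\<lambda>h. grad g (x + t *\<^sub>R b + r *\<^sub>R a) \<bullet> (h *\<^sub>R a) - grad g (x + r *\<^sub>R a) \<bullet> (h *\<^sub>R a))) (at r)"
          unfolding \<psi>_def
          by (intro has_derivative_diff has_derivative_compose[OF _ C2_has_derivative[OF g]])
            (auto intro!: derivative_eq_intros)
        thus ?thesis unfolding has_field_derivative_def
          by (rule has_derivative_eq_rhs) (simp add: fun_eq_iff inner_diff_left algebra_simps)
      qed
      obtain r where r: "0 < r" "r < t"
        "\<psi> t - \<psi> 0 = (t - 0) * ((grad g (x + t *\<^sub>R b + r *\<^sub>R a) - grad g (x + r *\<^sub>R a)) \<bullet> a)"
        using MVT2[of 0 t \<psi>, OF t der] by blast
      have S: "S = \<psi> t - \<psi> 0" using ab by (auto simp: S_def \<psi>_def algebra_simps)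
      have "norm (t *\<^sub>R b + r *\<^sub>R a) \<le> t * norm b + r * norm a"
        using r t by (intro norm_triangle_le) simp
      also have "\<dots> \<le> t * (norm u + norm v)"
        using ab r t by (auto simp: algebra_simps intro!: mult_right_mono)
      finally have n1: "norm (t *\<^sub>R b + r *\<^sub>R a) < d" using tb by simp
      have "r * norm a \<le> t * norm a" "0 \<le> t * norm b" using r t by (auto intro: mult_right_mono)
      hence "r * norm a \<le> t * norm a + t * norm b" by linarith
      hence "norm (r *\<^sub>R a) \<le> t * (norm u + norm v)"
        using ab r by (auto simp: distrib_left)
      hence n2: "norm (r *\<^sub>R a) < d" using tb by simp
      define E where "E = grad g (x + t *\<^sub>R b + r *\<^sub>R a) - grad g (x + r *\<^sub>R a) - hess g x *v (t *\<^sub>R b)"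
      have "x + t *\<^sub>R b + r *\<^sub>R a \<in> ball x d" "x + r *\<^sub>R a \<in> ball x d"
        using shift[OF n1] shift[OF n2] by (simp_all only: add.assoc)
      note D[OF this]
      moreover have "x + t *\<^sub>R b + r *\<^sub>R a - (x + r *\<^sub>R a) = t *\<^sub>R b" by simp
      ultimately have "norm E \<le> c * norm (t *\<^sub>R b)" unfolding E_def by metis
      hence E: "norm E \<le> c * t * norm b" using t by simp
      have "S - t^2 * ((hess g x *v b) \<bullet> a) = t * (E \<bullet> a)"
        unfolding S r(3) E_def
        by (simp add: inner_diff_left matrix_vector_mult_scaleR algebra_simps power2_eq_square)
      also have "\<bar>\<dots>\<bar> \<le> t * (norm E * norm a)"
        using t Cauchy_Schwarz_ineq2[of E a] by (simp add: abs_mult)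
      also have "\<dots> \<le> t * (c * t * norm b * norm a)"
        using t E by (intro mult_left_mono mult_right_mono) auto
      also have "\<dots> = c * t^2 * (norm u * norm v)" using ab by (auto simp: power2_eq_square)
      finally show ?thesis .
    qed
    have "\<bar>t^2 * ((hess g x *v v) \<bullet> u) - t^2 * ((hess g x *v u) \<bullet> v)\<bar> \<le> 2 * (c * t^2 * (norm u * norm v))"
      using one[of u v] one[of v u] by simp
    moreover have "t^2 * \<bar>(hess g x *v v) \<bullet> u - (hess g x *v u) \<bullet> v\<bar> =
        \<bar>t^2 * ((hess g x *v v) \<bullet> u) - t^2 * ((hess g x *v u) \<bullet> v)\<bar>"
      by (simp add: right_diff_distrib[symmetric] abs_mult)
    moreover have "2 * (c * t^2 * (norm u * norm v)) = t^2 * (2 * c * (norm u * norm v))" by simp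
    ultimately have "t^2 * \<bar>(hess g x *v v) \<bullet> u - (hess g x *v u) \<bullet> v\<bar> \<le> t^2 * (2 * c * (norm u * norm v))"
      by simp
    hence "\<bar>(hess g x *v v) \<bullet> u - (hess g x *v u) \<bullet> v\<bar> \<le> 2 * c * (norm u * norm v)"
      using t by (simp only: mult_le_cancel_left_pos zero_less_power)
    with c show ?thesis by linarith
  qed
  have "(hess g x *v v) \<bullet> u = (hess g x *v u) \<bullet> v" for u v
  proof (rule ccontr)
    assume ne: "(hess g x *v v) \<bullet> u \<noteq> (hess g x *v u) \<bullet> v"
    with key[of "\<bar>(hess g x *v v) \<bullet> u - (hess g x *v u) \<bullet> v\<bar> / 2" v u] show False by simp
  qed
  thus ?thesis by (simp add: sym_op_def inner_commute)
qed

section \<open>The optimality conditions of a single pair\<close>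

text \<open>Here \<open>a\<close>, \<open>b\<close> stand for the values of \<open>F1\<close>, \<open>F2\<close> at an index \<open>j\<close>, and \<open>p\<close>, \<open>q\<close> for the coefficients of their
  gradients once the multipliers \<open>\<eta>\<close>, \<open>\<nu>\<close>, \<open>\<omega>\<close> of the three constraints of the pair have been collected.\<close>
definition scholtes_pair :: "real \<Rightarrow> real \<Rightarrow> real \<Rightarrow> real \<Rightarrow> real \<Rightarrow> bool" where
  "scholtes_pair t a b p q \<longleftrightarrow> 0 \<le> a \<and> 0 \<le> b \<and> a * b \<le> t \<and>
     (\<exists>\<eta> \<nu> \<omega>. 0 \<le> \<eta> \<and> 0 \<le> \<nu> \<and> 0 \<le> \<omega> \<and> \<eta> * (t - a * b) = 0 \<and> \<nu> * a = 0 \<and> \<omega> * b = 0 \<and>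
        p = \<nu> - \<eta> * b \<and> q = \<omega> - \<eta> * a)"

lemma scholtes_pair_commute: "scholtes_pair t a b p q \<longleftrightarrow> scholtes_pair t b a q p"
proof -
  have "scholtes_pair t b a q p" if "scholtes_pair t a b p q" for a b p q
  proof -
    from that obtain \<eta> \<nu> \<omega> where "0 \<le> a" "0 \<le> b" "a * b \<le> t" "0 \<le> \<eta>" "0 \<le> \<nu>" "0 \<le> \<omega>"
      "\<eta> * (t - a * b) = 0" "\<nu> * a = 0" "\<omega> * b = 0" "p = \<nu> - \<eta> * b" "q = \<omega> - \<eta> * a"
      unfolding scholtes_pair_def by (elim conjE exE)
    thus ?thesis unfolding scholtes_pair_def
      by (intro conjI exI[of _ \<eta>] exI[of _ \<omega>] exI[of _ \<nu>]) (simp_all only: mult.commute[of b a])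
  qed
  thus ?thesis by blast
qed

text \<open>In this and the next lemmas, the signs of \<open>p\<close> and \<open>q\<close> decide which of the three multipliers are nonzero:
  a positive coefficient can only come from a nonnegativity constraint, a negative one only from the
  product constraint.\<close>
lemma scholtes_pair_pos:
  assumes "0 < t" "0 < p" "0 < b"
  shows "scholtes_pair t a b p q \<longleftrightarrow> a = 0 \<and> q = 0"
proof
  assume "scholtes_pair t a b p q"
  then obtain \<eta> \<nu> \<omega> where *: "0 \<le> \<eta>" "0 \<le> \<nu>" "\<eta> * (t - a * b) = 0" "\<nu> * a = 0" "\<omega> * b = 0"
    "p = \<nu> - \<eta> * b" "q = \<omega> - \<eta> * a" unfolding scholtes_pair_def by blast
  have "\<eta> * b \<ge> 0" using * assms by simp
  hence "\<nu> > 0" using * assms by linarith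
  hence "a = 0" using * by simp
  thus "a = 0 \<and> q = 0" using * assms by simp
next
  assume "a = 0 \<and> q = 0"
  thus "scholtes_pair t a b p q" using assms
    unfolding scholtes_pair_def
    by (intro conjI, simp_all) (rule exI[of _ 0], simp)
qed

lemma scholtes_pair_pos_pos:
  assumes "0 < t" "0 < p" "0 < q"
  shows "scholtes_pair t a b p q \<longleftrightarrow> a = 0 \<and> b = 0"
proof
  assume "scholtes_pair t a b p q"
  then obtain \<eta> \<nu> \<omega> where *: "0 \<le> \<eta>" "0 \<le> a" "0 \<le> b" "\<nu> * a = 0" "\<omega> * b = 0"
    "p = \<nu> - \<eta> * b" "q = \<omega> - \<eta> * a" unfolding scholtes_pair_def by blast
  have "\<eta> * b \<ge> 0" "\<eta> * a \<ge> 0" using * by simp_all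
  hence "\<nu> > 0" "\<omega> > 0" using * assms by linarith+
  thus "a = 0 \<and> b = 0" using * by simp
next
  assume "a = 0 \<and> b = 0"
  thus "scholtes_pair t a b p q" using assms
    unfolding scholtes_pair_def by (intro conjI exI[of _ 0] exI[of _ p] exI[of _ q]) auto
qed

lemma scholtes_pair_negD:
  assumes "0 < t" "p < 0" "scholtes_pair t a b p q"
  shows "a * b = t" "0 < a" "0 < b" "p * a = q * b" "q < 0"
proof -
  obtain \<eta> \<nu> \<omega> where *: "0 \<le> a" "0 \<le> b" "0 \<le> \<eta>" "0 \<le> \<nu>" "\<eta> * (t - a * b) = 0" "\<nu> * a = 0" "\<omega> * b = 0"
    "p = \<nu> - \<eta> * b" "q = \<omega> - \<eta> * a" using assms unfolding scholtes_pair_def by blast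
  have "\<eta> * b > 0" using * assms by linarith
  hence h: "\<eta> > 0" "b > 0" using * by (auto simp: zero_less_mult_iff)
  thus ab: "a * b = t" using * by simp
  thus a: "0 < a" using assms h by (metis zero_less_mult_pos2)
  show "0 < b" by (rule h)
  have "p = - \<eta> * b" "q = - \<eta> * a" using * h a by auto
  thus "p * a = q * b" "q < 0" using h a by auto
qed

lemma scholtes_pair_neg:
  assumes "0 < t" "p < 0" "0 < b"
  shows "scholtes_pair t a b p q \<longleftrightarrow> a * b = t \<and> p * a = q * b"
proof
  assume "scholtes_pair t a b p q"
  from scholtes_pair_negD[OF assms(1,2) this] show "a * b = t \<and> p * a = q * b" by simp
next
  assume *: "a * b = t \<and> p * a = q * b"
  hence "0 < a" using assms by (metis zero_less_mult_pos2)
  moreover have "q = - (- p / b) * a" using * assms by (simp add: field_simps)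
  moreover have "p = - (- p / b) * b" using assms by simp
  ultimately show "scholtes_pair t a b p q" using assms *
    unfolding scholtes_pair_def
    by (intro conjI exI[of _ "- p / b"] exI[of _ 0]) (auto simp: divide_nonpos_pos)
qed

text \<open>The equations \<open>a * b = s\<^sup>2\<close> and \<open>p * a = q * b\<close> have a degenerate linearisation at \<open>a = b = s = 0\<close>. Solved for
  \<open>a\<close> and \<open>b\<close> they do not.\<close>
lemma scholtes_pair_neg_neg:
  assumes "0 < s" "p < 0" "q < 0"
  shows "scholtes_pair (s^2) a b p q \<longleftrightarrow> a = s * sqrt (q / p) \<and> b = s * sqrt (p / q)"
proof
  assume sp: "scholtes_pair (s^2) a b p q"
  have s2: "0 < s^2" using assms by simp
  note D = scholtes_pair_negD[OF s2 assms(2) sp]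
  have 1: "q / p = a / b" "p / q = b / a" using D assms by (auto simp: field_simps)
  have "(s * sqrt (q / p))^2 = a^2" "(s * sqrt (p / q))^2 = b^2"
    using D by (simp_all add: 1 power_mult_distrib D(1)[symmetric]) (simp_all add: power2_eq_square)
  thus "a = s * sqrt (q / p) \<and> b = s * sqrt (p / q)"
    using D assms by (auto simp: power2_eq_iff_nonneg divide_nonpos_neg)
next
  assume *: "a = s * sqrt (q / p) \<and> b = s * sqrt (p / q)"
  have pos: "q / p > 0" "p / q > 0" using assms by (auto simp: divide_neg_neg)
  have "sqrt (q / p) * sqrt (p / q) = 1"
    using assms by (simp add: real_sqrt_mult[symmetric])
  hence ab: "a * b = s^2" using * by (simp add: power2_eq_square)
  have "b > 0" using * pos assms by simp
  have "p * sqrt (q / p) = q * sqrt (p / q)"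
  proof -
    have "(- p * sqrt (q / p))^2 = (- q * sqrt (p / q))^2"
      using pos assms by (simp add: power_mult_distrib) (simp add: power2_eq_square)
    moreover have "0 \<le> - p * sqrt (q / p)" "0 \<le> - q * sqrt (p / q)"
      using pos assms by (auto simp: mult_nonpos_nonneg)
    ultimately have "- p * sqrt (q / p) = - q * sqrt (p / q)" by (simp only: power2_eq_iff_nonneg)
    thus ?thesis by simp
  qed
  hence "p * a = q * b" using * by (simp add: algebra_simps)
  with ab \<open>b > 0\<close> assms show "scholtes_pair (s^2) a b p q"
    by (subst scholtes_pair_neg) auto
qed

text \<open>A function that is not active in the limit has a small coefficient: it is 0, or its ratio to the
  coefficient of the partner is \<open>b / a\<close>.\<close>
lemma scholtes_pair_inactive_bound:
  assumes "0 < t" "0 < a" "b \<le> \<kappa> * a" "scholtes_pair t a b p q"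
  shows "\<bar>p\<bar> \<le> \<kappa> * \<bar>q\<bar>"
proof -
  obtain \<eta> \<nu> \<omega> where *: "0 \<le> b" "0 \<le> \<eta>" "\<eta> * (t - a * b) = 0" "\<nu> * a = 0" "\<omega> * b = 0"
    "p = \<nu> - \<eta> * b" "q = \<omega> - \<eta> * a" using assms unfolding scholtes_pair_def by blast
  show ?thesis
  proof (cases "\<eta> = 0")
    case True
    have "0 \<le> \<kappa>" using assms * by (metis dual_order.trans zero_le_mult_iff not_le less_le_not_le)
    thus ?thesis using True * assms by simp
  next
    case False
    hence "a * b = t" using * by simp
    hence "b \<noteq> 0" using assms by auto
    hence "p = - \<eta> * b" "q = - \<eta> * a" using * assms by auto
    hence "\<bar>p\<bar> = \<eta> * b" "\<bar>q\<bar> = \<eta> * a" using * assms by (auto simp: abs_mult)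
    thus ?thesis using mult_left_mono[OF assms(3) *(2)] by (simp add: algebra_simps)
  qed
qed

section \<open>The system near a C-stationary point\<close>
text \<open>The functions of both families are indexed by \<open>'k + 'k\<close>, so that one argument serves for \<open>F1\<close> and \<open>F2\<close>;
  \<open>partner\<close> exchanges the two members of a pair.\<close>
definition partner :: "'k + 'k \<Rightarrow> 'k + 'k" where
  "partner = case_sum Inr Inl"

lemma partner_simps [simp]: "partner (Inl j) = Inr j" "partner (Inr j) = Inl j"
  by (simp_all add: partner_def)

lemma partner_partner [simp]: "partner (partner i) = i"
  by (cases i) auto

definition comp_fun :: "(real^'n \<Rightarrow> real^'k) \<Rightarrow> (real^'n \<Rightarrow> real^'k) \<Rightarrow> 'k + 'k \<Rightarrow> real^'n \<Rightarrow> real" where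
  "comp_fun F1 F2 = case_sum (\<lambda>j x. F1 x $ j) (\<lambda>j x. F2 x $ j)"

lemma comp_fun_simps [simp]:
  "comp_fun F1 F2 (Inl j) = (\<lambda>x. F1 x $ j)" "comp_fun F1 F2 (Inr j) = (\<lambda>x. F2 x $ j)"
  by (simp_all add: comp_fun_def)

lemma sum_UNIV_sum:
  fixes h :: "'a::finite + 'b::finite \<Rightarrow> 'c::comm_monoid_add"
  shows "(\<Sum>i\<in>UNIV. h i) = (\<Sum>j\<in>UNIV. h (Inl j)) + (\<Sum>j\<in>UNIV. h (Inr j))"
  by (simp add: UNIV_Plus_UNIV[symmetric] sum.Plus del: UNIV_Plus_UNIV)

text \<open>A C-stationary point with its multipliers \<open>mb\<close>, extended by 0 to the functions that are positive there.
  The assumption \<open>mult_inactive\<close> contains NDC4 and \<open>mult_biactive\<close> is NDC2.\<close>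
locale regular_pairs =
  fixes f :: "real^'n \<Rightarrow> real" and F1 F2 :: "real^'n \<Rightarrow> real^'k"
    and xb :: "real^'n" and mb :: "real^('k + 'k)"
  assumes C2_f: "C2 f" and C2_F1: "\<And>j. C2 (\<lambda>x. F1 x $ j)" and C2_F2: "\<And>j. C2 (\<lambda>x. F2 x $ j)"
    and feasible: "\<And>i. 0 \<le> comp_fun F1 F2 i xb"
    and compl: "\<And>i. comp_fun F1 F2 i xb * comp_fun F1 F2 (partner i) xb = 0"
    and mult_inactive: "\<And>i. comp_fun F1 F2 i xb \<noteq> 0 \<Longrightarrow> mb $ i = 0 \<and> mb $ partner i \<noteq> 0"
    and mult_biactive: "\<And>i. comp_fun F1 F2 i xb = 0 \<Longrightarrow> comp_fun F1 F2 (partner i) xb = 0 \<Longrightarrow>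
      mb $ i * mb $ partner i > 0"
    and stationary: "grad f xb = (\<Sum>i\<in>UNIV. mb $ i *\<^sub>R grad (comp_fun F1 F2 i) xb)"
begin

abbreviation G :: "'k + 'k \<Rightarrow> real^'n \<Rightarrow> real" where "G \<equiv> comp_fun F1 F2"

abbreviation I :: "('k + 'k) set" where "I \<equiv> {i. G i xb = 0}"

text \<open>The Hessian at \<open>x\<close> of the Lagrange function with multipliers \<open>m\<close>; see \<open>mpcc_lagrangian_hessian\<close>.\<close>
definition M :: "real^'n \<Rightarrow> real^('k + 'k) \<Rightarrow> real^'n^'n" where
  "M x m = hess f x - (\<Sum>i\<in>UNIV. m $ i *\<^sub>R hess (G i) x)"

definition T :: "(real^'n) set" where
  "T = {\<xi>. \<forall>i\<in>I. grad (G i) xb \<bullet> \<xi> = 0}"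

text \<open>The Karush-Kuhn-Tucker conditions of the regularisation in normalised multipliers. Each pair is listed
  twice, once for each of its members.\<close>
definition kkt_at :: "real \<Rightarrow> real^'n \<Rightarrow> real^('k + 'k) \<Rightarrow> bool" where
  "kkt_at t x m \<longleftrightarrow> grad f x = (\<Sum>i\<in>UNIV. m $ i *\<^sub>R grad (G i) x) \<and>
     (\<forall>i. scholtes_pair t (G i x) (G (partner i) x) (m $ i) (m $ partner i))"

text \<open>The pairs whose product constraint becomes active.\<close>
definition neg_pair :: "'k + 'k \<Rightarrow> bool" where
  "neg_pair i \<longleftrightarrow> mb $ i < 0 \<or> mb $ partner i < 0"

definition near_signs :: "real^'n \<Rightarrow> real^('k + 'k) \<Rightarrow> bool" where
  "near_signs x m \<longleftrightarrow> (\<forall>i. (0 < G i xb \<longrightarrow> 0 < G i x) \<and> (0 < mb $ i \<longrightarrow> 0 < m $ i) \<and> (mb $ i < 0 \<longrightarrow> m $ i < 0))"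

lemma C2_G: "C2 (G i)"
  using C2_F1 C2_F2 by (cases i) auto

lemma G_pos_iff: "0 < G i xb \<longleftrightarrow> i \<notin> I"
  using feasible[of i] by auto

lemma partner_in_I: "i \<notin> I \<Longrightarrow> partner i \<in> I"
  using compl[of i] by auto

lemma neg_pair_partner: "neg_pair (partner i) \<longleftrightarrow> neg_pair i"
  by (auto simp: neg_pair_def)

lemma mult_cases:
  assumes "i \<in> I"
  obtains (inactive) "partner i \<notin> I" "mb $ i \<noteq> 0" "mb $ partner i = 0" "neg_pair i \<longleftrightarrow> mb $ i < 0"
  | (biactive_pos) "partner i \<in> I" "mb $ i > 0" "mb $ partner i > 0" "\<not> neg_pair i"
  | (biactive_neg) "partner i \<in> I" "mb $ i < 0" "mb $ partner i < 0" "neg_pair i"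
  using assms mult_inactive[of "partner i"] mult_biactive[of i]
  by (cases "partner i \<in> I") (auto simp: neg_pair_def zero_less_mult_iff)

text \<open>The equations found in the previous section, assigned to the members of a pair such that, linearised
  at \<open>s = 0\<close>, the equation of \<open>i\<close> fixes the increment of \<open>G i\<close> if \<open>i \<in> I\<close>, and otherwise, together with the
  equation of the partner, the increment of \<open>m $ i\<close>.\<close>
definition residual :: "'k + 'k \<Rightarrow> real \<times> (real^'n) \<times> (real^('k + 'k)) \<Rightarrow> real" where
  "residual i z = (let s = fst z; x = fst (snd z); m = snd (snd z) in
     if \<not> neg_pair i then (if i \<in> I then G i x else m $ i)
     else if i \<notin> I then m $ i * G i x - m $ partner i * G (partner i) x
     else if partner i \<in> I then G i x - s * sqrt (m $ partner i / m $ i)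
     else G i x * G (partner i) x - s * s)"

definition system :: "real \<times> (real^'n) \<times> (real^('k + 'k)) \<Rightarrow> (real^'n) \<times> (real^('k + 'k))" where
  "system z = (grad f (fst (snd z)) - (\<Sum>i\<in>UNIV. (snd (snd z) $ i) *\<^sub>R grad (G i) (fst (snd z))),
     \<chi> i. residual i z)"

lemma residual_iff_pair_active:
  assumes "near_signs x m" "0 < s" "i \<in> I"
  shows "residual i (s, x, m) = 0 \<and> residual (partner i) (s, x, m) = 0 \<longleftrightarrow>
    scholtes_pair (s^2) (G i x) (G (partner i) x) (m $ i) (m $ partner i)"
proof -
  have s2: "0 < s^2" using assms by simp
  have n: "0 < G i xb \<Longrightarrow> 0 < G i x" "0 < mb $ i \<Longrightarrow> 0 < m $ i" "mb $ i < 0 \<Longrightarrow> m $ i < 0" for i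
    using assms(1) by (auto simp: near_signs_def)
  from assms(3) show ?thesis
  proof (cases rule: mult_cases)
    case inactive
    hence b: "0 < G (partner i) x" using n(1) G_pos_iff by blast
    show ?thesis
    proof (cases "neg_pair i")
      case True
      hence "m $ i < 0" using inactive n(3) by blast
      with b s2 show ?thesis using inactive assms True neg_pair_partner[of i]
        by (auto simp: residual_def scholtes_pair_neg power2_eq_square)
    next
      case False
      hence "m $ i > 0" using inactive n(2)[of i] by fastforce
      with b s2 show ?thesis using inactive assms False neg_pair_partner[of i]
        by (auto simp: residual_def scholtes_pair_pos)
    qed
  next
    case biactive_pos
    hence "m $ i > 0" "m $ partner i > 0" using n(2) by blast+
    with s2 show ?thesis using biactive_pos assms neg_pair_partner[of i]
      by (auto simp: residual_def scholtes_pair_pos_pos)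
  next
    case biactive_neg
    hence "m $ i < 0" "m $ partner i < 0" using n(3) by blast+
    with assms show ?thesis using biactive_neg neg_pair_partner[of i]
      by (auto simp: residual_def scholtes_pair_neg_neg)
  qed
qed

lemma residual_iff_pair:
  assumes "near_signs x m" "0 < s"
  shows "residual i (s, x, m) = 0 \<and> residual (partner i) (s, x, m) = 0 \<longleftrightarrow>
    scholtes_pair (s^2) (G i x) (G (partner i) x) (m $ i) (m $ partner i)"
proof (cases "i \<in> I")
  case False
  hence "partner i \<in> I" by (rule partner_in_I)
  from residual_iff_pair_active[OF assms this] show ?thesis
    using scholtes_pair_commute by auto
qed (rule residual_iff_pair_active[OF assms])

lemma system_zero_iff:
  assumes "near_signs x m" "0 < s"
  shows "system (s, x, m) = 0 \<longleftrightarrow> kkt_at (s^2) x m"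
proof -
  have "(\<forall>i. residual i (s, x, m) = 0) \<longleftrightarrow>
      (\<forall>i. scholtes_pair (s^2) (G i x) (G (partner i) x) (m $ i) (m $ partner i))"
    using residual_iff_pair[OF assms] by metis
  moreover have "(\<chi> i. residual i (s, x, m)) = 0 \<longleftrightarrow> (\<forall>i. residual i (s, x, m) = 0)" by (simp add: vec_eq_iff)
  ultimately show ?thesis by (simp add: system_def kkt_at_def zero_prod_def)
qed

lemma tendsto_G: "((\<lambda>z. G i (fst z)) \<longlongrightarrow> G i xb) (nhds (xb, mb))"
  by (rule filterlim_compose[OF has_strict_derivative_tendsto[OF C2_has_strict_derivative[OF C2_G]]])
    (auto intro!: tendsto_intros filterlim_ident simp: nhds_prod filterlim_fst)

lemma tendsto_grad_G: "((\<lambda>z. grad (G i) (fst z)) \<longlongrightarrow> grad (G i) xb) (nhds (xb, mb))"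
  by (rule filterlim_compose[OF has_strict_derivative_tendsto[OF C2_has_strict_derivative_grad[OF C2_G]]])
    (auto simp: nhds_prod filterlim_fst)

lemma tendsto_multiplier: "((\<lambda>z. snd z $ i) \<longlongrightarrow> mb $ i) (nhds (xb, mb))"
  by (intro tendsto_vec_nth) (simp add: nhds_prod filterlim_snd)

lemma eventually_near_signs: "\<forall>\<^sub>F z in nhds (xb, mb). near_signs (fst z) (snd z)"
  unfolding near_signs_def
proof (intro eventually_all_finite eventually_conj)
  fix i
  show "\<forall>\<^sub>F z in nhds (xb, mb). 0 < G i xb \<longrightarrow> 0 < G i (fst z)"
    using order_tendstoD(1)[OF tendsto_G[of i], of 0] by (cases "0 < G i xb") auto
  show "\<forall>\<^sub>F z in nhds (xb, mb). 0 < mb $ i \<longrightarrow> 0 < snd z $ i"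
    using order_tendstoD(1)[OF tendsto_multiplier[of i], of 0] by (cases "0 < mb $ i") auto
  show "\<forall>\<^sub>F z in nhds (xb, mb). mb $ i < 0 \<longrightarrow> snd z $ i < 0"
    using order_tendstoD(2)[OF tendsto_multiplier[of i], of 0] by (cases "0 > mb $ i") auto
qed

lemma eventually_nhds_balls:
  assumes "\<forall>\<^sub>F z in nhds (xb, mb). Q (fst z) (snd z)"
  obtains \<delta> where "\<delta> > 0" "\<And>x m. x \<in> ball xb \<delta> \<Longrightarrow> m \<in> ball mb \<delta> \<Longrightarrow> Q x m"
proof -
  obtain P1 P2 where P: "eventually P1 (nhds xb)" "eventually P2 (nhds mb)" "\<And>x m. P1 x \<Longrightarrow> P2 m \<Longrightarrow> Q x m"
    using assms unfolding nhds_prod eventually_prod_filter by auto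
  then obtain d1 d2 where "d1 > 0" "d2 > 0" "\<And>x. dist x xb < d1 \<Longrightarrow> P1 x" "\<And>m. dist m mb < d2 \<Longrightarrow> P2 m"
    unfolding eventually_nhds_metric by blast
  with P(3) show ?thesis by (intro that[of "min d1 d2"]) (auto simp: dist_commute)
qed

lemma strict_x: "has_strict_derivative (\<lambda>z. fst (snd z)) (\<lambda>h. fst (snd h)) p"
  by (intro has_strict_derivative_linear bounded_linear_fst_comp bounded_linear_snd)

lemma strict_m: "has_strict_derivative (\<lambda>z. snd (snd z) $ i) (\<lambda>h. snd (snd h) $ i) p"
  by (intro has_strict_derivative_linear bounded_linear_compose[OF bounded_linear_vec_nth]
      bounded_linear_snd_comp bounded_linear_snd)

lemma strict_s: "has_strict_derivative fst fst p"
  by (intro has_strict_derivative_linear bounded_linear_fst)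

lemma strict_G: "has_strict_derivative (\<lambda>z. G i (fst (snd z))) (\<lambda>h. grad (G i) (fst (snd p)) \<bullet> fst (snd h)) p"
  by (rule has_strict_derivative_compose[OF strict_x C2_has_strict_derivative[OF C2_G]])

lemma strict_grad:
  "C2 g \<Longrightarrow> has_strict_derivative (\<lambda>z. grad g (fst (snd z))) (\<lambda>h. hess g (fst (snd p)) *v fst (snd h)) p"
  by (rule has_strict_derivative_compose[OF strict_x C2_has_strict_derivative_grad])


lemma strict_sqrt_quotient:
  assumes "mb $ i < 0" "mb $ j < 0"
  obtains D where "has_strict_derivative (\<lambda>z. sqrt (snd (snd z) $ j / snd (snd z) $ i)) D (0::real, xb, mb)"
proof -
  let ?p = "(0, xb, mb) :: real \<times> (real^'n) \<times> (real^('k + 'k))"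
  have inv: "has_strict_derivative inverse (\<lambda>h. - inverse ((mb $ i)^2) * h) (mb $ i)"
  proof (rule has_strict_derivative_real)
    have "\<forall>\<^sub>F x in nhds (mb $ i). x \<noteq> 0"
      using assms(1) by (intro t1_space_nhds) simp
    thus "\<forall>\<^sub>F x in nhds (mb $ i). (inverse has_real_derivative - inverse (x^2)) (at x)"
      by eventually_elim (auto intro!: derivative_eq_intros simp: power2_eq_square)
    show "isCont (\<lambda>x. - inverse (x^2)) (mb $ i)"
      using assms by (intro continuous_intros) auto
  qed
  have q: "0 < mb $ j * inverse (mb $ i)" using assms by (simp add: mult_neg_neg)
  have sq: "has_strict_derivative sqrt (\<lambda>h. inverse (sqrt (mb $ j * inverse (mb $ i))) / 2 * h) (mb $ j * inverse (mb $ i))"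
  proof (rule has_strict_derivative_real)
    have "\<forall>\<^sub>F x in nhds (mb $ j * inverse (mb $ i)). 0 < x"
      by (rule order_tendstoD(1)[OF filterlim_ident q])
    thus "\<forall>\<^sub>F x in nhds (mb $ j * inverse (mb $ i)). (sqrt has_real_derivative inverse (sqrt x) / 2) (at x)"
      by eventually_elim (rule DERIV_real_sqrt)
    show "isCont (\<lambda>x. inverse (sqrt x) / 2) (mb $ j * inverse (mb $ i))"
      using q by (intro continuous_intros) auto
  qed
  have "has_strict_derivative (\<lambda>z. inverse (snd (snd z) $ i)) (\<lambda>h. - inverse ((mb $ i)^2) * (snd (snd h) $ i)) ?p"
    by (rule has_strict_derivative_compose[OF strict_m[of i ?p]]) (use inv in simp)
  from has_strict_derivative_mult[OF strict_m[of j ?p] this]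
  have "\<exists>D. has_strict_derivative (\<lambda>z. snd (snd z) $ j * inverse (snd (snd z) $ i)) D ?p" by blast
  then obtain D where "has_strict_derivative (\<lambda>z. snd (snd z) $ j * inverse (snd (snd z) $ i)) D ?p" ..
  hence "has_strict_derivative (\<lambda>z. sqrt (snd (snd z) $ j * inverse (snd (snd z) $ i)))
      (\<lambda>h. inverse (sqrt (mb $ j * inverse (mb $ i))) / 2 * D h) ?p"
    by (rule has_strict_derivative_compose) (use sq in simp)
  thus ?thesis unfolding divide_inverse by (rule that[unfolded divide_inverse])
qed

text \<open>Every term with a factor \<open>s\<close> drops out in the directions \<open>(0, dx, dm)\<close>. In the last case the coefficient \<open>d\<close>
  is harmless: the partner of an inactive function is active, so \<open>grad (G (partner i)) xb \<bullet> dx\<close> vanishes as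
  soon as the equation of the partner is satisfied.\<close>
lemma strict_residual:
  "\<exists>D. has_strict_derivative (residual i) D (0, xb, mb) \<and>
     (if i \<in> I then \<exists>c. c \<noteq> 0 \<and> (\<forall>dx dm. D (0, dx, dm) = c * (grad (G i) xb \<bullet> dx))
      else \<exists>c d. c \<noteq> 0 \<and> (\<forall>dx dm. D (0, dx, dm) = c * dm $ i + d * (grad (G (partner i)) xb \<bullet> dx)))"
proof -
  let ?p = "(0, xb, mb) :: real \<times> (real^'n) \<times> (real^('k + 'k))"
  let ?r = "residual i"
  have active: ?thesis if "has_strict_derivative ?r D ?p" "i \<in> I" "c \<noteq> 0"
    "\<And>dx dm. D (0, dx, dm) = c * (grad (G i) xb \<bullet> dx)" for D c
    using that by (intro exI[of _ D]) auto
  have inactive: ?thesis if "has_strict_derivative ?r D ?p" "i \<notin> I" "c \<noteq> 0"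
    "\<And>dx dm. D (0, dx, dm) = c * dm $ i + d * (grad (G (partner i)) xb \<bullet> dx)" for D c d
  proof -
    have "\<exists>c d. c \<noteq> 0 \<and> (\<forall>dx dm. D (0, dx, dm) = c * dm $ i + d * (grad (G (partner i)) xb \<bullet> dx))"
      using that by blast
    with that show ?thesis by (intro exI[of _ D]) simp
  qed
  consider (pos_active) "\<not> neg_pair i" "i \<in> I" | (pos_inactive) "\<not> neg_pair i" "i \<notin> I"
    | (neg_inactive) "neg_pair i" "i \<notin> I" | (neg_bi) "neg_pair i" "i \<in> I" "partner i \<in> I"
    | (neg_active) "neg_pair i" "i \<in> I" "partner i \<notin> I" by blast
  thus ?thesis
  proof cases
    case pos_active
    hence r: "?r = (\<lambda>z. G i (fst (snd z)))" by (auto simp: residual_def)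
    show ?thesis
      by (rule active[OF strict_G[of i ?p, folded r], of 1]) (use pos_active in auto)
  next
    case pos_inactive
    hence r: "?r = (\<lambda>z. snd (snd z) $ i)" by (auto simp: residual_def)
    have "has_strict_derivative ?r (\<lambda>h. snd (snd h) $ i) ?p" unfolding r by (rule strict_m)
    from inactive[OF this, of 1 0] show ?thesis using pos_inactive by simp
  next
    case neg_inactive
    hence r: "?r = (\<lambda>z. snd (snd z) $ i * G i (fst (snd z)) - snd (snd z) $ partner i * G (partner i) (fst (snd z)))"
      by (auto simp: residual_def)
    note D = has_strict_derivative_diff[OF has_strict_derivative_mult[OF strict_m[of i ?p] strict_G[of i ?p]]
        has_strict_derivative_mult[OF strict_m[of "partner i" ?p] strict_G[of "partner i" ?p]], folded r]
    have "G (partner i) xb = 0" "mb $ i = 0" "G i xb \<noteq> 0"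
      using partner_in_I[of i] mult_inactive[of i] neg_inactive by auto
    thus ?thesis
      by (intro inactive[OF D, of "G i xb" "- mb $ partner i"]) (use neg_inactive in auto)
  next
    case neg_bi
    hence r: "?r = (\<lambda>z. G i (fst (snd z)) - fst z * sqrt (snd (snd z) $ partner i / snd (snd z) $ i))"
      by (auto simp: residual_def)
    have "mb $ i < 0 \<and> mb $ partner i < 0" using neg_bi(2) by (cases rule: mult_cases) (use neg_bi in auto)
    then obtain D where "has_strict_derivative (\<lambda>z. sqrt (snd (snd z) $ partner i / snd (snd z) $ i)) D ?p"
      using strict_sqrt_quotient[of i "partner i"] by blast
    note D = has_strict_derivative_diff[OF strict_G[of i ?p] has_strict_derivative_mult[OF strict_s[of ?p] this], folded r]
    show ?thesis
      by (rule active[OF D, of 1]) (use neg_bi in auto)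
  next
    case neg_active
    hence r: "?r = (\<lambda>z. G i (fst (snd z)) * G (partner i) (fst (snd z)) - fst z * fst z)"
      by (auto simp: residual_def)
    note D = has_strict_derivative_diff[OF has_strict_derivative_mult[OF strict_G[of i ?p] strict_G[of "partner i" ?p]]
        has_strict_derivative_mult[OF strict_s[of ?p] strict_s[of ?p]], folded r]
    show ?thesis
      by (rule active[OF D, of "G (partner i) xb"]) (use neg_active in auto)
  qed
qed

lemma system_base: "system (0, xb, mb) = 0"
proof -
  have "residual i (0, xb, mb) = 0" for i
  proof (cases "i \<in> I")
    case True
    thus ?thesis by (simp add: residual_def)
  next
    case False
    hence "mb $ i = 0" "G (partner i) xb = 0" using mult_inactive[of i] partner_in_I[of i] by auto
    with False show ?thesis by (simp add: residual_def)
  qed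
  hence "(\<chi> i. residual i (0, xb, mb)) = 0" by (simp add: vec_eq_iff)
  thus ?thesis using stationary by (simp add: system_def zero_prod_def)
qed

lemma M_mult: "M x m *v h = hess f x *v h - (\<Sum>i\<in>UNIV. m $ i *\<^sub>R (hess (G i) x *v h))"
proof -
  have "(\<Sum>i\<in>S. m $ i *\<^sub>R hess (G i) x) *v h = (\<Sum>i\<in>S. m $ i *\<^sub>R (hess (G i) x *v h))" for S
    by (induction S rule: infinite_finite_induct)
      (simp_all add: matrix_vector_mult_add_rdistrib scaleR_matrix_vector_assoc[symmetric])
  thus ?thesis by (simp add: M_def matrix_vector_mult_diff_rdistrib)
qed

lemma subspace_T: "subspace T"
  by (auto simp: T_def subspace_def inner_add_right)

section \<open>Constraints, multipliers and Hessian of the regularised problem\<close>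
definition scholtes_at ::
  "real \<Rightarrow> real^'n \<Rightarrow> real^('k + 'k) \<Rightarrow> ('k \<Rightarrow> real) \<Rightarrow> ('k \<Rightarrow> real) \<Rightarrow> ('k \<Rightarrow> real) \<Rightarrow> bool" where
  "scholtes_at t x m \<eta> \<nu>1 \<nu>2 \<longleftrightarrow> scholtes_KKT f F1 F2 t x \<eta> \<nu>1 \<nu>2 \<and>
     (\<forall>j. m $ Inl j = \<nu>1 j - \<eta> j * F2 x $ j \<and> m $ Inr j = \<nu>2 j - \<eta> j * F1 x $ j)"

lemma normalised_gradient_sum:
  assumes "\<And>j. m $ Inl j = \<nu>1 j - \<eta> j * F2 x $ j" "\<And>j. m $ Inr j = \<nu>2 j - \<eta> j * F1 x $ j"
  shows "(\<Sum>i\<in>UNIV. m $ i *\<^sub>R grad (G i) x) =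
      - (\<Sum>j\<in>UNIV. \<eta> j *\<^sub>R prod_grad F1 F2 x j)
       + (\<Sum>j\<in>UNIV. \<nu>1 j *\<^sub>R grad (\<lambda>y. F1 y $ j) x)
       + (\<Sum>j\<in>UNIV. \<nu>2 j *\<^sub>R grad (\<lambda>y. F2 y $ j) x)"
  by (simp add: sum_UNIV_sum assms prod_grad_def sum_negf[symmetric] sum.distrib[symmetric] algebra_simps)

lemma scholtes_at_imp_kkt_at:
  assumes "scholtes_at t x m \<eta> \<nu>1 \<nu>2"
  shows "kkt_at t x m"
proof -
  have K: "scholtes_KKT f F1 F2 t x \<eta> \<nu>1 \<nu>2" and m: "\<And>j. m $ Inl j = \<nu>1 j - \<eta> j * F2 x $ j"
    "\<And>j. m $ Inr j = \<nu>2 j - \<eta> j * F1 x $ j" using assms by (auto simp: scholtes_at_def)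
  have pair: "scholtes_pair t (F1 x $ j) (F2 x $ j) (m $ Inl j) (m $ Inr j)" for j
    unfolding scholtes_pair_def using K m
    by (intro conjI exI[of _ "\<eta> j"] exI[of _ "\<nu>1 j"] exI[of _ "\<nu>2 j"])
      (simp_all add: scholtes_KKT_def scholtes_feasible_def)
  have "scholtes_pair t (G i x) (G (partner i) x) (m $ i) (m $ partner i)" for i
    using pair scholtes_pair_commute by (cases i) auto
  moreover have "grad f x = (\<Sum>i\<in>UNIV. m $ i *\<^sub>R grad (G i) x)"
    using K normalised_gradient_sum[of m \<nu>1 \<eta> x \<nu>2] m by (simp add: scholtes_KKT_def)
  ultimately show ?thesis by (simp add: kkt_at_def)
qed

lemma scholtes_KKT_imp_scholtes_at:
  assumes "scholtes_KKT f F1 F2 t x \<eta> \<nu>1 \<nu>2"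
  obtains m where "scholtes_at t x m \<eta> \<nu>1 \<nu>2"
  using assms
  by (intro that[of "\<chi> i. case i of Inl j \<Rightarrow> \<nu>1 j - \<eta> j * F2 x $ j | Inr j \<Rightarrow> \<nu>2 j - \<eta> j * F1 x $ j"])
    (simp add: scholtes_at_def)

lemma kkt_at_imp_scholtes_at:
  assumes "kkt_at t x m"
  obtains \<eta> \<nu>1 \<nu>2 where "scholtes_at t x m \<eta> \<nu>1 \<nu>2"
proof -
  have "\<forall>j. scholtes_pair t (F1 x $ j) (F2 x $ j) (m $ Inl j) (m $ Inr j)"
    using assms unfolding kkt_at_def by (metis comp_fun_simps partner_simps(1))
  hence "\<forall>j. \<exists>\<eta> \<nu> \<omega>. 0 \<le> F1 x $ j \<and> 0 \<le> F2 x $ j \<and> F1 x $ j * F2 x $ j \<le> t \<and>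
    0 \<le> \<eta> \<and> 0 \<le> \<nu> \<and> 0 \<le> \<omega> \<and> \<eta> * (t - F1 x $ j * F2 x $ j) = 0 \<and> \<nu> * F1 x $ j = 0 \<and> \<omega> * F2 x $ j = 0 \<and>
    m $ Inl j = \<nu> - \<eta> * F2 x $ j \<and> m $ Inr j = \<omega> - \<eta> * F1 x $ j"
    unfolding scholtes_pair_def by blast
  then obtain \<eta> \<nu>1 \<nu>2 where *: "\<And>j. 0 \<le> F1 x $ j \<and> 0 \<le> F2 x $ j \<and> F1 x $ j * F2 x $ j \<le> t \<and>
    0 \<le> \<eta> j \<and> 0 \<le> \<nu>1 j \<and> 0 \<le> \<nu>2 j \<and> \<eta> j * (t - F1 x $ j * F2 x $ j) = 0 \<and> \<nu>1 j * F1 x $ j = 0 \<and> \<nu>2 j * F2 x $ j = 0 \<and>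
    m $ Inl j = \<nu>1 j - \<eta> j * F2 x $ j \<and> m $ Inr j = \<nu>2 j - \<eta> j * F1 x $ j"
    by metis
  have "grad f x = (\<Sum>i\<in>UNIV. m $ i *\<^sub>R grad (G i) x)" using assms by (simp add: kkt_at_def)
  with * normalised_gradient_sum[of m \<nu>1 \<eta> x \<nu>2] have "scholtes_at t x m \<eta> \<nu>1 \<nu>2"
    by (simp add: scholtes_at_def scholtes_KKT_def scholtes_feasible_def)
  thus ?thesis by (rule that)
qed

text \<open>Near \<open>(xb, mb)\<close> one coefficient of a negative pair is negative because its limit is, and then so is the other.\<close>
lemma kkt_at_neg_pair:
  assumes "near_signs x m" "0 < t" "kkt_at t x m" "neg_pair i"
  shows "G i x * G (partner i) x = t" "0 < G i x" "m $ i < 0"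
proof -
  have sp: "scholtes_pair t (G i x) (G (partner i) x) (m $ i) (m $ partner i)"
    "scholtes_pair t (G (partner i) x) (G i x) (m $ partner i) (m $ i)"
    using assms(3) scholtes_pair_commute by (auto simp: kkt_at_def)
  have "m $ i < 0 \<or> m $ partner i < 0" using assms(1,4) by (auto simp: near_signs_def neg_pair_def)
  thus "G i x * G (partner i) x = t" "0 < G i x" "m $ i < 0"
    using scholtes_pair_negD[OF assms(2) _ sp(1)] scholtes_pair_negD[OF assms(2) _ sp(2)]
    by (auto simp: mult.commute)
qed

lemma kkt_at_pos_pair:
  assumes "near_signs x m" "0 < t" "kkt_at t x m" "\<not> neg_pair i"
  shows "i \<in> I \<Longrightarrow> G i x = 0 \<and> 0 < m $ i" "G i x * G (partner i) x = 0" "G i x = 0 \<longleftrightarrow> i \<in> I"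
proof -
  have act: "G i x = 0 \<and> 0 < m $ i" if i: "i \<in> I" "\<not> neg_pair i" for i
  proof -
    have sp: "scholtes_pair t (G i x) (G (partner i) x) (m $ i) (m $ partner i)"
      using assms(3) by (simp add: kkt_at_def)
    have n: "0 < G i xb \<Longrightarrow> 0 < G i x" "0 < mb $ i \<Longrightarrow> 0 < m $ i" for i
      using assms(1) by (auto simp: near_signs_def)
    from i(1) show ?thesis
    proof (cases rule: mult_cases)
      case inactive
      hence "0 < mb $ i" using i by auto
      hence "0 < m $ i" "0 < G (partner i) x" using n inactive G_pos_iff by blast+
      with sp assms(2) show ?thesis by (simp add: scholtes_pair_pos)
    next
      case biactive_pos
      hence "0 < m $ i" "0 < m $ partner i" using n by blast+
      with sp assms(2) show ?thesis by (simp add: scholtes_pair_pos_pos)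
    qed (use i in simp)
  qed
  show "i \<in> I \<Longrightarrow> G i x = 0 \<and> 0 < m $ i" using act assms(4) by blast
  show "G i x * G (partner i) x = 0"
    using act[of i] act[of "partner i"] partner_in_I[of i] assms(4) neg_pair_partner[of i] by auto
  show "G i x = 0 \<longleftrightarrow> i \<in> I"
    using act[of i] assms(1,4) G_pos_iff[of i] by (auto simp: near_signs_def)
qed

text \<open>The product constraints add to \<open>M x m\<close> one symmetric term of rank at most two per pair. Its factor \<open>\<eta> j\<close>
  is unbounded on biactive pairs with negative multipliers; these terms create the additional negative
  eigenvalues.\<close>
lemma lagrangian_hessian:
  fixes m :: "real^('k + 'k)"
  assumes m: "\<And>j. m $ Inl j = \<nu>1 j - \<eta> j * F2 x $ j" "\<And>j. m $ Inr j = \<nu>2 j - \<eta> j * F1 x $ j"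
  shows "hess (scholtes_lagrange f F1 F2 t \<eta> \<nu>1 \<nu>2) x *v h = M x m *v h + (\<Sum>j\<in>UNIV. \<eta> j *\<^sub>R
      ((grad (G (Inr j)) x \<bullet> h) *\<^sub>R grad (G (Inl j)) x + (grad (G (Inl j)) x \<bullet> h) *\<^sub>R grad (G (Inr j)) x))"
proof -
  note d1 = C2_has_derivative[OF C2_F1] and d2 = C2_has_derivative[OF C2_F2]
  have "(scholtes_lagrange f F1 F2 t \<eta> \<nu>1 \<nu>2 has_derivative (\<lambda>h. (grad f y + (\<Sum>j\<in>UNIV. \<eta> j *\<^sub>R prod_grad F1 F2 y j)
      - (\<Sum>j\<in>UNIV. \<nu>1 j *\<^sub>R grad (\<lambda>x. F1 x $ j) y) - (\<Sum>j\<in>UNIV. \<nu>2 j *\<^sub>R grad (\<lambda>x. F2 x $ j) y)) \<bullet> h)) (at y)" for y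
  proof -
    have "(scholtes_lagrange f F1 F2 t \<eta> \<nu>1 \<nu>2 has_derivative (\<lambda>h. grad f y \<bullet> h
        - (\<Sum>j\<in>UNIV. \<eta> j * (0 - (F1 y $ j * (grad (\<lambda>x. F2 x $ j) y \<bullet> h) + (grad (\<lambda>x. F1 x $ j) y \<bullet> h) * F2 y $ j)))
        - (\<Sum>j\<in>UNIV. \<nu>1 j * (grad (\<lambda>x. F1 x $ j) y \<bullet> h)) - (\<Sum>j\<in>UNIV. \<nu>2 j * (grad (\<lambda>x. F2 x $ j) y \<bullet> h)))) (at y)"
      unfolding scholtes_lagrange_def[abs_def]
      by (intro has_derivative_diff has_derivative_sum has_derivative_mult_right has_derivative_mult
          has_derivative_const C2_has_derivative[OF C2_f] d1 d2)
    thus ?thesis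
      by (rule has_derivative_eq_rhs)
        (simp add: fun_eq_iff inner_diff_left inner_add_left inner_sum_left prod_grad_def
          sum_negf sum_subtractf sum.distrib algebra_simps)
  qed
  hence g: "grad (scholtes_lagrange f F1 F2 t \<eta> \<nu>1 \<nu>2) = (\<lambda>y. grad f y + (\<Sum>j\<in>UNIV. \<eta> j *\<^sub>R prod_grad F1 F2 y j)
      - (\<Sum>j\<in>UNIV. \<nu>1 j *\<^sub>R grad (\<lambda>x. F1 x $ j) y) - (\<Sum>j\<in>UNIV. \<nu>2 j *\<^sub>R grad (\<lambda>x. F2 x $ j) y))"
    by (intro ext grad_eqI)
  have "(grad (scholtes_lagrange f F1 F2 t \<eta> \<nu>1 \<nu>2) has_derivative (\<lambda>h. hess f x *v h
      + (\<Sum>j\<in>UNIV. \<eta> j *\<^sub>R ((F2 x $ j *\<^sub>R (hess (\<lambda>x. F1 x $ j) x *v h) + (grad (\<lambda>x. F2 x $ j) x \<bullet> h) *\<^sub>R grad (\<lambda>x. F1 x $ j) x) +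
         (F1 x $ j *\<^sub>R (hess (\<lambda>x. F2 x $ j) x *v h) + (grad (\<lambda>x. F1 x $ j) x \<bullet> h) *\<^sub>R grad (\<lambda>x. F2 x $ j) x)))
      - (\<Sum>j\<in>UNIV. \<nu>1 j *\<^sub>R (hess (\<lambda>x. F1 x $ j) x *v h)) - (\<Sum>j\<in>UNIV. \<nu>2 j *\<^sub>R (hess (\<lambda>x. F2 x $ j) x *v h)))) (at x)"
    unfolding g prod_grad_def
    by (intro has_derivative_diff has_derivative_add has_derivative_sum has_derivative_scaleR_right
        has_derivative_scaleR d1 d2 C2_grad_has_derivative C2_f C2_F1 C2_F2)
  from hess_eqI[OF this, of h] show ?thesis
    by (simp add: M_mult sum_UNIV_sum m algebra_simps sum.distrib sum_subtractf)
qed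

lemma sym_M: "sym_op (M x m)"
  using C2_hess_symmetric[OF C2_f, of x] C2_hess_symmetric[OF C2_G, of _ x]
  by (simp add: sym_op_def M_mult inner_diff_left inner_diff_right inner_sum_left inner_sum_right)

lemma mpcc_lagrangian_hessian:
  "hess (\<lambda>y. f y - (\<Sum>i\<in>UNIV. m $ i * G i y)) x = M x m"
proof -
  have "((\<lambda>y. f y - (\<Sum>i\<in>UNIV. m $ i * G i y)) has_derivative
      (\<lambda>h. (grad f y - (\<Sum>i\<in>UNIV. m $ i *\<^sub>R grad (G i) y)) \<bullet> h)) (at y)" for y
  proof -
    have "((\<lambda>y. f y - (\<Sum>i\<in>UNIV. m $ i * G i y)) has_derivative
        (\<lambda>h. grad f y \<bullet> h - (\<Sum>i\<in>UNIV. m $ i * (grad (G i) y \<bullet> h)))) (at y)"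
      by (intro has_derivative_diff has_derivative_sum has_derivative_mult_right
          C2_has_derivative[OF C2_f] C2_has_derivative[OF C2_G])
    thus ?thesis
      by (rule has_derivative_eq_rhs) (simp add: fun_eq_iff inner_diff_left inner_sum_left)
  qed
  hence g: "grad (\<lambda>y. f y - (\<Sum>i\<in>UNIV. m $ i * G i y)) = (\<lambda>y. grad f y - (\<Sum>i\<in>UNIV. m $ i *\<^sub>R grad (G i) y))"
    by (intro ext grad_eqI)
  have "(grad (\<lambda>y. f y - (\<Sum>i\<in>UNIV. m $ i * G i y)) has_derivative
      (\<lambda>h. hess f x *v h - (\<Sum>i\<in>UNIV. m $ i *\<^sub>R (hess (G i) x *v h)))) (at x)"
    unfolding g by (intro has_derivative_diff has_derivative_sum has_derivative_scaleR_right
        C2_grad_has_derivative C2_f C2_G)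
  from hess_eqI[OF this] show ?thesis by (simp add: matrix_eq M_mult)
qed

text \<open>The pairs counted by the biactive index.\<close>
definition biactive_neg :: "'k set" where
  "biactive_neg = {j. neg_pair (Inl j) \<and> Inl j \<in> I \<and> Inr j \<in> I}"

lemma active_sets:
  assumes "near_signs x m" "0 < t" "kkt_at t x m"
  shows "active_H F1 F2 t x = {j. neg_pair (Inl j)}"
    "active_N F1 x = {j. \<not> neg_pair (Inl j) \<and> Inl j \<in> I}"
    "active_N F2 x = {j. \<not> neg_pair (Inl j) \<and> Inr j \<in> I}"
proof -
  have neg: "F1 x $ j * F2 x $ j = t" "0 < F1 x $ j" "0 < F2 x $ j" if "neg_pair (Inl j)" for j
    using kkt_at_neg_pair[OF assms that] kkt_at_neg_pair[OF assms, of "Inr j"] that neg_pair_partner[of "Inl j"]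
    by auto
  have pos: "F1 x $ j * F2 x $ j = 0" "F1 x $ j = 0 \<longleftrightarrow> Inl j \<in> I" "F2 x $ j = 0 \<longleftrightarrow> Inr j \<in> I"
    if "\<not> neg_pair (Inl j)" for j
    using kkt_at_pos_pair(2,3)[OF assms that] kkt_at_pos_pair(3)[OF assms, of "Inr j"] that neg_pair_partner[of "Inl j"]
    by auto
  show "active_H F1 F2 t x = {j. neg_pair (Inl j)}"
  proof (rule set_eqI)
    fix j show "j \<in> active_H F1 F2 t x \<longleftrightarrow> j \<in> {j. neg_pair (Inl j)}"
      using neg(1)[of j] pos(1)[of j] assms(2) by (cases "neg_pair (Inl j)") (auto simp: active_H_def)
  qed
  show "active_N F1 x = {j. \<not> neg_pair (Inl j) \<and> Inl j \<in> I}"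
    using neg(2) pos(2) by (auto simp: active_N_def) (metis less_irrefl)+
  show "active_N F2 x = {j. \<not> neg_pair (Inl j) \<and> Inr j \<in> I}"
    using neg(3) pos(3) by (auto simp: active_N_def) (metis less_irrefl)+
qed

text \<open>Every function that vanishes at \<open>xb\<close> contributes one active constraint of the regularisation, except that
  the two members of a biactive negative pair share a single product constraint.\<close>
lemma card_active:
  "card {j. neg_pair (Inl j)} + card {j. \<not> neg_pair (Inl j) \<and> Inl j \<in> I} + card {j. \<not> neg_pair (Inl j) \<and> Inr j \<in> I}
    + card biactive_neg = card I"
proof -
  let ?I1 = "{j. Inl j \<in> I}" and ?I2 = "{j. Inr j \<in> I}" and ?N = "{j. neg_pair (Inl j)}"
  have "I = ?I1 <+> ?I2"
  proof (intro set_eqI)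
    show "i \<in> I \<longleftrightarrow> i \<in> ?I1 <+> ?I2" for i by (cases i) auto
  qed
  hence "card I = card ?I1 + card ?I2" by (metis card_Plus finite)
  moreover have "card ?I1 = card {j. \<not> neg_pair (Inl j) \<and> Inl j \<in> I} + card (?N \<inter> ?I1)"
    by (subst card_Un_disjoint[symmetric]) (auto intro!: arg_cong[of _ _ card])
  moreover have "card ?I2 = card {j. \<not> neg_pair (Inl j) \<and> Inr j \<in> I} + card (?N \<inter> ?I2)"
    by (subst card_Un_disjoint[symmetric]) (auto intro!: arg_cong[of _ _ card])
  moreover have "(?N \<inter> ?I1) \<union> (?N \<inter> ?I2) = ?N" using partner_in_I by fastforce
  hence "card (?N \<inter> ?I1) + card (?N \<inter> ?I2) = card ?N + card biactive_neg"
    using card_Un_Int[of "?N \<inter> ?I1" "?N \<inter> ?I2"]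
    by (simp add: biactive_neg_def Int_def conj_ac)
  ultimately show ?thesis by simp
qed

lemma scholtes_at_strict_complementarity:
  assumes "near_signs x m" "0 < t" "scholtes_at t x m \<eta> \<nu>1 \<nu>2"
  shows "\<forall>j\<in>active_H F1 F2 t x. \<eta> j > 0" "\<forall>j\<in>active_N F1 x. \<nu>1 j > 0" "\<forall>j\<in>active_N F2 x. \<nu>2 j > 0"
    and "\<And>j. \<not> neg_pair (Inl j) \<Longrightarrow> \<eta> j = 0"
    and "\<And>j. neg_pair (Inl j) \<Longrightarrow> \<eta> j * F2 x $ j = - m $ Inl j \<and> \<eta> j * F1 x $ j = - m $ Inr j"
proof -
  note kkt = scholtes_at_imp_kkt_at[OF assms(3)]
  note S = active_sets[OF assms(1,2) kkt]
  have K: "\<eta> j * (t - F1 x $ j * F2 x $ j) = 0" "\<nu>1 j * F1 x $ j = 0" "\<nu>2 j * F2 x $ j = 0"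
    "m $ Inl j = \<nu>1 j - \<eta> j * F2 x $ j" "m $ Inr j = \<nu>2 j - \<eta> j * F1 x $ j" "0 \<le> \<eta> j" for j
    using assms(3) by (auto simp: scholtes_at_def scholtes_KKT_def)
  have neg: "0 < F1 x $ j" "0 < F2 x $ j" "m $ Inl j < 0" if "neg_pair (Inl j)" for j
    using kkt_at_neg_pair[OF assms(1,2) kkt that] kkt_at_neg_pair[OF assms(1,2) kkt, of "Inr j"] that neg_pair_partner[of "Inl j"]
    by auto
  show e0: "\<eta> j = 0" if "\<not> neg_pair (Inl j)" for j
  proof -
    have z: "F1 x $ j * F2 x $ j = 0" using kkt_at_pos_pair(2)[OF assms(1,2) kkt that] by simp
    show ?thesis using K(1)[of j, unfolded z] assms(2) by simp
  qed
  show em: "\<eta> j * F2 x $ j = - m $ Inl j \<and> \<eta> j * F1 x $ j = - m $ Inr j" if "neg_pair (Inl j)" for j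
    using neg[OF that] K(2-5)[of j] by simp
  show "\<forall>j\<in>active_H F1 F2 t x. \<eta> j > 0"
  proof
    fix j assume "j \<in> active_H F1 F2 t x"
    hence n: "neg_pair (Inl j)" by (simp add: S)
    hence "\<eta> j \<noteq> 0" using em[OF n] neg[OF n] by auto
    thus "\<eta> j > 0" using K(6)[of j] by simp
  qed
  show "\<forall>j\<in>active_N F1 x. \<nu>1 j > 0"
  proof
    fix j assume "j \<in> active_N F1 x"
    hence n: "\<not> neg_pair (Inl j)" "Inl j \<in> I" by (simp_all add: S)
    thus "\<nu>1 j > 0" using kkt_at_pos_pair(1)[OF assms(1,2) kkt n] e0[OF n(1)] K(4)[of j] by simp
  qed
  show "\<forall>j\<in>active_N F2 x. \<nu>2 j > 0"
  proof
    fix j assume "j \<in> active_N F2 x"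
    hence n: "\<not> neg_pair (Inr j)" "Inr j \<in> I" using neg_pair_partner[of "Inl j"] by (simp_all add: S)
    hence "\<not> neg_pair (Inl j)" using neg_pair_partner[of "Inl j"] by simp
    thus "\<nu>2 j > 0" using kkt_at_pos_pair(1)[OF assms(1,2) kkt n] e0[of j] K(5)[of j] by simp
  qed
qed

lemma eventually_M_near:
  assumes "\<epsilon> > 0"
  shows "\<forall>\<^sub>F z in nhds (xb, mb). \<forall>\<xi>. \<bar>(M (fst z) (snd z) *v \<xi>) \<bullet> \<xi> - (M xb mb *v \<xi>) \<bullet> \<xi>\<bar> \<le> \<epsilon> * (norm \<xi>)^2"
proof -
  have h: "((\<lambda>z. hess g (fst z)) \<longlongrightarrow> hess g xb) (nhds (xb, mb))" if "C2 g" for g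
  proof -
    have "continuous (at xb) (hess g)" using that by (simp add: C2_def continuous_on_eq_continuous_at)
    hence "(hess g \<longlongrightarrow> hess g xb) (nhds xb)" unfolding continuous_at tendsto_at_iff_tendsto_nhds .
    thus ?thesis by (rule filterlim_compose) (simp add: nhds_prod filterlim_fst)
  qed
  define c where "c = real CARD('n) * real CARD('n)"
  have c: "c > 0" by (simp add: c_def)
  have "((\<lambda>z. M (fst z) (snd z)) \<longlongrightarrow> M xb mb) (nhds (xb, mb))"
    unfolding M_def by (intro tendsto_intros h C2_f C2_G tendsto_multiplier)
  hence "((\<lambda>z. norm (M (fst z) (snd z) - M xb mb)) \<longlongrightarrow> norm (M xb mb - M xb mb)) (nhds (xb, mb))"
    by (intro tendsto_intros)
  hence "\<forall>\<^sub>F z in nhds (xb, mb). norm (M (fst z) (snd z) - M xb mb) < \<epsilon> / c"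
    using assms c by (intro order_tendstoD(2)) auto
  thus ?thesis
  proof eventually_elim
    case (elim z)
    show ?case
    proof
      fix \<xi>
      let ?A = "M (fst z) (snd z) - M xb mb"
      have "\<bar>(?A *v \<xi>) \<bullet> \<xi>\<bar> \<le> norm (?A *v \<xi>) * norm \<xi>" by (rule Cauchy_Schwarz_ineq2)
      also have "\<dots> \<le> (c * norm ?A * norm \<xi>) * norm \<xi>"
        unfolding c_def by (intro mult_right_mono norm_matrix_vector_mult_le) auto
      also have "\<dots> \<le> \<epsilon> * norm \<xi> * norm \<xi>"
        using elim c by (intro mult_right_mono) (auto simp: field_simps)
      finally show "\<bar>(M (fst z) (snd z) *v \<xi>) \<bullet> \<xi> - (M xb mb *v \<xi>) \<bullet> \<xi>\<bar> \<le> \<epsilon> * (norm \<xi>)^2"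
        by (simp add: matrix_vector_mult_diff_rdistrib inner_diff_left power2_eq_square algebra_simps)
    qed
  qed
qed

end

section \<open>Existence and uniqueness of the solution\<close>
locale nondegenerate_pairs = regular_pairs f F1 F2 xb mb
  for f :: "real^'n \<Rightarrow> real" and F1 F2 :: "real^'n \<Rightarrow> real^'k"
    and xb :: "real^'n" and mb :: "real^('k + 'k)" +
  assumes licq: "lin_indep_family (\<lambda>i. grad (comp_fun F1 F2 i) xb) {i. comp_fun F1 F2 i xb = 0}"
    and nonsingular: "restrict_nonsingular (M xb mb) T"
begin

text \<open>The first equation says that \<open>M xb mb *v dx\<close> is a combination of active gradients, hence orthogonal to \<open>T\<close>,
  while \<open>dx\<close> lies in \<open>T\<close>. So NDC3 gives \<open>dx = 0\<close>, and then LICQ gives \<open>dm = 0\<close>.\<close>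
lemma system_kernel:
  assumes "hess f xb *v dx - (\<Sum>i\<in>UNIV. dm $ i *\<^sub>R grad (G i) xb + mb $ i *\<^sub>R (hess (G i) xb *v dx)) = 0"
    and dx: "\<And>i. i \<in> I \<Longrightarrow> grad (G i) xb \<bullet> dx = 0" and dm: "\<And>i. i \<notin> I \<Longrightarrow> dm $ i = 0"
  shows "dx = 0" "dm = 0"
proof -
  have eq: "M xb mb *v dx = (\<Sum>i\<in>UNIV. dm $ i *\<^sub>R grad (G i) xb)"
    using assms(1) by (simp add: M_mult sum.distrib algebra_simps)
  also have sI: "\<dots> = (\<Sum>i\<in>I. dm $ i *\<^sub>R grad (G i) xb)"
    using dm by (intro sum.mono_neutral_right) auto
  finally have "(M xb mb *v dx) \<bullet> \<zeta> = 0" if "\<zeta> \<in> T" for \<zeta>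
    using that by (simp add: T_def inner_sum_left)
  moreover have "dx \<in> T" using dx by (simp add: T_def)
  ultimately show 0: "dx = 0" using nonsingular subspace_T by (auto simp: restrict_nonsingular_iff)
  have "(\<Sum>i\<in>I. dm $ i *\<^sub>R grad (G i) xb) = 0" using eq sI 0 by simp
  with licq have "\<forall>i\<in>I. dm $ i = 0"
    unfolding lin_indep_family_iff[OF finite] by simp
  with dm show "dm = 0" by (auto simp: vec_eq_iff)
qed

lemma system_strict_derivative:
  "\<exists>L. has_strict_derivative system L (0, xb, mb) \<and> (\<forall>z. L (0, z) = 0 \<longrightarrow> z = 0)"
proof -
  let ?p = "(0, xb, mb) :: real \<times> (real^'n) \<times> (real^('k + 'k))"
  obtain D where D: "\<And>i. has_strict_derivative (residual i) (D i) ?p"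
    and DI: "\<And>i. i \<in> I \<Longrightarrow> \<exists>c. c \<noteq> 0 \<and> (\<forall>dx dm. D i (0, dx, dm) = c * (grad (G i) xb \<bullet> dx))"
    and DN: "\<And>i. i \<notin> I \<Longrightarrow> \<exists>c d. c \<noteq> 0 \<and> (\<forall>dx dm. D i (0, dx, dm) = c * dm $ i + d * (grad (G (partner i)) xb \<bullet> dx))"
    using strict_residual by metis
  define L where "L h = (hess f xb *v fst (snd h) -
    (\<Sum>i\<in>UNIV. (snd (snd h) $ i) *\<^sub>R grad (G i) xb + mb $ i *\<^sub>R (hess (G i) xb *v fst (snd h))), \<chi> i. D i h)" for h
  have sum: "has_strict_derivative (\<lambda>z. \<Sum>i\<in>UNIV. (snd (snd z) $ i) *\<^sub>R grad (G i) (fst (snd z)))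
      (\<lambda>h. \<Sum>i\<in>UNIV. (snd (snd h) $ i) *\<^sub>R grad (G i) xb + mb $ i *\<^sub>R (hess (G i) xb *v fst (snd h))) ?p"
    by (intro has_strict_derivative_sum)
      (use has_strict_derivative_scaleR[OF strict_m[of _ ?p] strict_grad[OF C2_G, of _ ?p]] in simp)
  have "has_strict_derivative system L ?p"
    unfolding system_def[abs_def] L_def[abs_def]
    by (intro has_strict_derivative_Pair has_strict_derivative_diff has_strict_derivative_vec sum D)
      (use strict_grad[OF C2_f, of ?p] in simp)
  moreover have "z = 0" if L0: "L (0, z) = 0" for z
  proof -
    obtain dx dm where z: "z = (dx, dm)" by (cases z)
    have Di: "D i (0, dx, dm) = 0" for i
      using L0 by (auto simp: L_def z zero_prod_def vec_eq_iff)
    have dx: "grad (G i) xb \<bullet> dx = 0" if "i \<in> I" for i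
      using DI[OF that] Di[of i] by auto
    have "dm $ i = 0" if "i \<notin> I" for i
      using DN[OF that] Di[of i] dx[OF partner_in_I[OF that]] by auto
    moreover have "hess f xb *v dx - (\<Sum>i\<in>UNIV. dm $ i *\<^sub>R grad (G i) xb + mb $ i *\<^sub>R (hess (G i) xb *v dx)) = 0"
      using L0 by (simp add: L_def z zero_prod_def)
    ultimately show ?thesis using system_kernel[of dx dm] dx by (simp add: z zero_prod_def)
  qed
  ultimately show ?thesis by blast
qed

text \<open>Where the signs are those of the base point, the conditions coincide with the system for
  \<open>s = sqrt t\<close>, so both parts are instances of the implicit function principle.\<close>
lemma kkt_at_solvable:
  shows kkt_at_unique: "\<exists>\<delta>>0. \<forall>t x m x' m'. 0 < t \<longrightarrow> t < \<delta> \<longrightarrow> x \<in> ball xb \<delta> \<longrightarrow> x' \<in> ball xb \<delta> \<longrightarrow>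
      m \<in> ball mb \<delta> \<longrightarrow> m' \<in> ball mb \<delta> \<longrightarrow> kkt_at t x m \<longrightarrow> kkt_at t x' m' \<longrightarrow> x = x'" (is ?unique)
    and kkt_at_exists: "\<And>r. r > 0 \<Longrightarrow>
      \<exists>\<delta>>0. \<forall>t. 0 < t \<and> t < \<delta> \<longrightarrow> (\<exists>x\<in>ball xb r. \<exists>m\<in>ball mb r. kkt_at t x m)"
proof -
  obtain L where L: "has_strict_derivative system L (0, xb, mb)" "\<And>z. L (0, z) = 0 \<Longrightarrow> z = 0"
    using system_strict_derivative by blast
  obtain e where e: "e > 0" and U: "\<And>s z z'. \<bar>s\<bar> < e \<Longrightarrow> z \<in> ball (xb, mb) e \<Longrightarrow> z' \<in> ball (xb, mb) e \<Longrightarrow>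
      system (s, z) = 0 \<Longrightarrow> system (s, z') = 0 \<Longrightarrow> z = z'"
    using implicit_solution(1)[OF L(1) system_base L(2)] by blast
  have X: "\<And>r. r > 0 \<Longrightarrow> \<exists>\<delta>>0. \<forall>s. \<bar>s\<bar> < \<delta> \<longrightarrow> (\<exists>z\<in>ball (xb, mb) r. system (s, z) = 0)"
    by (rule implicit_solution(2)[OF L(1) system_base L(2)])
  obtain d where d: "d > 0" and near: "\<And>x m. x \<in> ball xb d \<Longrightarrow> m \<in> ball mb d \<Longrightarrow> near_signs x m"
    using eventually_nhds_balls[OF eventually_near_signs] by blast
  have sq: "\<bar>sqrt t\<bar> < c \<and> 0 < sqrt t \<and> (sqrt t)^2 = t" if "0 < t" "t < c^2" "c > 0" for t c :: real
    using that real_sqrt_less_mono[of t "c^2"] by simp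
  have prod: "(x, m) \<in> ball (xb, mb) r" if "x \<in> ball xb (r / 2)" "m \<in> ball mb (r / 2)" for x m r
  proof -
    have "dist (xb, mb) (x, m) \<le> dist xb x + dist mb m"
      unfolding dist_Pair_Pair by (rule sqrt_sum_squares_le_sum) auto
    with that show ?thesis by simp
  qed
  have proj: "x \<in> ball xb r" "m \<in> ball mb r" if "(x, m) \<in> ball (xb, mb) r" for x m r
    using that dist_fst_le[of "(xb, mb)" "(x, m)"] dist_snd_le[of "(xb, mb)" "(x, m)"] by auto
  show ?unique
  proof (intro exI[of _ "min (min (e^2) (e / 2)) d"] conjI allI impI)
    show "min (min (e^2) (e / 2)) d > 0" using e d by simp
    fix t x m x' m' assume *: "0 < t" "t < min (min (e^2) (e / 2)) d"
      "x \<in> ball xb (min (min (e^2) (e / 2)) d)" "x' \<in> ball xb (min (min (e^2) (e / 2)) d)"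
      "m \<in> ball mb (min (min (e^2) (e / 2)) d)" "m' \<in> ball mb (min (min (e^2) (e / 2)) d)"
      "kkt_at t x m" "kkt_at t x' m'"
    have s: "\<bar>sqrt t\<bar> < e" "0 < sqrt t" "(sqrt t)^2 = t" using sq[of t e] * e by auto
    have "system (sqrt t, x, m) = 0" "system (sqrt t, x', m') = 0"
      using * s near by (auto simp: system_zero_iff)
    from U[OF s(1) prod prod this] * show "x = x'" by simp
  qed
  fix r :: real assume r: "r > 0"
    obtain c where c: "c > 0" "\<And>s. \<bar>s\<bar> < c \<Longrightarrow> \<exists>z\<in>ball (xb, mb) (min r d). system (s, z) = 0"
      using X[of "min r d"] r d by auto
    show "\<exists>\<delta>>0. \<forall>t. 0 < t \<and> t < \<delta> \<longrightarrow> (\<exists>x\<in>ball xb r. \<exists>m\<in>ball mb r. kkt_at t x m)"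
    proof (intro exI[of _ "c^2"] conjI allI impI)
      fix t assume "0 < t \<and> t < c^2"
      hence s: "\<bar>sqrt t\<bar> < c" "0 < sqrt t" "(sqrt t)^2 = t" using sq[of t c] c by auto
      then obtain x m where xm: "(x, m) \<in> ball (xb, mb) (min r d)" "system (sqrt t, x, m) = 0"
        using c(2)[OF s(1)] by auto
      from proj[OF xm(1)] have b: "x \<in> ball xb r" "m \<in> ball mb r" "x \<in> ball xb d" "m \<in> ball mb d" by auto
      with xm(2) s near have "kkt_at t x m" by (auto simp: system_zero_iff)
      with b show "\<exists>x\<in>ball xb r. \<exists>m\<in>ball mb r. kkt_at t x m" by blast
    qed (use c in simp)
qed

section \<open>Multipliers of nearby Karush-Kuhn-Tucker points\<close>
lemma inactive_sum_le:
  fixes w :: "real^('k + 'k)"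
  assumes "0 \<le> \<kappa>" and w: "\<And>i. i \<in> -I \<Longrightarrow> \<bar>w $ i\<bar> \<le> \<kappa> * \<bar>w $ partner i\<bar>"
  shows "(\<Sum>i\<in>-I. \<bar>w $ i\<bar>) \<le> real CARD('k + 'k) * \<kappa> * norm w"
proof -
  have "\<bar>w $ i\<bar> \<le> \<kappa> * norm w" if "i \<in> -I" for i
    using w[OF that] mult_left_mono[OF component_le_norm_cart[of w "partner i"] assms(1)] by linarith
  hence "(\<Sum>i\<in>-I. \<bar>w $ i\<bar>) \<le> real (card (-I)) * (\<kappa> * norm w)" by (rule sum_bounded_above)
  also have "\<dots> \<le> real CARD('k + 'k) * (\<kappa> * norm w)"
  proof (intro mult_right_mono)
    show "real (card (-I)) \<le> real CARD('k + 'k)" by (simp only: of_nat_le_iff) (rule card_mono, auto)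
  qed (use assms(1) in auto)
  finally show ?thesis by simp
qed

text \<open>By LICQ, the map from \<open>m\<close> to the combination of the gradients at \<open>xb\<close> and the entries of \<open>m\<close> outside \<open>I\<close>
  is injective, hence bounded below, and it remains so when the gradients change a little.\<close>
lemma gradient_combination_stable:
  obtains \<alpha> \<delta> where "\<alpha> > 0" "\<delta> > 0"
    "\<And>x m. x \<in> ball xb \<delta> \<Longrightarrow>
      \<alpha> * norm m \<le> norm (\<Sum>i\<in>UNIV. m $ i *\<^sub>R grad (G i) x) + (\<Sum>i\<in>-I. \<bar>m $ i\<bar>)"
proof -
  define S where "S x m = (\<Sum>i\<in>UNIV. (m :: real^('k + 'k)) $ i *\<^sub>R grad (G i) x)" for x m
  define B where "B m = (S xb m, (\<chi> i. if i \<in> I then 0 else m $ i) :: real^('k + 'k))" for m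
  have lin: "linear B"
    by (rule linearI) (auto simp: B_def S_def scaleR_add_left sum.distrib scaleR_sum_right vec_eq_iff)
  have "inj B"
    unfolding linear_injective_0[OF lin]
  proof (intro allI impI)
    fix m assume "B m = 0"
    hence 0: "S xb m = 0" and off: "\<And>i. i \<notin> I \<Longrightarrow> m $ i = 0"
      by (auto simp: B_def zero_prod_def vec_eq_iff split: if_splits)
    have "(\<Sum>i\<in>I. m $ i *\<^sub>R grad (G i) xb) = S xb m"
      unfolding S_def using off by (intro sum.mono_neutral_left) auto
    with 0 licq have "\<forall>i\<in>I. m $ i = 0"
      unfolding lin_indep_family_iff[OF finite] by simp
    with off show "m = 0" by (auto simp: vec_eq_iff)
  qed
  from linear_inj_bounded_below_pos[OF lin this] obtain \<beta> where \<beta>: "\<beta> > 0" "\<And>m. \<beta> * norm m \<le> norm (B m)"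
    by blast
  have base: "\<beta> * norm m \<le> norm (S xb m) + (\<Sum>i\<in>-I. \<bar>m $ i\<bar>)" for m
  proof -
    have "norm (B m) \<le> norm (S xb m) + norm (\<chi> i. if i \<in> I then 0 else m $ i)"
      unfolding B_def by (rule norm_Pair_le)
    also have "norm (\<chi> i. if i \<in> I then 0 else m $ i) \<le> (\<Sum>i\<in>UNIV. \<bar>(\<chi> i. if i \<in> I then 0 else m $ i) $ i\<bar>)"
      by (rule norm_le_l1_cart)
    also have "\<dots> = (\<Sum>i\<in>-I. \<bar>m $ i\<bar>)"
      by (intro sum.mono_neutral_cong_right) auto
    finally show ?thesis using \<beta>(2)[of m] by simp
  qed
  have "((\<lambda>z. \<Sum>i\<in>UNIV. norm (grad (G i) (fst z) - grad (G i) xb)) \<longlongrightarrow>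
      (\<Sum>i\<in>UNIV. norm (grad (G i) xb - grad (G i) xb))) (nhds (xb, mb))"
    by (intro tendsto_intros tendsto_grad_G)
  hence ev: "\<forall>\<^sub>F z in nhds (xb, mb). (\<Sum>i\<in>UNIV. norm (grad (G i) (fst z) - grad (G i) xb)) < \<beta> / 2"
    using \<beta> by (intro order_tendstoD(2)) auto
  obtain \<delta> where \<delta>: "\<delta> > 0" "\<And>x m. x \<in> ball xb \<delta> \<Longrightarrow> m \<in> ball mb \<delta> \<Longrightarrow>
      (\<Sum>i\<in>UNIV. norm (grad (G i) x - grad (G i) xb)) < \<beta> / 2"
    using eventually_nhds_balls[where Q = "\<lambda>x m. (\<Sum>i\<in>UNIV. norm (grad (G i) x - grad (G i) xb)) < \<beta> / 2", OF ev]
    by blast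
  show ?thesis
  proof (rule that[of "\<beta> / 2" \<delta>])
    fix x m assume x: "x \<in> ball xb \<delta>"
    have "norm (S xb m - S x m) = norm (\<Sum>i\<in>UNIV. m $ i *\<^sub>R (grad (G i) xb - grad (G i) x))"
      by (simp add: S_def sum_subtractf scaleR_diff_right)
    also have "\<dots> \<le> (\<Sum>i\<in>UNIV. norm m * norm (grad (G i) x - grad (G i) xb))"
      by (intro sum_norm_le) (auto simp: norm_minus_commute intro!: mult_right_mono component_le_norm_cart)
    also have "\<dots> = norm m * (\<Sum>i\<in>UNIV. norm (grad (G i) x - grad (G i) xb))"
      by (simp add: sum_distrib_left)
    also have "\<dots> \<le> norm m * (\<beta> / 2)"
      using \<delta>(2)[OF x, of mb] \<delta>(1) by (intro mult_left_mono) auto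
    finally have "norm (S xb m - S x m) \<le> norm m * (\<beta> / 2)" .
    moreover have "norm (S xb m) \<le> norm (S x m) + norm (S xb m - S x m)"
      by (metis norm_triangle_sub)
    ultimately have "\<beta> / 2 * norm m \<le> norm (S x m) + (\<Sum>i\<in>-I. \<bar>m $ i\<bar>)"
      using base[of m] by (simp add: algebra_simps)
    thus "\<beta> / 2 * norm m \<le> norm (\<Sum>i\<in>UNIV. m $ i *\<^sub>R grad (G i) x) + (\<Sum>i\<in>-I. \<bar>m $ i\<bar>)"
      by (simp add: S_def)
  qed (use \<beta> \<delta> in auto)
qed

lemma eventually_inactive_small:
  assumes "\<kappa> > 0"
  shows "\<forall>\<^sub>F z in nhds (xb, mb). \<forall>i\<in>-I. 0 < G i (fst z) \<and> G (partner i) (fst z) \<le> \<kappa> * G i (fst z)"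
proof -
  have "\<forall>\<^sub>F z in nhds (xb, mb). i \<in> -I \<longrightarrow> 0 < G i (fst z) \<and> G (partner i) (fst z) \<le> \<kappa> * G i (fst z)" for i
  proof (cases "i \<in> I")
    case False
    hence pos: "0 < G i xb" and zero: "G (partner i) xb = 0" using G_pos_iff partner_in_I[of i] by auto
    have "((\<lambda>z. \<kappa> * G i (fst z) - G (partner i) (fst z)) \<longlongrightarrow> \<kappa> * G i xb - G (partner i) xb) (nhds (xb, mb))"
      by (intro tendsto_intros tendsto_G)
    from order_tendstoD(1)[OF this, of 0] pos zero assms
    have "\<forall>\<^sub>F z in nhds (xb, mb). 0 < \<kappa> * G i (fst z) - G (partner i) (fst z)" by simp
    with order_tendstoD(1)[OF tendsto_G pos] show ?thesis by eventually_elim simp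
  qed simp
  hence "\<forall>\<^sub>F z in nhds (xb, mb). \<forall>i. i \<in> -I \<longrightarrow> 0 < G i (fst z) \<and> G (partner i) (fst z) \<le> \<kappa> * G i (fst z)"
    by (rule eventually_all_finite)
  thus ?thesis by (simp only: Ball_def)
qed

text \<open>The coefficients outside \<open>I\<close> are small multiples of those of their partners, so
  \<open>gradient_combination_stable\<close> first bounds \<open>m\<close> by a constant and then, applied to \<open>m - mb\<close>, shows that it is
  near \<open>mb\<close>. The radius is independent of \<open>t\<close>.\<close>
lemma multipliers_near:
  assumes e: "\<epsilon> > 0"
  shows "\<exists>\<delta>>0. \<forall>t x m. 0 < t \<longrightarrow> x \<in> ball xb \<delta> \<longrightarrow> kkt_at t x m \<longrightarrow> m \<in> ball mb \<epsilon>"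
proof -
  obtain \<alpha> d0 where a: "\<alpha> > 0" "d0 > 0" and stable: "\<And>x m. x \<in> ball xb d0 \<Longrightarrow>
      \<alpha> * norm m \<le> norm (\<Sum>i\<in>UNIV. m $ i *\<^sub>R grad (G i) x) + (\<Sum>i\<in>-I. \<bar>m $ i\<bar>)"
    by (rule gradient_combination_stable) blast
  define N where "N = real CARD('k + 'k)"
  define C where "C = norm (grad f xb) + 1"
  \<comment> \<open>\<open>C\<close> bounds the gradient of \<open>f\<close> near \<open>xb\<close>, and \<open>R\<close> will turn out to bound \<open>norm m\<close>.\<close>
  define R where "R = 2 * C / \<alpha>"
  define \<kappa> where "\<kappa> = min (\<alpha> / (2 * N)) (\<alpha> * \<epsilon> / (4 * N * R))"
  have N: "N > 0" by (simp add: N_def)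
  have C: "C > 0" by (simp add: C_def add_nonneg_pos)
  have R: "R > 0" using C a by (simp add: R_def)
  have k: "\<kappa> > 0" using a e N R by (simp add: \<kappa>_def)
  have Nk: "N * \<kappa> \<le> \<alpha> / 2" "N * \<kappa> * R \<le> \<alpha> * \<epsilon> / 4"
  proof -
    have "N * \<kappa> \<le> N * (\<alpha> / (2 * N))" using N by (intro mult_left_mono) (auto simp: \<kappa>_def)
    thus "N * \<kappa> \<le> \<alpha> / 2" using N by simp
    have "N * \<kappa> * R \<le> N * (\<alpha> * \<epsilon> / (4 * N * R)) * R"
      using N R by (intro mult_right_mono mult_left_mono) (auto simp: \<kappa>_def)
    thus "N * \<kappa> * R \<le> \<alpha> * \<epsilon> / 4" using N R by simp
  qed
  have gf: "((\<lambda>z. grad f (fst z)) \<longlongrightarrow> grad f xb) (nhds (xb, mb))"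
    by (rule filterlim_compose[OF has_strict_derivative_tendsto[OF C2_has_strict_derivative_grad[OF C2_f]]])
      (simp add: nhds_prod filterlim_fst)
  have ev1: "\<forall>\<^sub>F z in nhds (xb, mb). norm (grad f (fst z)) < C"
    using order_tendstoD(2)[OF tendsto_norm[OF gf], of C] by (simp add: C_def)
  have "((\<lambda>z. norm (grad f (fst z) - (\<Sum>i\<in>UNIV. mb $ i *\<^sub>R grad (G i) (fst z)))) \<longlongrightarrow>
      norm (grad f xb - (\<Sum>i\<in>UNIV. mb $ i *\<^sub>R grad (G i) xb))) (nhds (xb, mb))"
    by (intro tendsto_intros gf tendsto_grad_G)
  hence ev2: "\<forall>\<^sub>F z in nhds (xb, mb). norm (grad f (fst z) - (\<Sum>i\<in>UNIV. mb $ i *\<^sub>R grad (G i) (fst z))) < \<alpha> * \<epsilon> / 4"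
    using stationary a e by (intro order_tendstoD(2)) auto
  define Q where "Q x \<longleftrightarrow> norm (grad f x) < C \<and>
      norm (grad f x - (\<Sum>i\<in>UNIV. mb $ i *\<^sub>R grad (G i) x)) < \<alpha> * \<epsilon> / 4 \<and>
      (\<forall>i\<in>-I. 0 < G i x \<and> G (partner i) x \<le> \<kappa> * G i x)" for x
  have "\<forall>\<^sub>F z in nhds (xb, mb). Q (fst z)"
    unfolding Q_def using ev1 ev2 eventually_inactive_small[OF k] by (intro eventually_conj)
  from eventually_nhds_balls[where Q = "\<lambda>x m. Q x", OF this]
  obtain d1 where d1: "d1 > 0" and D: "\<And>x m. x \<in> ball xb d1 \<Longrightarrow> m \<in> ball mb d1 \<Longrightarrow> Q x" by blast
  show ?thesis
  proof (intro exI[of _ "min d0 d1"] conjI allI impI)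
    fix t x m assume t: "0 < t" and x: "x \<in> ball xb (min d0 d1)" and kkt: "kkt_at t x m"
    have near: "norm (grad f x) < C" "norm (grad f x - (\<Sum>i\<in>UNIV. mb $ i *\<^sub>R grad (G i) x)) < \<alpha> * \<epsilon> / 4"
      "\<And>i. i \<in> -I \<Longrightarrow> 0 < G i x \<and> G (partner i) x \<le> \<kappa> * G i x"
      using D[of x mb] x d1 by (auto simp: Q_def)
    have eq: "(\<Sum>i\<in>UNIV. m $ i *\<^sub>R grad (G i) x) = grad f x" using kkt by (simp add: kkt_at_def)
    have "\<bar>m $ i\<bar> \<le> \<kappa> * \<bar>m $ partner i\<bar>" if "i \<in> -I" for i
      using near(3)[OF that] kkt by (intro scholtes_pair_inactive_bound[OF t, of "G i x" "G (partner i) x"])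
        (auto simp: kkt_at_def)
    from inactive_sum_le[OF less_imp_le[OF k] this]
    have off: "(\<Sum>i\<in>-I. \<bar>m $ i\<bar>) \<le> N * \<kappa> * norm m" unfolding N_def .
    have "\<alpha> * norm m \<le> norm (grad f x) + (\<Sum>i\<in>-I. \<bar>m $ i\<bar>)"
      using stable[of x m] x eq by simp
    moreover have "N * \<kappa> * norm m \<le> \<alpha> / 2 * norm m" using Nk by (intro mult_right_mono) auto
    ultimately have "\<alpha> * norm m \<le> C + \<alpha> / 2 * norm m" using off near(1) by linarith
    hence "norm m \<le> R" using a by (simp add: R_def field_simps)
    hence "N * \<kappa> * norm m \<le> N * \<kappa> * R" using N k by (intro mult_left_mono) auto
    hence off': "(\<Sum>i\<in>-I. \<bar>m $ i\<bar>) \<le> \<alpha> * \<epsilon> / 4" using off Nk by linarith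
    have s1: "(\<Sum>i\<in>-I. \<bar>(m - mb) $ i\<bar>) = (\<Sum>i\<in>-I. \<bar>m $ i\<bar>)"
      using mult_inactive by (intro sum.cong) auto
    have s2: "(\<Sum>i\<in>UNIV. (m - mb) $ i *\<^sub>R grad (G i) x) = grad f x - (\<Sum>i\<in>UNIV. mb $ i *\<^sub>R grad (G i) x)"
      by (simp add: scaleR_diff_left sum_subtractf eq)
    have "\<alpha> * norm (m - mb) \<le> norm (\<Sum>i\<in>UNIV. (m - mb) $ i *\<^sub>R grad (G i) x) + (\<Sum>i\<in>-I. \<bar>(m - mb) $ i\<bar>)"
      by (rule stable) (use x in simp)
    hence "\<alpha> * norm (m - mb) < \<alpha> * \<epsilon>"
      unfolding s1 s2 using off' near(2) mult_pos_pos[OF a(1) e] by linarith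
    thus "m \<in> ball mb \<epsilon>" using a by (simp add: dist_norm norm_minus_commute)
  qed (use a d1 in simp)
qed

section \<open>Nondegeneracy and index of nearby Karush-Kuhn-Tucker points\<close>
text \<open>A vanishing combination of the active gradients of the regularisation is a vanishing combination of
  the \<open>grad (G i) x\<close>, with coefficients \<open>w\<close>. The coefficients outside \<open>I\<close> stem from product constraints only and
  are small multiples of those of their partners, hence \<open>w = 0\<close>.\<close>
lemma scholtes_licq_near:
  "\<exists>\<delta>>0. \<forall>t x m. 0 < t \<longrightarrow> x \<in> ball xb \<delta> \<longrightarrow> m \<in> ball mb \<delta> \<longrightarrow> kkt_at t x m \<longrightarrow> scholtes_licq F1 F2 t x"
proof -
  obtain \<alpha> d0 where a: "\<alpha> > 0" "d0 > 0" and stable: "\<And>x m. x \<in> ball xb d0 \<Longrightarrow>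
      \<alpha> * norm m \<le> norm (\<Sum>i\<in>UNIV. m $ i *\<^sub>R grad (G i) x) + (\<Sum>i\<in>-I. \<bar>m $ i\<bar>)"
    by (rule gradient_combination_stable) blast
  define N where "N = real CARD('k + 'k)"
  define \<kappa> where "\<kappa> = \<alpha> / (2 * N)"
  have N: "N > 0" by (simp add: N_def)
  have k: "\<kappa> > 0" using a N by (simp add: \<kappa>_def)
  have Nk: "N * \<kappa> = \<alpha> / 2" using N by (simp add: \<kappa>_def)
  define Q where "Q x m \<longleftrightarrow> near_signs x m \<and> (\<forall>i\<in>-I. 0 < G i x \<and> G (partner i) x \<le> \<kappa> * G i x)" for x m
  have "\<forall>\<^sub>F z in nhds (xb, mb). Q (fst z) (snd z)"
    unfolding Q_def by (intro eventually_conj eventually_near_signs eventually_inactive_small k)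
  from eventually_nhds_balls[OF this]
  obtain d1 where d1: "d1 > 0" and D: "\<And>x m. x \<in> ball xb d1 \<Longrightarrow> m \<in> ball mb d1 \<Longrightarrow> Q x m" by blast
  show ?thesis
  proof (intro exI[of _ "min d0 d1"] conjI allI impI)
    fix t x m assume t: "0 < t" and x: "x \<in> ball xb (min d0 d1)" and mm: "m \<in> ball mb (min d0 d1)" and kkt: "kkt_at t x m"
    have near: "near_signs x m" and small: "\<And>i. i \<in> -I \<Longrightarrow> 0 < G i x \<and> G (partner i) x \<le> \<kappa> * G i x"
      using D[of x m] x mm by (auto simp: Q_def)
    note S = active_sets[OF near t kkt]
    let ?H = "{j. neg_pair (Inl j)}" and ?N1 = "{j. \<not> neg_pair (Inl j) \<and> Inl j \<in> I}"
      and ?N2 = "{j. \<not> neg_pair (Inl j) \<and> Inr j \<in> I}"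
    let ?v = "case_sum (prod_grad F1 F2 x)
         (case_sum (\<lambda>j. grad (\<lambda>y. F1 y $ j) x) (\<lambda>j. grad (\<lambda>y. F2 y $ j) x))"
    have neg: "0 < F1 x $ j" "0 < F2 x $ j" if "neg_pair (Inl j)" for j
      using kkt_at_neg_pair(2)[OF near t kkt that] kkt_at_neg_pair(2)[OF near t kkt, of "Inr j"] that neg_pair_partner[of "Inl j"]
      by auto
    show "scholtes_licq F1 F2 t x"
      unfolding scholtes_licq_def S lin_indep_family_iff[OF finite]
    proof (intro allI impI)
      fix c assume c0: "(\<Sum>i\<in>?H <+> (?N1 <+> ?N2). c i *\<^sub>R ?v i) = 0"
      define h where "h j = (if j \<in> ?H then c (Inl j) else 0)" for j
      define n1 where "n1 j = (if j \<in> ?N1 then c (Inr (Inl j)) else 0)" for j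
      define n2 where "n2 j = (if j \<in> ?N2 then c (Inr (Inr j)) else 0)" for j
      define w :: "real^('k + 'k)" where
        "w = (\<chi> i. case i of Inl j \<Rightarrow> h j * F2 x $ j + n1 j | Inr j \<Rightarrow> h j * F1 x $ j + n2 j)"
      have w: "w $ Inl j = n1 j - (- h j) * F2 x $ j" "w $ Inr j = n2 j - (- h j) * F1 x $ j" for j
        by (simp_all add: w_def)
      have "(\<Sum>i\<in>UNIV. w $ i *\<^sub>R grad (G i) x) = (\<Sum>j\<in>UNIV. h j *\<^sub>R prod_grad F1 F2 x j)
         + (\<Sum>j\<in>UNIV. n1 j *\<^sub>R grad (\<lambda>y. F1 y $ j) x) + (\<Sum>j\<in>UNIV. n2 j *\<^sub>R grad (\<lambda>y. F2 y $ j) x)"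
        using normalised_gradient_sum[of w n1 "\<lambda>j. - h j" x n2] w by (simp add: sum_negf)
      also have "(\<Sum>j\<in>UNIV. h j *\<^sub>R prod_grad F1 F2 x j) = (\<Sum>j\<in>?H. c (Inl j) *\<^sub>R prod_grad F1 F2 x j)"
        unfolding h_def by (intro sum.mono_neutral_cong_right) auto
      also have "(\<Sum>j\<in>UNIV. n1 j *\<^sub>R grad (\<lambda>y. F1 y $ j) x) = (\<Sum>j\<in>?N1. c (Inr (Inl j)) *\<^sub>R grad (\<lambda>y. F1 y $ j) x)"
        unfolding n1_def by (intro sum.mono_neutral_cong_right) auto
      also have "(\<Sum>j\<in>UNIV. n2 j *\<^sub>R grad (\<lambda>y. F2 y $ j) x) = (\<Sum>j\<in>?N2. c (Inr (Inr j)) *\<^sub>R grad (\<lambda>y. F2 y $ j) x)"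
        unfolding n2_def by (intro sum.mono_neutral_cong_right) auto
      also have "(\<Sum>j\<in>?H. c (Inl j) *\<^sub>R prod_grad F1 F2 x j) + (\<Sum>j\<in>?N1. c (Inr (Inl j)) *\<^sub>R grad (\<lambda>y. F1 y $ j) x)
          + (\<Sum>j\<in>?N2. c (Inr (Inr j)) *\<^sub>R grad (\<lambda>y. F2 y $ j) x) = 0"
        using c0 by (simp add: sum.Plus add.assoc)
      finally have zero: "(\<Sum>i\<in>UNIV. w $ i *\<^sub>R grad (G i) x) = 0" .
      have "\<bar>w $ i\<bar> \<le> \<kappa> * \<bar>w $ partner i\<bar>" if "i \<in> -I" for i
        proof (cases "neg_pair i")
          case True
          have "\<exists>r. w $ i = r * G (partner i) x \<and> w $ partner i = r * G i x"
          proof (cases i)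
            case (Inl j)
            with True that show ?thesis by (intro exI[of _ "h j"]) (simp add: w_def n1_def n2_def)
          next
            case (Inr j)
            with True that neg_pair_partner[of i] show ?thesis
              by (intro exI[of _ "h j"]) (simp add: w_def n1_def n2_def)
          qed
          then obtain r where r: "w $ i = r * G (partner i) x" "w $ partner i = r * G i x" by blast
          have "0 < G (partner i) x" using kkt_at_neg_pair(2)[OF near t kkt, of "partner i"] True neg_pair_partner[of i] by simp
          hence "\<bar>w $ i\<bar> = \<bar>r\<bar> * G (partner i) x" "\<bar>w $ partner i\<bar> = \<bar>r\<bar> * G i x"
            using r small[OF that] by (auto simp: abs_mult)
          thus ?thesis using mult_left_mono[of "G (partner i) x" "\<kappa> * G i x" "\<bar>r\<bar>"] small[OF that]
            by (simp add: algebra_simps)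
        next
          case False
          hence "w $ i = 0"
          proof (cases i)
            case (Inl j)
            with False that show ?thesis by (simp add: w_def h_def n1_def)
          next
            case (Inr j)
            with False that neg_pair_partner[of i] show ?thesis by (simp add: w_def h_def n2_def)
          qed
          thus ?thesis using k by simp
        qed
      from inactive_sum_le[OF less_imp_le[OF k] this]
      have off: "(\<Sum>i\<in>-I. \<bar>w $ i\<bar>) \<le> \<alpha> / 2 * norm w" unfolding N_def[symmetric] Nk .
      have "\<alpha> * norm w \<le> norm (\<Sum>i\<in>UNIV. w $ i *\<^sub>R grad (G i) x) + (\<Sum>i\<in>-I. \<bar>w $ i\<bar>)"
        by (rule stable) (use x in simp)
      hence "\<alpha> * norm w \<le> \<alpha> / 2 * norm w" unfolding zero using off by simp
      hence "w = 0" using a by simp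
      hence w0: "w $ i = 0" for i by simp
      have h0: "h j = 0" if "j \<in> ?H" for j
        using w0[of "Inl j"] that neg(2)[of j] by (simp add: w_def n1_def)
      have h0': "h j = 0" for j using h0 by (cases "j \<in> ?H") (auto simp: h_def)
      have "c (Inl j) = 0" if "j \<in> ?H" for j using h0[OF that] that by (simp add: h_def)
      moreover have "c (Inr (Inl j)) = 0" if "j \<in> ?N1" for j
        using w0[of "Inl j"] h0'[of j] that by (simp add: w_def n1_def)
      moreover have "c (Inr (Inr j)) = 0" if "j \<in> ?N2" for j
        using w0[of "Inr j"] h0'[of j] that by (simp add: w_def n2_def)
      ultimately show "\<forall>i\<in>?H <+> (?N1 <+> ?N2). c i = 0" by (auto elim!: PlusE)
    qed
  qed (use a d1 in simp)
qed

text \<open>The negative definite subspace consists of the tangent directions orthogonal to \<open>P\<close>, the positive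
  definite one of the tangent directions that are orthogonal to \<open>N\<close> and annihilated by the gradients of all
  biactive negative pairs. On the tangent space the contribution \<open>tm j \<xi>\<close> of a pair to the quadratic form is
  \<open>- 2 * (\<bar>m $ i\<bar> / G i x) * (grad (G i) x \<bullet> \<xi>)\<^sup>2\<close> for either member \<open>i\<close> of a negative pair. It is small if the pair is
  not biactive, as the formula shows for the inactive member \<open>i\<close>. If the pair is biactive, the quotient is
  at least \<open>L\<close>: either both \<open>grad (G i) x \<bullet> \<xi>\<close> are so small that \<open>\<xi>\<close> is almost tangent at \<open>xb\<close>, or the term outweighs
  everything else.

  Of the constants, \<open>C\<close> bounds the form at \<open>xb\<close>, \<open>Cg\<close> the gradients at \<open>x\<close>, \<open>R\<close> the multipliers \<open>\<eta> j\<close> of the negative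
  pairs that are not biactive, and \<open>\<kappa>\<close> the quotients \<open>G (partner i) x / G i x\<close> for inactive \<open>i\<close>.\<close>
lemma scholtes_inertia:
  fixes N P :: "(real^'n) set"
  assumes dims: "dim N + dim P = dim T" and \<delta>: "\<delta> > 0"
    and posd: "\<And>\<xi>. (\<forall>w\<in>N. w \<bullet> \<xi> = 0) \<Longrightarrow> (\<forall>i\<in>I. \<bar>grad (G i) xb \<bullet> \<xi>\<bar> \<le> \<delta> * norm \<xi>) \<Longrightarrow>
      (M xb mb *v \<xi>) \<bullet> \<xi> \<ge> \<delta> * (norm \<xi>)^2"
    and negd: "\<And>\<xi>. (\<forall>w\<in>P. w \<bullet> \<xi> = 0) \<Longrightarrow> (\<forall>i\<in>I. \<bar>grad (G i) xb \<bullet> \<xi>\<bar> \<le> \<delta> * norm \<xi>) \<Longrightarrow>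
      (M xb mb *v \<xi>) \<bullet> \<xi> \<le> - \<delta> * (norm \<xi>)^2"
    and C0: "0 \<le> C" and C: "\<And>\<xi>. (M xb mb *v \<xi>) \<bullet> \<xi> \<le> C * (norm \<xi>)^2" and L: "C + \<delta> < L * \<delta>^2 / 2"
    and \<kappa>: "0 \<le> \<kappa>" "\<kappa> * Cg \<le> \<delta> / 2" "2 * \<kappa> * R * Cg^2 \<le> \<delta> / (4 * real CARD('k))" and R: "0 \<le> R"
    and near: "near_signs x m"
    and Mnear: "\<And>\<xi>. \<bar>(M x m *v \<xi>) \<bullet> \<xi> - (M xb mb *v \<xi>) \<bullet> \<xi>\<bar> \<le> \<delta> / 4 * (norm \<xi>)^2"
    and gnear: "\<And>i. norm (grad (G i) x - grad (G i) xb) \<le> \<delta> / 2" and gbound: "\<And>i. norm (grad (G i) x) \<le> Cg"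
    and inact: "\<And>i. i \<notin> I \<Longrightarrow> 0 < G i x \<and> G (partner i) x \<le> \<kappa> * G i x \<and> \<bar>m $ partner i\<bar> \<le> R * G i x"
    and bi: "\<And>i. neg_pair i \<Longrightarrow> i \<in> I \<Longrightarrow> partner i \<in> I \<Longrightarrow> L * G i x \<le> \<bar>m $ i\<bar>"
    and t: "0 < t" and at: "scholtes_at t x m \<eta> \<nu>1 \<nu>2" and sl: "scholtes_licq F1 F2 t x"
  shows "restrict_nonsingular (hess (scholtes_lagrange f F1 F2 t \<eta> \<nu>1 \<nu>2) x) (scholtes_tangent F1 F2 t x)"
    and "num_neg_eigenvalues (hess (scholtes_lagrange f F1 F2 t \<eta> \<nu>1 \<nu>2) x) (scholtes_tangent F1 F2 t x)
      = dim N + card biactive_neg"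
proof -
  note kkt = scholtes_at_imp_kkt_at[OF at]
  note S = active_sets[OF near t kkt]
  note compl = scholtes_at_strict_complementarity[OF near t at]
  define Hs where "Hs = hess (scholtes_lagrange f F1 F2 t \<eta> \<nu>1 \<nu>2) x"
  define TS where "TS = scholtes_tangent F1 F2 t x"
  define q where "q i \<xi> = grad (G i) x \<bullet> \<xi>" for i and \<xi> :: "real^'n"
  define idx :: "'k + 'k \<Rightarrow> 'k" where "idx = case_sum (\<lambda>j. j) (\<lambda>j. j)"
  define tm where "tm j \<xi> = \<eta> j * (2 * (q (Inl j) \<xi> * q (Inr j) \<xi>))" for j and \<xi> :: "real^'n"
  have m: "m $ Inl j = \<nu>1 j - \<eta> j * F2 x $ j" "m $ Inr j = \<nu>2 j - \<eta> j * F1 x $ j" for j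
    using at by (auto simp: scholtes_at_def)
  have H: "Hs *v h = M x m *v h + (\<Sum>j\<in>UNIV. \<eta> j *\<^sub>R (q (Inr j) h *\<^sub>R grad (G (Inl j)) x + q (Inl j) h *\<^sub>R grad (G (Inr j)) x))" for h
    unfolding Hs_def q_def by (rule lagrangian_hessian[OF m])
  have symH: "sym_op Hs"
    using sym_M[of x m]
    by (simp add: sym_op_def H inner_add_left inner_add_right inner_sum_left inner_sum_right q_def
        algebra_simps inner_commute)
  have form: "(Hs *v \<xi>) \<bullet> \<xi> = (M x m *v \<xi>) \<bullet> \<xi> + (\<Sum>j\<in>UNIV. tm j \<xi>)" for \<xi>
    by (simp add: H inner_add_left inner_sum_left tm_def q_def algebra_simps)
  have Gpos: "0 < G i x" "m $ i < 0" if "neg_pair i" for i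
    using kkt_at_neg_pair[OF near t kkt that] by auto
  have tan1: "G (partner i) x * q i \<xi> + G i x * q (partner i) \<xi> = 0" if "\<xi> \<in> TS" "neg_pair i" for i \<xi>
  proof (cases i)
    case (Inl j)
    hence "j \<in> active_H F1 F2 t x" using that S by simp
    hence "prod_grad F1 F2 x j \<bullet> \<xi> = 0" using that(1) by (simp add: TS_def scholtes_tangent_def)
    thus ?thesis by (simp add: Inl prod_grad_def q_def inner_add_left)
  next
    case (Inr j)
    hence "j \<in> active_H F1 F2 t x" using that S neg_pair_partner[of i] by simp
    hence "prod_grad F1 F2 x j \<bullet> \<xi> = 0" using that(1) by (simp add: TS_def scholtes_tangent_def)
    thus ?thesis by (simp add: Inr prod_grad_def q_def inner_add_left)
  qed
  have tan0: "q i \<xi> = 0" if "\<xi> \<in> TS" "\<not> neg_pair i" "i \<in> I" for i \<xi>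
  proof (cases i)
    case (Inl j)
    hence "j \<in> active_N F1 x" using that S by simp
    thus ?thesis using that(1) by (simp add: TS_def scholtes_tangent_def q_def Inl)
  next
    case (Inr j)
    hence "j \<in> active_N F2 x" using that S neg_pair_partner[of i] by simp
    thus ?thesis using that(1) by (simp add: TS_def scholtes_tangent_def q_def Inr)
  qed
  have tan2: "q (partner i) \<xi> = - (G (partner i) x / G i x) * q i \<xi>" if "\<xi> \<in> TS" "neg_pair i" for i \<xi>
    using tan1[OF that] Gpos(1)[OF that(2)] by (simp add: field_simps)
  have coef: "\<eta> (idx i) * G (partner i) x = - m $ i" if "neg_pair i" for i
    using compl(5)[of "idx i"] that neg_pair_partner[of i] by (cases i) (auto simp: idx_def)
  have term_eq: "tm (idx i) \<xi> = - (2 * (\<bar>m $ i\<bar> / G i x) * (q i \<xi>)^2)" if "\<xi> \<in> TS" "neg_pair i" for i \<xi>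
  proof -
    have "tm (idx i) \<xi> = \<eta> (idx i) * (2 * (q i \<xi> * q (partner i) \<xi>))"
      by (cases i) (simp_all add: tm_def idx_def mult.commute)
    also have "\<dots> = - (2 * (\<eta> (idx i) * G (partner i) x) / G i x * (q i \<xi>)^2)"
      unfolding tan2[OF that] by (simp add: power2_eq_square)
    finally show ?thesis using coef[OF that(2)] Gpos(2)[OF that(2)] by simp
  qed
  have term0: "tm j \<xi> = 0" if "\<not> neg_pair (Inl j)" for j \<xi>
    using compl(4)[OF that] by (simp add: tm_def)
  have idx: "idx (Inl j) = j" "idx (Inr j) = j" for j by (auto simp: idx_def)
  have term_nonpos: "tm j \<xi> \<le> 0" if "\<xi> \<in> TS" for j \<xi>
  proof (cases "neg_pair (Inl j)")
    case True
    show ?thesis using term_eq[OF that True] Gpos(1)[OF True] by (simp add: idx)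
  qed (simp add: term0)
  have qbound: "(q i \<xi>)^2 \<le> Cg^2 * (norm \<xi>)^2" "\<bar>q i \<xi>\<bar> \<le> Cg * norm \<xi>" for i \<xi>
  proof -
    show *: "\<bar>q i \<xi>\<bar> \<le> Cg * norm \<xi>" unfolding q_def
      using Cauchy_Schwarz_ineq2[of "grad (G i) x" \<xi>] mult_right_mono[OF gbound[of i] norm_ge_zero[of \<xi>]] by linarith
    show "(q i \<xi>)^2 \<le> Cg^2 * (norm \<xi>)^2"
      using power_mono[OF *, of 2] by (simp add: power_mult_distrib)
  qed
  have term_lower: "tm j \<xi> \<ge> - (\<delta> / (4 * real CARD('k)) * (norm \<xi>)^2)" if x: "\<xi> \<in> TS" and jb: "j \<notin> biactive_neg" for j \<xi>
  proof (cases "neg_pair (Inl j)")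
    case False
    thus ?thesis using \<delta> by (simp add: term0)
  next
    case True
    then obtain i where i: "neg_pair i" "i \<notin> I" "idx i = j"
      using jb neg_pair_partner[of "Inl j"] idx by (force simp: biactive_neg_def)
    have "\<bar>m $ i\<bar> \<le> \<kappa> * \<bar>m $ partner i\<bar>"
      using inact[OF i(2)] kkt by (intro scholtes_pair_inactive_bound[OF t]) (auto simp: kkt_at_def)
    also have "\<dots> \<le> \<kappa> * (R * G i x)" using inact[OF i(2)] \<kappa> by (intro mult_left_mono) auto
    finally have "\<bar>m $ i\<bar> / G i x \<le> \<kappa> * R" using Gpos(1)[OF i(1)] by (simp add: field_simps)
    hence "2 * (\<bar>m $ i\<bar> / G i x) * (q i \<xi>)^2 \<le> 2 * (\<kappa> * R) * (Cg^2 * (norm \<xi>)^2)"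
      using qbound(1) \<kappa> R Gpos(1)[OF i(1)] by (intro mult_mono) auto
    also have "\<dots> = (2 * \<kappa> * R * Cg^2) * (norm \<xi>)^2" by simp
    also have "\<dots> \<le> \<delta> / (4 * real CARD('k)) * (norm \<xi>)^2" using \<kappa> by (intro mult_right_mono) auto
    finally show ?thesis using term_eq[OF x i(1)] i(3) by simp
  qed
  have gclose: "\<bar>grad (G i) xb \<bullet> \<xi>\<bar> \<le> \<bar>q i \<xi>\<bar> + \<delta> / 2 * norm \<xi>" for i \<xi>
  proof -
    have "\<bar>(grad (G i) x - grad (G i) xb) \<bullet> \<xi>\<bar> \<le> \<delta> / 2 * norm \<xi>"
      using Cauchy_Schwarz_ineq2[of "grad (G i) x - grad (G i) xb" \<xi>] mult_right_mono[OF gnear[of i] norm_ge_zero[of \<xi>]] by linarith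
    thus ?thesis unfolding q_def inner_diff_left by linarith
  qed
  have close: "\<forall>i\<in>I. \<bar>grad (G i) xb \<bullet> \<xi>\<bar> \<le> \<delta> * norm \<xi>"
    if x: "\<xi> \<in> TS" and b: "\<And>i. neg_pair i \<Longrightarrow> i \<in> I \<Longrightarrow> partner i \<in> I \<Longrightarrow> \<bar>q i \<xi>\<bar> \<le> \<delta> / 2 * norm \<xi>" for \<xi>
  proof
    fix i assume i: "i \<in> I"
    have "\<bar>q i \<xi>\<bar> \<le> \<delta> / 2 * norm \<xi>"
    proof (cases "neg_pair i")
      case False
      thus ?thesis using tan0[OF x False i] \<delta> by simp
    next
      case True
      show ?thesis
      proof (cases "partner i \<in> I")
        case False
        have n: "neg_pair (partner i)" using True neg_pair_partner by simp
        have "q i \<xi> = - (G i x / G (partner i) x) * q (partner i) \<xi>" using tan2[OF x n] by simp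
        hence "\<bar>q i \<xi>\<bar> = (G i x / G (partner i) x) * \<bar>q (partner i) \<xi>\<bar>"
          using Gpos(1)[OF True] Gpos(1)[OF n] by (simp add: abs_mult)
        also have "\<dots> \<le> \<kappa> * (Cg * norm \<xi>)"
          using inact[OF False] \<kappa> qbound(2) by (intro mult_mono) (auto simp: field_simps)
        also have "\<dots> \<le> \<delta> / 2 * norm \<xi>"
          using mult_right_mono[OF \<kappa>(2), of "norm \<xi>"] by simp
        finally show ?thesis .
      qed (use b True i in blast)
    qed
    thus "\<bar>grad (G i) xb \<bullet> \<xi>\<bar> \<le> \<delta> * norm \<xi>" using gclose[of i \<xi>] by simp
  qed

  define Ns where "Ns = {\<xi>\<in>TS. \<forall>w\<in>P. w \<bullet> \<xi> = 0}"
  define Ps where "Ps = {\<xi>\<in>{\<xi>\<in>TS. \<forall>w\<in>N. w \<bullet> \<xi> = 0}. \<forall>j\<in>biactive_neg. grad (G (Inl j)) x \<bullet> \<xi> = 0}"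
  have subTS: "subspace TS"
    by (auto simp: TS_def scholtes_tangent_def subspace_def inner_add_right)
  have negative: "(Hs *v \<xi>) \<bullet> \<xi> < 0" if "\<xi> \<in> Ns" "\<xi> \<noteq> 0" for \<xi>
  proof -
    have x: "\<xi> \<in> TS" "\<forall>w\<in>P. w \<bullet> \<xi> = 0" using that by (auto simp: Ns_def)
    have n: "(norm \<xi>)^2 > 0" using that by simp
    have M1: "(M x m *v \<xi>) \<bullet> \<xi> \<le> (M xb mb *v \<xi>) \<bullet> \<xi> + \<delta> / 4 * (norm \<xi>)^2" using Mnear[of \<xi>] by linarith
    show ?thesis
    proof (cases "\<exists>i. neg_pair i \<and> i \<in> I \<and> partner i \<in> I \<and> \<bar>q i \<xi>\<bar> > \<delta> / 2 * norm \<xi>")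
      case False
      hence "(M xb mb *v \<xi>) \<bullet> \<xi> \<le> - \<delta> * (norm \<xi>)^2"
        by (intro negd x(2) close x(1)) force
      moreover have "(\<Sum>j\<in>UNIV. tm j \<xi>) \<le> 0" using term_nonpos[OF x(1)] by (intro sum_nonpos) auto
      moreover have "- \<delta> * (norm \<xi>)^2 + \<delta> / 4 * (norm \<xi>)^2 < 0"
        using mult_pos_pos[OF \<delta> n] by (simp add: algebra_simps)
      ultimately show ?thesis using M1 unfolding form by linarith
    next
      case True
      then obtain i where i: "neg_pair i" "i \<in> I" "partner i \<in> I" "\<bar>q i \<xi>\<bar> > \<delta> / 2 * norm \<xi>" by blast
      have "0 < L * \<delta>^2" using L C0 \<delta> by linarith
      hence "L \<ge> 0" by (simp add: zero_less_mult_iff)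
      have "L \<le> \<bar>m $ i\<bar> / G i x" using bi[OF i(1-3)] Gpos(1)[OF i(1)] by (simp add: field_simps)
      moreover have "(\<delta> / 2 * norm \<xi>)^2 \<le> (q i \<xi>)^2"
        using i(4) \<delta> by (intro abs_le_square_iff[THEN iffD1]) auto
      ultimately have "L * (\<delta> / 2 * norm \<xi>)^2 \<le> \<bar>m $ i\<bar> / G i x * (q i \<xi>)^2"
        using \<open>L \<ge> 0\<close> by (intro mult_mono) auto
      hence "tm (idx i) \<xi> \<le> - (L * \<delta>^2 / 2 * (norm \<xi>)^2)"
      proof -
        assume *: "L * (\<delta> / 2 * norm \<xi>)^2 \<le> \<bar>m $ i\<bar> / G i x * (q i \<xi>)^2"
        have "L * \<delta>^2 / 2 * (norm \<xi>)^2 = 2 * (L * (\<delta> / 2 * norm \<xi>)^2)"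
          by (simp add: power_mult_distrib power_divide)
        also have "\<dots> \<le> 2 * (\<bar>m $ i\<bar> / G i x * (q i \<xi>)^2)" using * by simp
        also have "\<dots> = - tm (idx i) \<xi>" unfolding term_eq[OF x(1) i(1)] by simp
        finally show ?thesis by simp
      qed
      moreover have "(\<Sum>j\<in>UNIV. tm j \<xi>) \<le> tm (idx i) \<xi>"
        using term_nonpos[OF x(1)] sum_mono2[of UNIV "{idx i}" "\<lambda>j. - tm j \<xi>"] by (simp add: sum_negf)
      moreover have "(C + \<delta>) * (norm \<xi>)^2 < L * \<delta>^2 / 2 * (norm \<xi>)^2"
        using L n by (rule mult_strict_right_mono)
      moreover have "\<delta> / 4 * (norm \<xi>)^2 \<le> \<delta> * (norm \<xi>)^2" using \<delta> by (intro mult_right_mono) auto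
      ultimately show ?thesis using M1 C[of \<xi>] unfolding form by (simp add: distrib_right)
    qed
  qed
  have positive: "(Hs *v \<xi>) \<bullet> \<xi> > 0" if "\<xi> \<in> Ps" "\<xi> \<noteq> 0" for \<xi>
  proof -
    have x: "\<xi> \<in> TS" "\<forall>w\<in>N. w \<bullet> \<xi> = 0" using that by (auto simp: Ps_def)
    have l: "q (Inl j) \<xi> = 0" if "j \<in> biactive_neg" for j using \<open>\<xi> \<in> Ps\<close> that by (simp add: Ps_def q_def)
    have q0: "q i \<xi> = 0" if i: "neg_pair i" "i \<in> I" "partner i \<in> I" for i
    proof (cases i)
      case (Inl j)
      with i l show ?thesis by (simp add: biactive_neg_def)
    next
      case (Inr j)
      hence "j \<in> biactive_neg" using i neg_pair_partner[of i] by (simp add: biactive_neg_def)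
      from l[OF this] have "q (partner i) \<xi> = 0" using Inr by simp
      thus ?thesis using tan1[OF x(1) i(1)] Gpos(1)[of "partner i"] i(1) neg_pair_partner[of i] by simp
    qed
    have n: "(norm \<xi>)^2 > 0" using that by simp
    have "(M xb mb *v \<xi>) \<bullet> \<xi> \<ge> \<delta> * (norm \<xi>)^2"
      using \<delta> by (intro posd x(2) close x(1)) (simp add: q0)
    moreover have "(M x m *v \<xi>) \<bullet> \<xi> \<ge> (M xb mb *v \<xi>) \<bullet> \<xi> - \<delta> / 4 * (norm \<xi>)^2" using Mnear[of \<xi>] by linarith
    moreover have "tm j \<xi> \<ge> - (\<delta> / (4 * real CARD('k)) * (norm \<xi>)^2)" for j
    proof (cases "j \<in> biactive_neg")
      case True
      thus ?thesis using l[OF True] \<delta> by (simp add: tm_def)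
    qed (rule term_lower[OF x(1)])
    hence "(\<Sum>j\<in>(UNIV::'k set). tm j \<xi>) \<ge> (\<Sum>j\<in>(UNIV::'k set). - (\<delta> / (4 * real CARD('k)) * (norm \<xi>)^2))"
      by (intro sum_mono) auto
    hence "(\<Sum>j\<in>(UNIV::'k set). tm j \<xi>) \<ge> - (\<delta> / 4 * (norm \<xi>)^2)" by simp
    moreover have "\<delta> * (norm \<xi>)^2 > 0" using \<delta> n by simp
    ultimately show ?thesis unfolding form by (simp add: algebra_simps)
  qed
  have dimT: "dim T + card I = CARD('n)"
    using dim_kernel_lin_indep_family[OF licq] by (simp add: T_def)
  let ?H = "{j. neg_pair (Inl j)}" and ?N1 = "{j. \<not> neg_pair (Inl j) \<and> Inl j \<in> I}"
    and ?N2 = "{j. \<not> neg_pair (Inl j) \<and> Inr j \<in> I}"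
  have "TS = {\<xi>. \<forall>i\<in>?H <+> (?N1 <+> ?N2). case_sum (prod_grad F1 F2 x)
      (case_sum (\<lambda>j. grad (\<lambda>y. F1 y $ j) x) (\<lambda>j. grad (\<lambda>y. F2 y $ j) x)) i \<bullet> \<xi> = 0}"
    unfolding TS_def scholtes_tangent_def S by (simp add: Plus_def ball_Un)
  with dim_kernel_lin_indep_family[OF sl[unfolded scholtes_licq_def S]]
  have "dim TS + card (?H <+> (?N1 <+> ?N2)) = CARD('n)" by simp
  hence "dim TS + (card ?H + card ?N1 + card ?N2) = CARD('n)" by (simp add: card_Plus)
  with dimT card_active have dimTS: "dim TS = (dim N + card biactive_neg) + dim P" using dims by linarith
  have dN: "dim N + card biactive_neg \<le> dim Ns"
    using dim_orthogonal_to_subspace[OF subTS, of P] dimTS by (simp add: Ns_def)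
  have sub1: "subspace {\<xi>\<in>TS. \<forall>w\<in>N. w \<bullet> \<xi> = 0}" by (rule subspace_inner_constraints[OF subTS])
  have dP: "dim P \<le> dim Ps"
    using dim_orthogonal_to_subspace[OF subTS, of N] dimTS
      dim_inner_constraints_family[OF sub1, of biactive_neg "\<lambda>j. grad (G (Inl j)) x"]
    by (simp add: Ps_def)
  have "subspace Ns" "Ns \<subseteq> TS" unfolding Ns_def by (auto intro: subspace_inner_constraints subTS)
  moreover have "Ps = {\<xi>\<in>{\<xi>\<in>TS. \<forall>w\<in>N. w \<bullet> \<xi> = 0}. \<forall>w\<in>(\<lambda>j. grad (G (Inl j)) x) ` biactive_neg. w \<bullet> \<xi> = 0}"
    by (auto simp: Ps_def)
  hence "subspace Ps" by (simp only: subspace_inner_constraints[OF sub1])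
  moreover have "Ps \<subseteq> TS" by (auto simp: Ps_def)
  ultimately show "restrict_nonsingular (hess (scholtes_lagrange f F1 F2 t \<eta> \<nu>1 \<nu>2) x) (scholtes_tangent F1 F2 t x)"
    "num_neg_eigenvalues (hess (scholtes_lagrange f F1 F2 t \<eta> \<nu>1 \<nu>2) x) (scholtes_tangent F1 F2 t x)
      = dim N + card biactive_neg"
    using inertia_from_definite_subspaces[OF symH subTS, of Ns Ps "dim N + card biactive_neg" "dim P"]
      negative positive dN dP dimTS unfolding Hs_def TS_def by blast+
qed

text \<open>It remains to choose the constants of \<open>scholtes_inertia\<close> and to check that its estimates hold near
  \<open>(xb, mb)\<close>. The multipliers are nonzero on biactive pairs while \<open>G i x\<close> tends to 0, which makes the required
  quotient arbitrarily large.\<close>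
lemma scholtes_nondegenerate_near:
  "\<exists>\<delta>>0. \<forall>t x m \<eta> \<nu>1 \<nu>2. 0 < t \<longrightarrow> x \<in> ball xb \<delta> \<longrightarrow> m \<in> ball mb \<delta> \<longrightarrow> scholtes_at t x m \<eta> \<nu>1 \<nu>2 \<longrightarrow>
     nondegenerate_scholtes_KKT f F1 F2 t x \<eta> \<nu>1 \<nu>2 \<and>
     quadratic_index f F1 F2 t x \<eta> \<nu>1 \<nu>2 = num_neg_eigenvalues (M xb mb) T + card biactive_neg"
proof -
  obtain N P where NP: "dim N = num_neg_eigenvalues (M xb mb) T" "dim N + dim P = dim T"
    and pos: "\<And>\<xi>. \<xi> \<in> T \<Longrightarrow> \<xi> \<noteq> 0 \<Longrightarrow> (\<forall>w\<in>N. w \<bullet> \<xi> = 0) \<Longrightarrow> (M xb mb *v \<xi>) \<bullet> \<xi> > 0"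
    and neg: "\<And>\<xi>. \<xi> \<in> T \<Longrightarrow> \<xi> \<noteq> 0 \<Longrightarrow> (\<forall>w\<in>P. w \<bullet> \<xi> = 0) \<Longrightarrow> (M xb mb *v \<xi>) \<bullet> \<xi> < 0"
    using inertia_splitting[OF sym_M subspace_T nonsingular] by metis
  have "\<exists>\<delta>>0. \<forall>\<xi>. (\<forall>w\<in>(\<lambda>i. grad (G i) xb) ` I \<union> N. \<bar>w \<bullet> \<xi>\<bar> \<le> \<delta> * norm \<xi>) \<longrightarrow>
      (M xb mb *v \<xi>) \<bullet> \<xi> \<ge> \<delta> * (norm \<xi>)^2"
    by (rule definite_form_stable[of "(\<lambda>i. grad (G i) xb) ` I \<union> N" "M xb mb"])
      (use pos in \<open>auto simp: T_def\<close>)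
  then obtain d1 where d1: "d1 > 0" and D1: "\<And>\<xi>. (\<forall>w\<in>(\<lambda>i. grad (G i) xb) ` I \<union> N. \<bar>w \<bullet> \<xi>\<bar> \<le> d1 * norm \<xi>) \<Longrightarrow>
      (M xb mb *v \<xi>) \<bullet> \<xi> \<ge> d1 * (norm \<xi>)^2" by blast
  have minus: "((0 - M xb mb) *v \<xi>) \<bullet> \<xi> = - ((M xb mb *v \<xi>) \<bullet> \<xi>)" for \<xi>
    by (simp only: matrix_vector_mult_diff_rdistrib matrix_vector_mult_0) simp
  have "\<exists>\<delta>>0. \<forall>\<xi>. (\<forall>w\<in>(\<lambda>i. grad (G i) xb) ` I \<union> P. \<bar>w \<bullet> \<xi>\<bar> \<le> \<delta> * norm \<xi>) \<longrightarrow>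
      ((0 - M xb mb) *v \<xi>) \<bullet> \<xi> \<ge> \<delta> * (norm \<xi>)^2"
    by (rule definite_form_stable[of "(\<lambda>i. grad (G i) xb) ` I \<union> P" "0 - M xb mb"])
      (unfold minus, use neg in \<open>auto simp: T_def\<close>)
  then obtain d2 where d2: "d2 > 0" and D2: "\<And>\<xi>. (\<forall>w\<in>(\<lambda>i. grad (G i) xb) ` I \<union> P. \<bar>w \<bullet> \<xi>\<bar> \<le> d2 * norm \<xi>) \<Longrightarrow>
      - ((M xb mb *v \<xi>) \<bullet> \<xi>) \<ge> d2 * (norm \<xi>)^2" unfolding minus by blast
  define \<delta> where "\<delta> = min d1 d2"
  have \<delta>: "\<delta> > 0" "\<delta> \<le> d1" "\<delta> \<le> d2" using d1 d2 by (auto simp: \<delta>_def)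
  have mono: "\<delta> * y \<le> d1 * y" "\<delta> * y \<le> d2 * y" if "0 \<le> y" for y
    using \<delta> that by (auto intro: mult_right_mono)
  have posd: "(M xb mb *v \<xi>) \<bullet> \<xi> \<ge> \<delta> * (norm \<xi>)^2"
    if "\<forall>w\<in>N. w \<bullet> \<xi> = 0" "\<forall>i\<in>I. \<bar>grad (G i) xb \<bullet> \<xi>\<bar> \<le> \<delta> * norm \<xi>" for \<xi>
  proof -
    have "\<forall>w\<in>(\<lambda>i. grad (G i) xb) ` I \<union> N. \<bar>w \<bullet> \<xi>\<bar> \<le> d1 * norm \<xi>"
      using that d1 mono(1)[of "norm \<xi>"] by fastforce
    from D1[OF this] show ?thesis using mono(1)[of "(norm \<xi>)^2"] by simp
  qed
  have negd: "(M xb mb *v \<xi>) \<bullet> \<xi> \<le> - \<delta> * (norm \<xi>)^2"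
    if "\<forall>w\<in>P. w \<bullet> \<xi> = 0" "\<forall>i\<in>I. \<bar>grad (G i) xb \<bullet> \<xi>\<bar> \<le> \<delta> * norm \<xi>" for \<xi>
  proof -
    have "\<forall>w\<in>(\<lambda>i. grad (G i) xb) ` I \<union> P. \<bar>w \<bullet> \<xi>\<bar> \<le> d2 * norm \<xi>"
      using that d2 mono(2)[of "norm \<xi>"] by fastforce
    from D2[OF this] show ?thesis using mono(2)[of "(norm \<xi>)^2"] by simp
  qed
  define C where "C = real CARD('n) * real CARD('n) * norm (M xb mb)"
  have C0: "0 \<le> C" by (simp add: C_def)
  have C: "(M xb mb *v \<xi>) \<bullet> \<xi> \<le> C * (norm \<xi>)^2" for \<xi>
  proof -
    have "(M xb mb *v \<xi>) \<bullet> \<xi> \<le> norm (M xb mb *v \<xi>) * norm \<xi>" by (rule norm_cauchy_schwarz)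
    also have "\<dots> \<le> (C * norm \<xi>) * norm \<xi>" unfolding C_def
      by (intro mult_right_mono norm_matrix_vector_mult_le) auto
    finally show ?thesis by (simp add: power2_eq_square)
  qed
  \<comment> \<open>Any \<open>L\<close> above \<open>2 * (C + \<delta>) / \<delta>\<^sup>2\<close> would do.\<close>
  define L where "L = 2 * (C + \<delta> + 1) / \<delta>^2"
  have L: "C + \<delta> < L * \<delta>^2 / 2" using \<delta> by (simp add: L_def)
  define Cg where "Cg = 1 + (\<Sum>i\<in>UNIV. norm (grad (G i) xb))"
  define R where "R = 1 + (\<Sum>i\<in>-I. \<bar>mb $ partner i\<bar> / G i xb)"
  have Cg: "Cg > 0" unfolding Cg_def by (intro add_pos_nonneg sum_nonneg) auto
  have R: "R > 0" unfolding R_def using feasible by (intro add_pos_nonneg sum_nonneg) auto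
  define K where "K = real CARD('k)"
  have K: "K > 0" by (simp add: K_def)
  define \<kappa> where "\<kappa> = min (\<delta> / (2 * Cg)) (\<delta> / (8 * K * R * Cg^2))"
  have \<kappa>: "\<kappa> > 0" using \<delta> Cg R K by (simp add: \<kappa>_def)
  have \<kappa>1: "\<kappa> * Cg \<le> \<delta> / 2"
  proof -
    have "\<kappa> * Cg \<le> \<delta> / (2 * Cg) * Cg" using Cg by (intro mult_right_mono) (auto simp: \<kappa>_def)
    thus ?thesis using Cg by simp
  qed
  have \<kappa>2: "2 * \<kappa> * R * Cg^2 \<le> \<delta> / (4 * K)"
  proof -
    have "\<kappa> * (2 * R * Cg^2) \<le> \<delta> / (8 * K * R * Cg^2) * (2 * R * Cg^2)"
      using Cg R by (intro mult_right_mono) (auto simp: \<kappa>_def)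
    also have "\<dots> = \<delta> / (4 * K)" using Cg R K by (simp add: field_simps)
    finally show ?thesis by (simp add: algebra_simps)
  qed
  define Q where "Q x m \<longleftrightarrow> near_signs x m \<and>
      (\<forall>\<xi>. \<bar>(M x m *v \<xi>) \<bullet> \<xi> - (M xb mb *v \<xi>) \<bullet> \<xi>\<bar> \<le> \<delta> / 4 * (norm \<xi>)^2) \<and>
      (\<forall>i. norm (grad (G i) x - grad (G i) xb) \<le> \<delta> / 2) \<and> (\<forall>i. norm (grad (G i) x) \<le> Cg) \<and>
      (\<forall>i\<in>-I. 0 < G i x \<and> G (partner i) x \<le> \<kappa> * G i x) \<and>
      (\<forall>i. i \<notin> I \<longrightarrow> \<bar>m $ partner i\<bar> \<le> R * G i x) \<and>
      (\<forall>i. neg_pair i \<longrightarrow> i \<in> I \<longrightarrow> partner i \<in> I \<longrightarrow> L * G i x \<le> \<bar>m $ i\<bar>)" for x m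
  have e3: "\<forall>\<^sub>F z in nhds (xb, mb). \<forall>i. norm (grad (G i) (fst z) - grad (G i) xb) \<le> \<delta> / 2"
  proof (rule eventually_all_finite)
    fix i
    have "((\<lambda>z. norm (grad (G i) (fst z) - grad (G i) xb)) \<longlongrightarrow> norm (grad (G i) xb - grad (G i) xb)) (nhds (xb, mb))"
      by (intro tendsto_intros tendsto_grad_G)
    from order_tendstoD(2)[OF this, of "\<delta> / 2"] \<delta>
    show "\<forall>\<^sub>F z in nhds (xb, mb). norm (grad (G i) (fst z) - grad (G i) xb) \<le> \<delta> / 2"
      by (auto elim: eventually_mono)
  qed
  have e4: "\<forall>\<^sub>F z in nhds (xb, mb). \<forall>i. norm (grad (G i) (fst z)) \<le> Cg"
  proof (rule eventually_all_finite)
    fix i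
    have "norm (grad (G i) xb) \<le> (\<Sum>i\<in>UNIV. norm (grad (G i) xb))"
      by (rule member_le_sum) auto
    hence "norm (grad (G i) xb) < Cg" by (simp add: Cg_def)
    from order_tendstoD(2)[OF tendsto_norm[OF tendsto_grad_G] this]
    show "\<forall>\<^sub>F z in nhds (xb, mb). norm (grad (G i) (fst z)) \<le> Cg"
      by (auto elim: eventually_mono)
  qed
  have e6: "\<forall>\<^sub>F z in nhds (xb, mb). \<forall>i. i \<notin> I \<longrightarrow> \<bar>snd z $ partner i\<bar> \<le> R * G i (fst z)"
  proof (rule eventually_all_finite)
    fix i
    show "\<forall>\<^sub>F z in nhds (xb, mb). i \<notin> I \<longrightarrow> \<bar>snd z $ partner i\<bar> \<le> R * G i (fst z)"
    proof (cases "i \<in> I")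
      case False
      hence g: "0 < G i xb" by (simp add: G_pos_iff)
      have "\<bar>mb $ partner i\<bar> / G i xb \<le> (\<Sum>i\<in>-I. \<bar>mb $ partner i\<bar> / G i xb)"
        using False feasible by (intro member_le_sum) auto
      hence "\<bar>mb $ partner i\<bar> / G i xb < R" by (simp add: R_def)
      hence "0 < R * G i xb - \<bar>mb $ partner i\<bar>" using g by (simp add: field_simps)
      moreover have "((\<lambda>z. R * G i (fst z) - \<bar>snd z $ partner i\<bar>) \<longlongrightarrow> R * G i xb - \<bar>mb $ partner i\<bar>) (nhds (xb, mb))"
        by (intro tendsto_intros tendsto_G tendsto_multiplier)
      ultimately have "\<forall>\<^sub>F z in nhds (xb, mb). 0 < R * G i (fst z) - \<bar>snd z $ partner i\<bar>"
        using order_tendstoD(1) by blast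
      thus ?thesis by eventually_elim simp
    qed simp
  qed
  have e7: "\<forall>\<^sub>F z in nhds (xb, mb). \<forall>i. neg_pair i \<longrightarrow> i \<in> I \<longrightarrow> partner i \<in> I \<longrightarrow> L * G i (fst z) \<le> \<bar>snd z $ i\<bar>"
  proof (rule eventually_all_finite)
    fix i
    show "\<forall>\<^sub>F z in nhds (xb, mb). neg_pair i \<longrightarrow> i \<in> I \<longrightarrow> partner i \<in> I \<longrightarrow> L * G i (fst z) \<le> \<bar>snd z $ i\<bar>"
    proof (cases "i \<in> I \<and> partner i \<in> I")
      case True
      hence "mb $ i \<noteq> 0" using mult_biactive[of i] by auto
      hence "0 < \<bar>mb $ i\<bar> - L * G i xb" using True by simp
      moreover have "((\<lambda>z. \<bar>snd z $ i\<bar> - L * G i (fst z)) \<longlongrightarrow> \<bar>mb $ i\<bar> - L * G i xb) (nhds (xb, mb))"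
        by (intro tendsto_intros tendsto_G tendsto_multiplier)
      ultimately have "\<forall>\<^sub>F z in nhds (xb, mb). 0 < \<bar>snd z $ i\<bar> - L * G i (fst z)"
        using order_tendstoD(1) by blast
      thus ?thesis by eventually_elim simp
    qed auto
  qed
  have "\<delta> / 4 > 0" using \<delta> by simp
  have "\<forall>\<^sub>F z in nhds (xb, mb). Q (fst z) (snd z)"
    unfolding Q_def
    by (intro eventually_conj eventually_near_signs eventually_M_near eventually_inactive_small e3 e4 e6 e7 \<kappa> \<open>\<delta> / 4 > 0\<close>)
  from eventually_nhds_balls[OF this] obtain dQ where dQ: "dQ > 0"
    "\<And>x m. x \<in> ball xb dQ \<Longrightarrow> m \<in> ball mb dQ \<Longrightarrow> Q x m" by blast
  obtain dL where dL: "dL > 0" "\<And>t x m. 0 < t \<Longrightarrow> x \<in> ball xb dL \<Longrightarrow> m \<in> ball mb dL \<Longrightarrow> kkt_at t x m \<Longrightarrow> scholtes_licq F1 F2 t x"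
    using scholtes_licq_near by blast
  show ?thesis
  proof (intro exI[of _ "min dQ dL"] conjI[of "0 < min dQ dL"] allI impI)
    fix t x m \<eta> \<nu>1 \<nu>2
    assume t: "0 < t" and x: "x \<in> ball xb (min dQ dL)" and m: "m \<in> ball mb (min dQ dL)" and at: "scholtes_at t x m \<eta> \<nu>1 \<nu>2"
    have q: "Q x m" using dQ(2) x m by simp
    have near: "near_signs x m" using q by (simp add: Q_def)
    have licq': "scholtes_licq F1 F2 t x"
      using dL(2)[OF t _ _ scholtes_at_imp_kkt_at[OF at]] x m by simp
    have inact: "0 < G i x \<and> G (partner i) x \<le> \<kappa> * G i x \<and> \<bar>m $ partner i\<bar> \<le> R * G i x" if "i \<notin> I" for i
      using q that unfolding Q_def by blast
    note inertia = scholtes_inertia[OF NP(2) \<delta>(1) posd negd C0 C L less_imp_le[OF \<kappa>] \<kappa>1 \<kappa>2[unfolded K_def] less_imp_le[OF R] near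
        _ _ _ inact _ t at licq']
    have "restrict_nonsingular (hess (scholtes_lagrange f F1 F2 t \<eta> \<nu>1 \<nu>2) x) (scholtes_tangent F1 F2 t x)"
      "num_neg_eigenvalues (hess (scholtes_lagrange f F1 F2 t \<eta> \<nu>1 \<nu>2) x) (scholtes_tangent F1 F2 t x)
      = dim N + card biactive_neg"
      by (rule inertia; use q in \<open>simp add: Q_def\<close>)+
    thus "nondegenerate_scholtes_KKT f F1 F2 t x \<eta> \<nu>1 \<nu>2 \<and>
        quadratic_index f F1 F2 t x \<eta> \<nu>1 \<nu>2 = num_neg_eigenvalues (M xb mb) T + card biactive_neg"
      using at licq' scholtes_at_strict_complementarity(1-3)[OF near t at] NP(1)
      by (simp add: nondegenerate_scholtes_KKT_def quadratic_index_def scholtes_at_def)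
  qed (use dQ dL in simp)
qed

text \<open>The radius \<open>\<rho>\<close> of uniqueness is fixed first; the solution for small \<open>t\<close> is then found in an arbitrarily
  small ball.\<close>
lemma scholtes_regularisation_well_posed:
  "\<exists>\<rho>>0. \<forall>r>0. \<exists>t0>0. \<forall>t. 0 < t \<and> t < t0 \<longrightarrow> (\<exists>x\<in>ball xb r.
     (\<exists>\<eta> \<nu>1 \<nu>2. nondegenerate_scholtes_KKT f F1 F2 t x \<eta> \<nu>1 \<nu>2 \<and>
        quadratic_index f F1 F2 t x \<eta> \<nu>1 \<nu>2 = num_neg_eigenvalues (M xb mb) T + card biactive_neg) \<and>
     (\<forall>y\<in>ball xb \<rho>. (\<exists>\<eta> \<nu>1 \<nu>2. scholtes_KKT f F1 F2 t y \<eta> \<nu>1 \<nu>2) \<longrightarrow> y = x))"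
proof -
  obtain dU where dU: "dU > 0" and uniq: "\<And>t x m x' m'. 0 < t \<Longrightarrow> t < dU \<Longrightarrow> x \<in> ball xb dU \<Longrightarrow> x' \<in> ball xb dU \<Longrightarrow>
      m \<in> ball mb dU \<Longrightarrow> m' \<in> ball mb dU \<Longrightarrow> kkt_at t x m \<Longrightarrow> kkt_at t x' m' \<Longrightarrow> x = x'"
    using kkt_at_unique by blast
  obtain dM where dM: "dM > 0" "\<And>t x m. 0 < t \<Longrightarrow> x \<in> ball xb dM \<Longrightarrow> kkt_at t x m \<Longrightarrow> m \<in> ball mb dU"
    using multipliers_near[OF dU] by blast
  obtain dI where dI: "dI > 0" "\<And>t x m \<eta> \<nu>1 \<nu>2. 0 < t \<Longrightarrow> x \<in> ball xb dI \<Longrightarrow> m \<in> ball mb dI \<Longrightarrow>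
     scholtes_at t x m \<eta> \<nu>1 \<nu>2 \<Longrightarrow> nondegenerate_scholtes_KKT f F1 F2 t x \<eta> \<nu>1 \<nu>2 \<and>
     quadratic_index f F1 F2 t x \<eta> \<nu>1 \<nu>2 = num_neg_eigenvalues (M xb mb) T + card biactive_neg"
    using scholtes_nondegenerate_near by blast
  show ?thesis
  proof (rule exI[of _ "min dU dM"], intro conjI allI impI)
    fix r :: real assume r: "r > 0"
    define r' where "r' = min (min r dU) dI"
    have r': "r' > 0" "r' \<le> r" "r' \<le> dU" "r' \<le> dI" using r dU dI by (auto simp: r'_def)
    obtain dE where dE: "dE > 0" "\<And>t. 0 < t \<Longrightarrow> t < dE \<Longrightarrow> \<exists>x\<in>ball xb r'. \<exists>m\<in>ball mb r'. kkt_at t x m"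
      using kkt_at_exists[OF r'(1)] by blast
    show "\<exists>t0>0. \<forall>t. 0 < t \<and> t < t0 \<longrightarrow> (\<exists>x\<in>ball xb r.
       (\<exists>\<eta> \<nu>1 \<nu>2. nondegenerate_scholtes_KKT f F1 F2 t x \<eta> \<nu>1 \<nu>2 \<and>
          quadratic_index f F1 F2 t x \<eta> \<nu>1 \<nu>2 = num_neg_eigenvalues (M xb mb) T + card biactive_neg) \<and>
       (\<forall>y\<in>ball xb (min dU dM). (\<exists>\<eta> \<nu>1 \<nu>2. scholtes_KKT f F1 F2 t y \<eta> \<nu>1 \<nu>2) \<longrightarrow> y = x))"
    proof (rule exI[of _ "min dE dU"], intro conjI allI impI)
      fix t assume t: "0 < t \<and> t < min dE dU"
      then obtain x m where xm: "x \<in> ball xb r'" "m \<in> ball mb r'" "kkt_at t x m"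
        using dE(2)[of t] by auto
      obtain \<eta> \<nu>1 \<nu>2 where at: "scholtes_at t x m \<eta> \<nu>1 \<nu>2" using kkt_at_imp_scholtes_at[OF xm(3)] .
      have good: "nondegenerate_scholtes_KKT f F1 F2 t x \<eta> \<nu>1 \<nu>2 \<and>
          quadratic_index f F1 F2 t x \<eta> \<nu>1 \<nu>2 = num_neg_eigenvalues (M xb mb) T + card biactive_neg"
        using dI(2)[OF _ _ _ at] t xm r' by auto
      have "y = x" if y: "y \<in> ball xb (min dU dM)" and K: "scholtes_KKT f F1 F2 t y \<eta>' \<nu>1' \<nu>2'" for y \<eta>' \<nu>1' \<nu>2'
      proof -
        obtain m' where "scholtes_at t y m' \<eta>' \<nu>1' \<nu>2'" using K by (rule scholtes_KKT_imp_scholtes_at)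
        hence k: "kkt_at t y m'" by (rule scholtes_at_imp_kkt_at)
        show ?thesis
          using uniq[of t y x m' m] dM(2)[OF _ _ k] y k xm t r' by auto
      qed
      with good xm(1) r'(2) show "\<exists>x\<in>ball xb r.
         (\<exists>\<eta> \<nu>1 \<nu>2. nondegenerate_scholtes_KKT f F1 F2 t x \<eta> \<nu>1 \<nu>2 \<and>
            quadratic_index f F1 F2 t x \<eta> \<nu>1 \<nu>2 = num_neg_eigenvalues (M xb mb) T + card biactive_neg) \<and>
         (\<forall>y\<in>ball xb (min dU dM). (\<exists>\<eta> \<nu>1 \<nu>2. scholtes_KKT f F1 F2 t y \<eta> \<nu>1 \<nu>2) \<longrightarrow> y = x)"
        by (intro bexI[of _ x]) auto
    qed (use dE dU in simp)
  qed (use dU dM in simp)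
qed

end

lemma sum_if_in_set:
  fixes h :: "'a::finite \<Rightarrow> 'b::comm_monoid_add"
  shows "(\<Sum>j\<in>UNIV. if j \<in> A then h j else 0) = (\<Sum>j\<in>A. h j)"
  by (simp add: sum.If_cases)

theorem theorem2:
  fixes f :: "real^'n \<Rightarrow> real"
    and F1 F2 :: "real^'n \<Rightarrow> real^'k"
    and xb :: "real^'n"
    and \<sigma>1 \<sigma>2 \<rho>1 \<rho>2 :: "'k \<Rightarrow> real"
    and c :: nat
  assumes "C2 f"
    and "\<And>j. C2 (\<lambda>x. F1 x $ j)"
    and "\<And>j. C2 (\<lambda>x. F2 x $ j)"
    and "nondegenerate_C_stationary f F1 F2 xb \<sigma>1 \<sigma>2 \<rho>1 \<rho>2"
    and "C_index f F1 F2 xb \<sigma>1 \<sigma>2 \<rho>1 \<rho>2 = c"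
    and "NDC4 F1 F2 xb \<sigma>1 \<sigma>2"
  shows "\<exists>V. open V \<and> xb \<in> V \<and>
    (\<forall>U. U \<subseteq> V \<and> xb \<in> interior U \<longrightarrow>
      (\<exists>t0>0. \<forall>t. 0 < t \<and> t < t0 \<longrightarrow>
        (\<exists>x\<in>U.
          (\<exists>\<eta> \<nu>1 \<nu>2. nondegenerate_scholtes_KKT f F1 F2 t x \<eta> \<nu>1 \<nu>2 \<and>
             quadratic_index f F1 F2 t x \<eta> \<nu>1 \<nu>2 = c) \<and>
          (\<forall>y\<in>U. (\<exists>\<eta> \<nu>1 \<nu>2. scholtes_KKT f F1 F2 t y \<eta> \<nu>1 \<nu>2) \<longrightarrow> y = x))))"
proof -
  let ?A1 = "a01 F1 F2 xb" and ?A2 = "a10 F1 F2 xb" and ?A0 = "a00 F1 F2 xb"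
  \<comment> \<open>The index sets are disjoint, so at most one summand in each entry differs from 0.\<close>
  define mb :: "real^('k + 'k)" where "mb = (\<chi> i. case i of
      Inl j \<Rightarrow> (if j \<in> ?A1 then \<sigma>1 j else 0) + (if j \<in> ?A0 then \<rho>1 j else 0)
    | Inr j \<Rightarrow> (if j \<in> ?A2 then \<sigma>2 j else 0) + (if j \<in> ?A0 then \<rho>2 j else 0))"
  have feas: "F1 xb $ j * F2 xb $ j = 0" "0 \<le> F1 xb $ j" "0 \<le> F2 xb $ j" for j
    using assms(4) by (auto simp: nondegenerate_C_stationary_def C_stationary_def mpcc_feasible_def)
  have bi: "\<And>j. j \<in> ?A0 \<Longrightarrow> \<rho>1 j * \<rho>2 j > 0"
    using assms(4) by (auto simp: nondegenerate_C_stationary_def)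
  have nz: "\<And>j. j \<in> ?A1 \<Longrightarrow> \<sigma>1 j \<noteq> 0" "\<And>j. j \<in> ?A2 \<Longrightarrow> \<sigma>2 j \<noteq> 0"
    using assms(6) by (auto simp: NDC4_def)
  have mbI: "mb $ Inl j = (if j \<in> ?A1 then \<sigma>1 j else 0) + (if j \<in> ?A0 then \<rho>1 j else 0)"
    "mb $ Inr j = (if j \<in> ?A2 then \<sigma>2 j else 0) + (if j \<in> ?A0 then \<rho>2 j else 0)" for j
    by (simp_all add: mb_def)
  have val: "mb $ Inl j = (if F1 xb $ j = 0 then if F2 xb $ j = 0 then \<rho>1 j else \<sigma>1 j else 0)"
    "mb $ Inr j = (if F2 xb $ j = 0 then if F1 xb $ j = 0 then \<rho>2 j else \<sigma>2 j else 0)" for j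
    using feas[of j] by (auto simp: mbI a01_def a10_def a00_def)
  have sums: "(\<Sum>i\<in>UNIV. mb $ i *\<^sub>R v i) = (\<Sum>j\<in>?A1. \<sigma>1 j *\<^sub>R v (Inl j)) + (\<Sum>j\<in>?A2. \<sigma>2 j *\<^sub>R v (Inr j))
      + (\<Sum>j\<in>?A0. \<rho>1 j *\<^sub>R v (Inl j) + \<rho>2 j *\<^sub>R v (Inr j))" for v :: "'k + 'k \<Rightarrow> 'v::real_vector"
    by (simp add: sum_UNIV_sum mbI scaleR_add_left sum.distrib if_distrib[of "\<lambda>r. r *\<^sub>R _"] sum_if_in_set cong: if_cong)
  interpret regular_pairs f F1 F2 xb mb
  proof
    show "C2 f" "\<And>j. C2 (\<lambda>x. F1 x $ j)" "\<And>j. C2 (\<lambda>x. F2 x $ j)" by (fact assms)+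
    show "0 \<le> comp_fun F1 F2 i xb" for i using feas by (cases i) auto
    show "comp_fun F1 F2 i xb * comp_fun F1 F2 (partner i) xb = 0" for i using feas(1) by (cases i) auto
    show "mb $ i = 0 \<and> mb $ partner i \<noteq> 0" if "comp_fun F1 F2 i xb \<noteq> 0" for i
    proof (cases i)
      case (Inl j)
      with that feas[of j] have "F1 xb $ j \<noteq> 0" "F2 xb $ j = 0" "j \<in> ?A2" by (auto simp: a10_def)
      thus ?thesis using Inl val[of j] nz(2)[of j] by simp
    next
      case (Inr j)
      with that feas[of j] have "F2 xb $ j \<noteq> 0" "F1 xb $ j = 0" "j \<in> ?A1" by (auto simp: a01_def)
      thus ?thesis using Inr val[of j] nz(1)[of j] by simp
    qed
    show "mb $ i * mb $ partner i > 0" if "comp_fun F1 F2 i xb = 0" "comp_fun F1 F2 (partner i) xb = 0" for i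
      using that bi by (cases i) (auto simp: val a00_def mult.commute)
    show "grad f xb = (\<Sum>i\<in>UNIV. mb $ i *\<^sub>R grad (comp_fun F1 F2 i) xb)"
      using assms(4) by (simp add: sums nondegenerate_C_stationary_def C_stationary_def)
  qed
  have I: "I = (?A1 \<union> ?A0) <+> (?A2 \<union> ?A0)"
  proof (intro set_eqI)
    show "i \<in> I \<longleftrightarrow> i \<in> (?A1 \<union> ?A0) <+> (?A2 \<union> ?A0)" for i
      using feas by (cases i) (auto simp: a01_def a10_def a00_def less_le)
  qed
  have family: "(\<lambda>i. grad (comp_fun F1 F2 i) xb) =
      case_sum (\<lambda>j. grad (\<lambda>x. F1 x $ j) xb) (\<lambda>j. grad (\<lambda>x. F2 x $ j) xb)"
  proof
    show "grad (comp_fun F1 F2 i) xb = case_sum (\<lambda>j. grad (\<lambda>x. F1 x $ j) xb) (\<lambda>j. grad (\<lambda>x. F2 x $ j) xb) i" for i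
      by (cases i) auto
  qed
  have T: "T = mpcc_tangent F1 F2 xb"
    unfolding T_def I mpcc_tangent_def by (simp add: Plus_def ball_Un)
  have "mpcc_lagrange f F1 F2 xb \<sigma>1 \<sigma>2 \<rho>1 \<rho>2 = (\<lambda>y. f y - (\<Sum>i\<in>UNIV. mb $ i * G i y))"
    using sums[of "\<lambda>i. G i _"] by (simp add: fun_eq_iff mpcc_lagrange_def)
  hence Lag: "hess (mpcc_lagrange f F1 F2 xb \<sigma>1 \<sigma>2 \<rho>1 \<rho>2) xb = M xb mb"
    by (simp only: mpcc_lagrangian_hessian)
  interpret nondegenerate_pairs f F1 F2 xb mb
  proof
    show "lin_indep_family (\<lambda>i. grad (comp_fun F1 F2 i) xb) I"
      using assms(4) unfolding family I by (simp add: nondegenerate_C_stationary_def mpcc_licq_def)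
    show "restrict_nonsingular (M xb mb) T"
      using assms(4) by (simp add: nondegenerate_C_stationary_def Lag T)
  qed
  have "biactive_neg = {j \<in> ?A0. \<rho>1 j < 0 \<and> \<rho>2 j < 0}"
  proof (intro set_eqI)
    fix j
    show "j \<in> biactive_neg \<longleftrightarrow> j \<in> {j \<in> ?A0. \<rho>1 j < 0 \<and> \<rho>2 j < 0}"
      using bi[of j] by (auto simp: biactive_neg_def neg_pair_def val a00_def zero_less_mult_iff)
  qed
  hence index: "num_neg_eigenvalues (M xb mb) T + card biactive_neg = c"
    using assms(5) by (simp add: C_index_def biactive_index_def Lag T)
  obtain r0 where r0: "r0 > 0" and main: "\<And>r. r > 0 \<Longrightarrow> \<exists>t0>0. \<forall>t. 0 < t \<and> t < t0 \<longrightarrow> (\<exists>x\<in>ball xb r.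
      (\<exists>\<eta> \<nu>1 \<nu>2. nondegenerate_scholtes_KKT f F1 F2 t x \<eta> \<nu>1 \<nu>2 \<and>
         quadratic_index f F1 F2 t x \<eta> \<nu>1 \<nu>2 = c) \<and>
      (\<forall>y\<in>ball xb r0. (\<exists>\<eta> \<nu>1 \<nu>2. scholtes_KKT f F1 F2 t y \<eta> \<nu>1 \<nu>2) \<longrightarrow> y = x))"
    using scholtes_regularisation_well_posed unfolding index by blast
  show ?thesis
  proof (intro exI[of _ "ball xb r0"] conjI allI impI)
    fix U assume U: "U \<subseteq> ball xb r0 \<and> xb \<in> interior U"
    then obtain r where r: "r > 0" "ball xb r \<subseteq> U" by (auto simp: mem_interior)
    show "\<exists>t0>0. \<forall>t. 0 < t \<and> t < t0 \<longrightarrow>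
        (\<exists>x\<in>U.
          (\<exists>\<eta> \<nu>1 \<nu>2. nondegenerate_scholtes_KKT f F1 F2 t x \<eta> \<nu>1 \<nu>2 \<and>
             quadratic_index f F1 F2 t x \<eta> \<nu>1 \<nu>2 = c) \<and>
          (\<forall>y\<in>U. (\<exists>\<eta> \<nu>1 \<nu>2. scholtes_KKT f F1 F2 t y \<eta> \<nu>1 \<nu>2) \<longrightarrow> y = x))"
      using main[OF r(1)] r(2) U by (meson subsetD)
  qed (use r0 in auto)
qed

end
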